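(* Let $k$ be a field of characteristic $0$ containing all roots of unity, let $H\subseteq G$ be an inclusion of finite groups, let $\mathcal V$ be a $k$-linear category, and let $\rho$ be an action of $H$ on $\mathcal V$ (by $k$-linear functors) such that $\mathbb{T}r(\rho(h))$ is finite dimensional for every $h\in H$. Let $\chi$ denote the 2-character of $\rho$. Then the 2-character $\chi_{\mathrm{ind}}$ of the induced 2-representation $\mathrm{ind}|_H^G\,\rho$ of $G$ is given, for every pair $(g,h)$ of commuting elements of $G$, by $$\chi_{\mathrm{ind}}(g,h)=\frac{1}{|H|}\sum_{\substack{s\in G\\ s^{-1}(g,h)s\in H\times H}}\chi(s^{-1}gs,\,s^{-1}hs),$$ where $s^{-1}(g,h)s=(s^{-1}gs,s^{-1}hs)$.
   Context: Group actions. An action (2-representation) $\rho$ of a group $G$ on a category $\mathcal V$ consists of functors $\rho(g):\mathcal V\to\mathcal V$ ($g\in G$), natural isomorphisms $\phi_{g,h}:\rho(g)\circ\rho(h)\Rightarrow\rho(gh)$ ($g,h\in G$) and $\phi_1:\rho(1)\Rightarrow \mathrm{id}_{\mathcal V}$ such that for all $g,h,l\in G$: $\phi_{gh,l}\,(\phi_{g,h}\circ\rho(l))=\phi_{g,hl}\,(\rho(g)\circ\phi_{h,l})$ (this common value is denoted $\phi_{g,h,l}:\rho(g)\rho(h)\rho(l)\Rightarrow\rho(ghl)$), $\phi_{1,g}=\phi_1\circ\rho(g)$ and $\phi_{g,1}=\rho(g)\circ\phi_1$. When $\mathcal V$ is $k$-linear all $\rho(g)$ are $k$-linear functors. Categorical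 trace. For an endofunctor $A:\mathcal V\to\mathcal V$ of a $k$-linear category, $\mathbb{T}r(A)=NT(\mathrm{id}_{\mathcal V},A)$, the $k$-vector space of natural transformations from the identity functor to $A$. 2-character. For an action $\rho$ of $G$ on a $k$-linear category and $f,g\in G$, let $\psi_f(g):\mathbb{T}r(\rho(f))\to\mathbb{T}r(\rho(gfg^{-1}))$ be the linear isomorphism sending $\xi:\mathrm{id}\Rightarrow\rho(f)$ to the composite $$\mathrm{id}\xrightarrow{\phi_{g,g^{-1}}^{-1}\phi_1^{-1}}\rho(g)\rho(g^{-1})\xrightarrow{\rho(g)\circ\xi\circ\rho(g^{-1})}\rho(g)\rho(f)\rho(g^{-1})\xrightarrow{\phi_{g,f,g^{-1}}}\rho(gfg^{-1}).$$ If the spaces $\mathbb{T}r(\rho(g))$ are finite dimensional, the 2-character of $\rho$ is the function on pairs of commuting elements of $G$ given by $\chi_\rho(g,h)=\mathrm{Trace}\{\psi_g(h):\mathbb{T}r(\rho(g))\to\mathbb{T}r(\rho(g))\}$. Induced 2-representation. Given an action $\rho$ of $H$ on $\mathcal V$, $\mathrm{ind}|_H^G(\mathcal V)$ is the category whose objects are maps $f:G\to\mathrm{Ob}\,\mathcal V$ together with isomorphisms $u_{g,h}:f(gh)\to\rho(h^{-1})(f(g))$ for all $g\in G$, $h\in H$, such that $u_{g,1}=\phi_{1,f(g)}^{-1}$ and, for all $g\in G$, $h_1,h_2\in H$, $$u_{g,h_1h_2}=\phi_{h_2^{-1},h_1^{-1}}\circ\rho(h_2^{-1})(u_{g,h_1})\circ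 u_{gh_1,h_2}:\ f(gh_1h_2)\to\rho((h_1h_2)^{-1})(f(g)).$$ A morphism $(f,u)\to(f',u')$ is a system of morphisms $f(g)\to f'(g)$, $g\in G$, commuting with the $u_{g,h}$ and $u'_{g,h}$. The group $G$ acts on the left on this category (strictly) by $(\sigma(g_1)f)(g)=f(g_1^{-1}g)$, $(\sigma(g_1)u)_{g,h}=u_{g_1^{-1}g,h}$. This 2-representation of $G$ is denoted $\mathrm{ind}|_H^G\,\rho$. *)

theory Defs
  imports "Jordan_Normal_Form.VS_Connect" "HOL-Algebra.Algebraic_Closure_Type"
begin

definition contains_all_roots_of_unity :: "'k::field itself \<Rightarrow> bool" where
  "contains_all_roots_of_unity _ \<longleftrightarrow>
     (\<forall>z :: 'k alg_closure. \<forall>n::nat. 0 < n \<and> z ^ n = 1 \<longrightarrow> z \<in> range to_ac)"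


section \<open>Trace of an endomorphism\<close>

definition coordinates :: "('k::field, 'v) module \<Rightarrow> 'v set \<Rightarrow> 'v \<Rightarrow> 'v \<Rightarrow> 'k" where
  "coordinates V B v = (THE c. c \<in> B \<rightarrow>\<^sub>E UNIV \<and> module.lincomb V c B = v)"

(* Independent of the basis chosen; only meaningful for finite-dimensional V. *)
definition lin_trace :: "('k::field, 'v) module \<Rightarrow> ('v \<Rightarrow> 'v) \<Rightarrow> 'k" where
  "lin_trace V T = (let B = (SOME B. finite B \<and> vectorspace.basis class_ring V B)
                    in \<Sum>b\<in>B. coordinates V B (T b) b)"


section \<open>Linear categories, functors and natural transformations\<close>

(* Morphism sets of different pairs of objects may overlap, so composition (and the action of a
   functor on morphisms) is indexed by the objects involved:
   Comp C x y z b a is the composite of a : x -> y followed by b : y -> z. *)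
record ('o, 'm, 'k) lincat =
  Ob :: "'o set"
  Hom :: "'o \<Rightarrow> 'o \<Rightarrow> ('k, 'm) module"
  Id :: "'o \<Rightarrow> 'm"
  Comp :: "'o \<Rightarrow> 'o \<Rightarrow> 'o \<Rightarrow> 'm \<Rightarrow> 'm \<Rightarrow> 'm"

abbreviation mor :: "('o, 'm, 'k) lincat \<Rightarrow> 'o \<Rightarrow> 'o \<Rightarrow> 'm set" where
  "mor C x y \<equiv> carrier (Hom C x y)"

locale linear_category =
  fixes C :: "('o, 'm, 'k::field) lincat"
  assumes vectorspace_Hom: "x \<in> Ob C \<Longrightarrow> y \<in> Ob C \<Longrightarrow> vectorspace class_ring (Hom C x y)"
    and Id_in: "x \<in> Ob C \<Longrightarrow> Id C x \<in> mor C x x"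
    and Comp_linear_left:
      "x \<in> Ob C \<Longrightarrow> y \<in> Ob C \<Longrightarrow> z \<in> Ob C \<Longrightarrow> a \<in> mor C x y \<Longrightarrow>
         (\<lambda>b. Comp C x y z b a) \<in> LinearCombinations.module_hom class_ring (Hom C y z) (Hom C x z)"
    and Comp_linear_right:
      "x \<in> Ob C \<Longrightarrow> y \<in> Ob C \<Longrightarrow> z \<in> Ob C \<Longrightarrow> b \<in> mor C y z \<Longrightarrow>
         (\<lambda>a. Comp C x y z b a) \<in> LinearCombinations.module_hom class_ring (Hom C x y) (Hom C x z)"
    and Comp_assoc:
      "w \<in> Ob C \<Longrightarrow> x \<in> Ob C \<Longrightarrow> y \<in> Ob C \<Longrightarrow> z \<in> Ob C \<Longrightarrow>
         a \<in> mor C w x \<Longrightarrow> b \<in> mor C x y \<Longrightarrow> c \<in> mor C y z \<Longrightarrow>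
         Comp C w x z (Comp C x y z c b) a = Comp C w y z c (Comp C w x y b a)"
    and Comp_Id_left:
      "x \<in> Ob C \<Longrightarrow> y \<in> Ob C \<Longrightarrow> a \<in> mor C x y \<Longrightarrow> Comp C x y y (Id C y) a = a"
    and Comp_Id_right:
      "x \<in> Ob C \<Longrightarrow> y \<in> Ob C \<Longrightarrow> a \<in> mor C x y \<Longrightarrow> Comp C x x y a (Id C x) = a"

definition inverse_of :: "('o, 'm, 'k) lincat \<Rightarrow> 'o \<Rightarrow> 'o \<Rightarrow> 'm \<Rightarrow> 'm \<Rightarrow> bool" where
  "inverse_of C x y a b \<longleftrightarrow>
     a \<in> mor C x y \<and> b \<in> mor C y x \<and> Comp C x y x b a = Id C x \<and> Comp C y x y a b = Id C y"

definition is_iso :: "('o, 'm, 'k) lincat \<Rightarrow> 'o \<Rightarrow> 'o \<Rightarrow> 'm \<Rightarrow> bool" where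
  "is_iso C x y a \<longleftrightarrow> (\<exists>b. inverse_of C x y a b)"

definition inv_mor :: "('o, 'm, 'k) lincat \<Rightarrow> 'o \<Rightarrow> 'o \<Rightarrow> 'm \<Rightarrow> 'm" where
  "inv_mor C x y a = (THE b. inverse_of C x y a b)"

record ('o, 'm) endofunctor =
  OMap :: "'o \<Rightarrow> 'o"
  MMap :: "'o \<Rightarrow> 'o \<Rightarrow> 'm \<Rightarrow> 'm"

definition linear_endofunctor ::
  "('o, 'm, 'k::field) lincat \<Rightarrow> ('o, 'm) endofunctor \<Rightarrow> bool" where
  "linear_endofunctor C F \<longleftrightarrow>
     OMap F \<in> Ob C \<rightarrow> Ob C \<and>
     (\<forall>x\<in>Ob C. \<forall>y\<in>Ob C.
        MMap F x y \<in> LinearCombinations.module_hom class_ring (Hom C x y) (Hom C (OMap F x) (OMap F y))) \<and>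
     (\<forall>x\<in>Ob C. MMap F x x (Id C x) = Id C (OMap F x)) \<and>
     (\<forall>x\<in>Ob C. \<forall>y\<in>Ob C. \<forall>z\<in>Ob C. \<forall>a\<in>mor C x y. \<forall>b\<in>mor C y z.
        MMap F x z (Comp C x y z b a) =
        Comp C (OMap F x) (OMap F y) (OMap F z) (MMap F y z b) (MMap F x y a))"

definition id_functor :: "('o, 'm) endofunctor" where
  "id_functor = \<lparr>OMap = (\<lambda>x. x), MMap = (\<lambda>x y a. a)\<rparr>"

definition comp_functor ::
  "('o, 'm) endofunctor \<Rightarrow> ('o, 'm) endofunctor \<Rightarrow> ('o, 'm) endofunctor" where
  "comp_functor F F' =
     \<lparr>OMap = (\<lambda>x. OMap F (OMap F' x)),
      MMap = (\<lambda>x y a. MMap F (OMap F' x) (OMap F' y) (MMap F' x y a))\<rparr>"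

definition nat_trans ::
  "('o, 'm, 'k) lincat \<Rightarrow> ('o, 'm) endofunctor \<Rightarrow> ('o, 'm) endofunctor \<Rightarrow> ('o \<Rightarrow> 'm) set" where
  "nat_trans C F F' =
     {\<eta> \<in> (\<Pi>\<^sub>E x\<in>Ob C. mor C (OMap F x) (OMap F' x)).
        \<forall>x\<in>Ob C. \<forall>y\<in>Ob C. \<forall>a\<in>mor C x y.
          Comp C (OMap F x) (OMap F y) (OMap F' y) (\<eta> y) (MMap F x y a) =
          Comp C (OMap F x) (OMap F' x) (OMap F' y) (MMap F' x y a) (\<eta> x)}"

definition nat_iso ::
  "('o, 'm, 'k) lincat \<Rightarrow> ('o, 'm) endofunctor \<Rightarrow> ('o, 'm) endofunctor \<Rightarrow> ('o \<Rightarrow> 'm) set" where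
  "nat_iso C F F' =
     {\<eta> \<in> nat_trans C F F'. \<forall>x\<in>Ob C. is_iso C (OMap F x) (OMap F' x) (\<eta> x)}"

(* The ring multiplication and unit fields of the module record play no role in a module. *)
definition cat_trace :: "('o, 'm, 'k) lincat \<Rightarrow> ('o, 'm) endofunctor \<Rightarrow> ('k, 'o \<Rightarrow> 'm) module" where
  "cat_trace C A =
     \<lparr>carrier = nat_trans C id_functor A,
      monoid.mult = undefined, one = undefined,
      zero = (\<lambda>x\<in>Ob C. \<zero>\<^bsub>Hom C x (OMap A x)\<^esub>),
      add = (\<lambda>\<xi> \<eta>. \<lambda>x\<in>Ob C. \<xi> x \<oplus>\<^bsub>Hom C x (OMap A x)\<^esub> \<eta> x),
      module.smult = (\<lambda>c \<xi>. \<lambda>x\<in>Ob C. c \<odot>\<^bsub>Hom C x (OMap A x)\<^esub> \<xi> x)\<rparr>"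


section \<open>Group actions on linear categories and their 2-characters\<close>

record ('g, 'o, 'm) cat_action =
  act :: "'g \<Rightarrow> ('o, 'm) endofunctor"
  phi :: "'g \<Rightarrow> 'g \<Rightarrow> 'o \<Rightarrow> 'm"
  phi1 :: "'o \<Rightarrow> 'm"

abbreviation act_ob :: "('g, 'o, 'm) cat_action \<Rightarrow> 'g \<Rightarrow> 'o \<Rightarrow> 'o" where
  "act_ob \<rho> g \<equiv> OMap (act \<rho> g)"

abbreviation act_mor :: "('g, 'o, 'm) cat_action \<Rightarrow> 'g \<Rightarrow> 'o \<Rightarrow> 'o \<Rightarrow> 'm \<Rightarrow> 'm" where
  "act_mor \<rho> g \<equiv> MMap (act \<rho> g)"

locale linear_action = group G + linear_category C
  for G :: "('g, 'b) monoid_scheme" (structure) and C :: "('o, 'm, 'k::field) lincat" +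
  fixes \<rho> :: "('g, 'o, 'm) cat_action"
  assumes act_functor: "g \<in> carrier G \<Longrightarrow> linear_endofunctor C (act \<rho> g)"
    and phi_nat_iso:
      "g \<in> carrier G \<Longrightarrow> h \<in> carrier G \<Longrightarrow>
         phi \<rho> g h \<in> nat_iso C (comp_functor (act \<rho> g) (act \<rho> h)) (act \<rho> (g \<otimes> h))"
    and phi1_nat_iso: "phi1 \<rho> \<in> nat_iso C (act \<rho> \<one>) id_functor"
    and phi_assoc:
      "g \<in> carrier G \<Longrightarrow> h \<in> carrier G \<Longrightarrow> l \<in> carrier G \<Longrightarrow> x \<in> Ob C \<Longrightarrow>
         Comp C (act_ob \<rho> g (act_ob \<rho> h (act_ob \<rho> l x))) (act_ob \<rho> (g \<otimes> h) (act_ob \<rho> l x))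
             (act_ob \<rho> (g \<otimes> h \<otimes> l) x)
           (phi \<rho> (g \<otimes> h) l x) (phi \<rho> g h (act_ob \<rho> l x)) =
         Comp C (act_ob \<rho> g (act_ob \<rho> h (act_ob \<rho> l x))) (act_ob \<rho> g (act_ob \<rho> (h \<otimes> l) x))
             (act_ob \<rho> (g \<otimes> (h \<otimes> l)) x)
           (phi \<rho> g (h \<otimes> l) x)
           (act_mor \<rho> g (act_ob \<rho> h (act_ob \<rho> l x)) (act_ob \<rho> (h \<otimes> l) x) (phi \<rho> h l x))"
    and phi_one_left:
      "g \<in> carrier G \<Longrightarrow> x \<in> Ob C \<Longrightarrow> phi \<rho> \<one> g x = phi1 \<rho> (act_ob \<rho> g x)"
    and phi_one_right:
      "g \<in> carrier G \<Longrightarrow> x \<in> Ob C \<Longrightarrow>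
         phi \<rho> g \<one> x = act_mor \<rho> g (act_ob \<rho> \<one> x) x (phi1 \<rho> x)"

definition phi3 ::
  "('g, 'b) monoid_scheme \<Rightarrow> ('o, 'm, 'k) lincat \<Rightarrow> ('g, 'o, 'm) cat_action \<Rightarrow>
   'g \<Rightarrow> 'g \<Rightarrow> 'g \<Rightarrow> 'o \<Rightarrow> 'm" where
  "phi3 G C \<rho> g h l x =
     Comp C (act_ob \<rho> g (act_ob \<rho> h (act_ob \<rho> l x))) (act_ob \<rho> (g \<otimes>\<^bsub>G\<^esub> h) (act_ob \<rho> l x))
         (act_ob \<rho> (g \<otimes>\<^bsub>G\<^esub> h \<otimes>\<^bsub>G\<^esub> l) x)
       (phi \<rho> (g \<otimes>\<^bsub>G\<^esub> h) l x) (phi \<rho> g h (act_ob \<rho> l x))"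

(* For xi : id => rho(f), the component at x is the composite
   x -> rho(1) x -> rho(g) rho(g^-1) x -> rho(g) rho(f) rho(g^-1) x -> rho(g f g^-1) x. *)
definition psi ::
  "('g, 'b) monoid_scheme \<Rightarrow> ('o, 'm, 'k) lincat \<Rightarrow> ('g, 'o, 'm) cat_action \<Rightarrow>
   'g \<Rightarrow> 'g \<Rightarrow> ('o \<Rightarrow> 'm) \<Rightarrow> ('o \<Rightarrow> 'm)" where
  "psi G C \<rho> f g \<xi> =
     (\<lambda>x\<in>Ob C.
        let g' = inv\<^bsub>G\<^esub> g;
            x0 = act_ob \<rho> \<one>\<^bsub>G\<^esub> x;
            x1 = act_ob \<rho> g (act_ob \<rho> g' x);
            x2 = act_ob \<rho> g (act_ob \<rho> f (act_ob \<rho> g' x));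
            x3 = act_ob \<rho> (g \<otimes>\<^bsub>G\<^esub> f \<otimes>\<^bsub>G\<^esub> g') x
        in Comp C x x2 x3 (phi3 G C \<rho> g f g' x)
             (Comp C x x1 x2
                (act_mor \<rho> g (act_ob \<rho> g' x) (act_ob \<rho> f (act_ob \<rho> g' x)) (\<xi> (act_ob \<rho> g' x)))
                (Comp C x x0 x1
                   (inv_mor C x1 x0 (phi \<rho> g g' x))
                   (inv_mor C x0 x (phi1 \<rho> x)))))"

(* For commuting g and h one has h g h^-1 = g, so psi_g(h) is an endomorphism of Tr(rho(g)). *)
definition two_character ::
  "('g, 'b) monoid_scheme \<Rightarrow> ('o, 'm, 'k::field) lincat \<Rightarrow> ('g, 'o, 'm) cat_action \<Rightarrow>
   'g \<Rightarrow> 'g \<Rightarrow> 'k" where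
  "two_character G C \<rho> g h = lin_trace (cat_trace C (act \<rho> g)) (psi G C \<rho> g h)"


section \<open>Induced 2-representation\<close>

(* Functions on G and on G x H are taken extensional (undefined outside), so that objects and
   morphisms are determined by their values; the induced action is then strict on the nose. *)
definition ind_ob ::
  "('g, 'b) monoid_scheme \<Rightarrow> 'g set \<Rightarrow> ('o, 'm, 'k) lincat \<Rightarrow> ('g, 'o, 'm) cat_action \<Rightarrow>
   (('g \<Rightarrow> 'o) \<times> ('g \<times> 'g \<Rightarrow> 'm)) set" where
  "ind_ob G H C \<rho> =
     {(f, u).
        f \<in> carrier G \<rightarrow>\<^sub>E Ob C \<and>
        u \<in> (\<Pi>\<^sub>E (g, h) \<in> carrier G \<times> H.
               {a. is_iso C (f (g \<otimes>\<^bsub>G\<^esub> h)) (act_ob \<rho> (inv\<^bsub>G\<^esub> h) (f g)) a}) \<and>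
        (\<forall>g\<in>carrier G.
           u (g, \<one>\<^bsub>G\<^esub>) = inv_mor C (act_ob \<rho> \<one>\<^bsub>G\<^esub> (f g)) (f g) (phi1 \<rho> (f g))) \<and>
        (\<forall>g\<in>carrier G. \<forall>h1\<in>H. \<forall>h2\<in>H.
           let y0 = f (g \<otimes>\<^bsub>G\<^esub> h1 \<otimes>\<^bsub>G\<^esub> h2);
               y1 = act_ob \<rho> (inv\<^bsub>G\<^esub> h2) (f (g \<otimes>\<^bsub>G\<^esub> h1));
               y2 = act_ob \<rho> (inv\<^bsub>G\<^esub> h2) (act_ob \<rho> (inv\<^bsub>G\<^esub> h1) (f g));
               y3 = act_ob \<rho> (inv\<^bsub>G\<^esub> (h1 \<otimes>\<^bsub>G\<^esub> h2)) (f g)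
           in u (g, h1 \<otimes>\<^bsub>G\<^esub> h2) =
              Comp C y0 y2 y3
                (phi \<rho> (inv\<^bsub>G\<^esub> h2) (inv\<^bsub>G\<^esub> h1) (f g))
                (Comp C y0 y1 y2
                   (act_mor \<rho> (inv\<^bsub>G\<^esub> h2) (f (g \<otimes>\<^bsub>G\<^esub> h1)) (act_ob \<rho> (inv\<^bsub>G\<^esub> h1) (f g)) (u (g, h1)))
                   (u (g \<otimes>\<^bsub>G\<^esub> h1, h2))))}"

definition ind_mor ::
  "('g, 'b) monoid_scheme \<Rightarrow> 'g set \<Rightarrow> ('o, 'm, 'k) lincat \<Rightarrow> ('g, 'o, 'm) cat_action \<Rightarrow>
   ('g \<Rightarrow> 'o) \<times> ('g \<times> 'g \<Rightarrow> 'm) \<Rightarrow> ('g \<Rightarrow> 'o) \<times> ('g \<times> 'g \<Rightarrow> 'm) \<Rightarrow> ('g \<Rightarrow> 'm) set" where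
  "ind_mor G H C \<rho> = (\<lambda>(f, u) (f', u').
     {a \<in> (\<Pi>\<^sub>E g\<in>carrier G. mor C (f g) (f' g)).
        \<forall>g\<in>carrier G. \<forall>h\<in>H.
          Comp C (f (g \<otimes>\<^bsub>G\<^esub> h)) (f' (g \<otimes>\<^bsub>G\<^esub> h)) (act_ob \<rho> (inv\<^bsub>G\<^esub> h) (f' g))
            (u' (g, h)) (a (g \<otimes>\<^bsub>G\<^esub> h)) =
          Comp C (f (g \<otimes>\<^bsub>G\<^esub> h)) (act_ob \<rho> (inv\<^bsub>G\<^esub> h) (f g)) (act_ob \<rho> (inv\<^bsub>G\<^esub> h) (f' g))
            (act_mor \<rho> (inv\<^bsub>G\<^esub> h) (f g) (f' g) (a g)) (u (g, h))})"

definition ind_cat ::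
  "('g, 'b) monoid_scheme \<Rightarrow> 'g set \<Rightarrow> ('o, 'm, 'k) lincat \<Rightarrow> ('g, 'o, 'm) cat_action \<Rightarrow>
   (('g \<Rightarrow> 'o) \<times> ('g \<times> 'g \<Rightarrow> 'm), 'g \<Rightarrow> 'm, 'k) lincat" where
  "ind_cat G H C \<rho> =
     \<lparr>Ob = ind_ob G H C \<rho>,
      Hom = (\<lambda>P Q.
        \<lparr>carrier = ind_mor G H C \<rho> P Q,
         monoid.mult = undefined, one = undefined,
         zero = (\<lambda>s\<in>carrier G. \<zero>\<^bsub>Hom C (fst P s) (fst Q s)\<^esub>),
         add = (\<lambda>a b. \<lambda>s\<in>carrier G. a s \<oplus>\<^bsub>Hom C (fst P s) (fst Q s)\<^esub> b s),
         module.smult = (\<lambda>c a. \<lambda>s\<in>carrier G. c \<odot>\<^bsub>Hom C (fst P s) (fst Q s)\<^esub> a s)\<rparr>),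
      Id = (\<lambda>P. \<lambda>s\<in>carrier G. Id C (fst P s)),
      Comp = (\<lambda>P Q R b a. \<lambda>s\<in>carrier G. Comp C (fst P s) (fst Q s) (fst R s) (b s) (a s))\<rparr>"

definition ind_functor ::
  "('g, 'b) monoid_scheme \<Rightarrow> 'g set \<Rightarrow> 'g \<Rightarrow>
   (('g \<Rightarrow> 'o) \<times> ('g \<times> 'g \<Rightarrow> 'm), 'g \<Rightarrow> 'm) endofunctor" where
  "ind_functor G H g1 =
     \<lparr>OMap = (\<lambda>(f, u). (\<lambda>g\<in>carrier G. f (inv\<^bsub>G\<^esub> g1 \<otimes>\<^bsub>G\<^esub> g),
                       \<lambda>(g, h)\<in>carrier G \<times> H. u (inv\<^bsub>G\<^esub> g1 \<otimes>\<^bsub>G\<^esub> g, h))),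
      MMap = (\<lambda>P Q a. \<lambda>g\<in>carrier G. a (inv\<^bsub>G\<^esub> g1 \<otimes>\<^bsub>G\<^esub> g))\<rparr>"

definition ind_action ::
  "('g, 'b) monoid_scheme \<Rightarrow> 'g set \<Rightarrow> ('o, 'm, 'k) lincat \<Rightarrow> ('g, 'o, 'm) cat_action \<Rightarrow>
   ('g, ('g \<Rightarrow> 'o) \<times> ('g \<times> 'g \<Rightarrow> 'm), 'g \<Rightarrow> 'm) cat_action" where
  "ind_action G H C \<rho> =
     \<lparr>act = ind_functor G H,
      phi = (\<lambda>g h. \<lambda>P\<in>ind_ob G H C \<rho>.
               Id (ind_cat G H C \<rho>) (OMap (ind_functor G H (g \<otimes>\<^bsub>G\<^esub> h)) P)),
      phi1 = (\<lambda>P\<in>ind_ob G H C \<rho>. Id (ind_cat G H C \<rho>) P)\<rparr>"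

end

theory Submission
  imports Defs
begin

text \<open>Write \<open>\<sigma>\<close> for the induced action and \<open>s\<^sup>-\<^sup>1gs = \<gamma>\<close>. The formula is a trace computation in the
space \<open>Tr(\<sigma>(g))\<close>, which decomposes along the cosets of \<open>H\<close>. A morphism of the induced category is
determined on a coset \<open>sH\<close> by its value at \<open>s\<close>, and any morphism \<open>f(s) \<rightarrow> f'(s)\<close> of \<open>V\<close> extends uniquely
to a morphism supported on \<open>sH\<close> (\<open>extend\<close>). There are so many of these supported morphisms that they
control a natural transformation \<open>\<xi> : id \<Rightarrow> \<sigma>(g)\<close>. If \<open>\<gamma> \<notin> H\<close>, then \<open>s\<close> and \<open>g\<^sup>-\<^sup>1s\<close> lie in different cosets, and
naturality along the identity of \<open>f(s)\<close> extended by zero kills \<open>\<xi>\<close> at \<open>s\<close>. If \<open>\<gamma> \<in> H\<close>, the structure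
isomorphism of the object turns the value of \<open>\<xi>\<close> at \<open>s\<close> into a morphism \<open>f(s) \<rightarrow> \<rho>(\<gamma>)f(s)\<close> that is natural in
\<open>f(s)\<close>, that is, into an element of \<open>Tr(\<rho>(\<gamma>))\<close>, because every object of \<open>V\<close> is isomorphic to a value
\<open>f(s)\<close>.

This gives linear maps \<open>\<pi>\<^sub>s : Tr(\<sigma>(g)) \<rightarrow> Tr(\<rho>(\<gamma>))\<close> (\<open>trace_component\<close>) and, by extension from \<open>s\<close> to \<open>sH\<close>,
\<open>\<iota>\<^sub>s : Tr(\<rho>(\<gamma>)) \<rightarrow> Tr(\<sigma>(g))\<close> (\<open>trace_extension\<close>), for every \<open>s\<close> with \<open>s\<^sup>-\<^sup>1gs \<in> H\<close>. The composite \<open>\<iota>\<^sub>s\<pi>\<^sub>s\<close> restricts \<open>\<xi>\<close> to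
the coset \<open>sH\<close>, and each coset occurs \<open>|H|\<close> times, so
\<open>id = 1/|H| \<Sum>\<^sub>s \<iota>\<^sub>s\<pi>\<^sub>s\<close> (\<open>trace_resolution\<close>). From cyclicity of the trace,
\<open>trace(\<psi>(h)) = 1/|H| \<Sum>\<^sub>s trace(\<pi>\<^sub>s\<psi>(h)\<iota>\<^sub>s)\<close> (\<open>lin_trace_of_resolution\<close>), which explains the factor \<open>1/|H|\<close> in
front of a sum over all group elements.

It remains to identify the diagonal block \<open>\<pi>\<^sub>s\<psi>(h)\<iota>\<^sub>s\<close> (\<open>component_psi_extension\<close>). The operator \<open>\<psi>(h)\<close> moves the
support \<open>sH\<close> to \<open>hsH\<close>, so the block vanishes unless \<open>s\<^sup>-\<^sup>1hs \<in> H\<close>. In that case the cocycle identities for the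
structure isomorphisms identify it with the operator \<open>\<psi>\<close> of \<open>\<rho>\<close> for the pair \<open>(s\<^sup>-\<^sup>1gs, s\<^sup>-\<^sup>1hs)\<close>
(\<open>psi_from_cocycle\<close>), whose trace is the corresponding value of the 2-character of \<open>\<rho>\<close>.\<close>

section \<open>Traces and resolutions of the identity\<close>

lemma module_homD:
  assumes "f \<in> LinearCombinations.module_hom class_ring M N"
  shows "v \<in> carrier M \<Longrightarrow> f v \<in> carrier N"
    and "v \<in> carrier M \<Longrightarrow> w \<in> carrier M \<Longrightarrow> f (v \<oplus>\<^bsub>M\<^esub> w) = f v \<oplus>\<^bsub>N\<^esub> f w"
    and "v \<in> carrier M \<Longrightarrow> f (c \<odot>\<^bsub>M\<^esub> v) = c \<odot>\<^bsub>N\<^esub> f v"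
  using assms by (auto simp: LinearCombinations.module_hom_def)

lemma module_homI:
  assumes "\<And>v. v \<in> carrier M \<Longrightarrow> f v \<in> carrier N"
    and "\<And>v w. v \<in> carrier M \<Longrightarrow> w \<in> carrier M \<Longrightarrow> f (v \<oplus>\<^bsub>M\<^esub> w) = f v \<oplus>\<^bsub>N\<^esub> f w"
    and "\<And>c v. v \<in> carrier M \<Longrightarrow> f (c \<odot>\<^bsub>M\<^esub> v) = c \<odot>\<^bsub>N\<^esub> f v"
  shows "f \<in> LinearCombinations.module_hom class_ring M N"
  using assms by (auto simp: LinearCombinations.module_hom_def)

lemma vectorspace_zero_smult:
  fixes V :: "('k::field, 'v) module"
  assumes "vectorspace class_ring V" "v \<in> carrier V"
  shows "0 \<odot>\<^bsub>V\<^esub> v = \<zero>\<^bsub>V\<^esub>"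
proof -
  interpret V: vectorspace "class_ring :: 'k ring" V by fact
  show ?thesis using V.lmult_0[OF assms(2)] by simp
qed

lemma module_hom_zero:
  fixes M N :: "('k::field, _) module"
  assumes "f \<in> LinearCombinations.module_hom class_ring M N"
    and "vectorspace class_ring M" "vectorspace class_ring N"
  shows "f \<zero>\<^bsub>M\<^esub> = \<zero>\<^bsub>N\<^esub>"
proof -
  interpret M: vectorspace "class_ring :: 'k ring" M by fact
  have "f (0 \<odot>\<^bsub>M\<^esub> \<zero>\<^bsub>M\<^esub>) = 0 \<odot>\<^bsub>N\<^esub> f \<zero>\<^bsub>M\<^esub>"
    using module_homD(3)[OF assms(1)] by blast
  then show ?thesis
    using assms(1)[THEN module_homD(1)]
    by (simp add: vectorspace_zero_smult[OF assms(2)] vectorspace_zero_smult[OF assms(3)])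
qed

lemma module_hom_compose:
  assumes "f \<in> LinearCombinations.module_hom class_ring M N"
    and "g \<in> LinearCombinations.module_hom class_ring N L"
  shows "(\<lambda>v. g (f v)) \<in> LinearCombinations.module_hom class_ring M L"
  by (rule module_homI) (simp_all add: module_homD[OF assms(1)] module_homD[OF assms(2)])

lemma module_hom_finsum:
  fixes M N :: "('k::field, _) module"
  assumes f: "f \<in> LinearCombinations.module_hom class_ring M N"
    and M: "vectorspace class_ring M" and N: "vectorspace class_ring N"
    and I: "finite I" and g: "g \<in> I \<rightarrow> carrier M"
  shows "f (finsum M g I) = finsum N (\<lambda>i. f (g i)) I"
proof -
  interpret M: vectorspace "class_ring :: 'k ring" M by fact
  interpret N: vectorspace "class_ring :: 'k ring" N by fact
  show ?thesis using I g
  proof (induction I)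
    case empty
    then show ?case using module_hom_zero[OF f M N] by simp
  next
    case (insert i I)
    then have g: "g \<in> I \<rightarrow> carrier M" "g i \<in> carrier M" by auto
    then have "(\<lambda>i. f (g i)) \<in> I \<rightarrow> carrier N" "f (g i) \<in> carrier N"
      using module_homD(1)[OF f] by auto
    with insert g show ?case
      by (simp add: M.finsum_insert N.finsum_insert module_homD(2)[OF f] M.finsum_closed)
  qed
qed

context
  fixes V :: "('k::field, 'v) module" and B :: "'v set"
  assumes V: "vectorspace class_ring V" and B: "finite B" "vectorspace.basis class_ring V B"
begin

interpretation V: vectorspace "class_ring :: 'k ring" V by (fact V)

lemma basis_in_carrier: "B \<subseteq> carrier V"
  using B by (simp add: V.basis_def)

lemma ex1_coordinates:
  assumes "v \<in> carrier V" shows "\<exists>!c. c \<in> B \<rightarrow>\<^sub>E UNIV \<and> V.lincomb c B = v"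
  using V.basis_criterion[OF B(1) basis_in_carrier] B(2) assms by simp

lemma lincomb_coordinates:
  assumes "v \<in> carrier V" shows "V.lincomb (coordinates V B v) B = v"
  using theI'[OF ex1_coordinates[OF assms]] by (simp add: coordinates_def)

lemma coordinates_lincomb:
  assumes "b \<in> B" shows "coordinates V B (V.lincomb c B) b = c b"
proof -
  have eq: "V.lincomb (restrict c B) B = V.lincomb c B"
    by (rule V.lincomb_cong) (use basis_in_carrier in auto)
  have "V.lincomb c B \<in> carrier V"
    by (rule V.lincomb_closed) (use basis_in_carrier in auto)
  then have "coordinates V B (V.lincomb c B) = restrict c B"
    unfolding coordinates_def
    by (intro the1_equality[OF ex1_coordinates]) (auto simp: eq)
  then show ?thesis using assms by simp
qed

lemma coordinates_add:
  assumes "v \<in> carrier V" "w \<in> carrier V" "b \<in> B"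
  shows "coordinates V B (v \<oplus>\<^bsub>V\<^esub> w) b = coordinates V B v b + coordinates V B w b"
proof -
  have "V.lincomb (\<lambda>b. coordinates V B v b + coordinates V B w b) B
      = V.lincomb (coordinates V B v) B \<oplus>\<^bsub>V\<^esub> V.lincomb (coordinates V B w) B"
    using V.lincomb_sum[OF B(1) basis_in_carrier, of "coordinates V B v" "coordinates V B w"] by simp
  then show ?thesis
    using coordinates_lincomb[OF assms(3)] assms(1,2) by (metis lincomb_coordinates)
qed

lemma coordinates_smult:
  assumes "v \<in> carrier V" "b \<in> B"
  shows "coordinates V B (c \<odot>\<^bsub>V\<^esub> v) b = c * coordinates V B v b"
proof -
  have "V.lincomb (\<lambda>b. c * coordinates V B v b) B = c \<odot>\<^bsub>V\<^esub> V.lincomb (coordinates V B v) B"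
    using V.lincomb_smult[OF basis_in_carrier, of "coordinates V B v" c] by simp
  then show ?thesis
    using coordinates_lincomb[OF assms(2)] assms(1) by (metis lincomb_coordinates)
qed

lemma coordinates_finsum:
  assumes "finite I" "g \<in> I \<rightarrow> carrier V" "b \<in> B"
  shows "coordinates V B (finsum V g I) b = (\<Sum>i\<in>I. coordinates V B (g i) b)"
  using assms(1,2)
proof (induction I)
  case empty
  have "coordinates V B (0 \<odot>\<^bsub>V\<^esub> \<zero>\<^bsub>V\<^esub>) b = 0"
    using coordinates_smult[of "\<zero>\<^bsub>V\<^esub>" b 0] assms(3) by simp
  then show ?case by (simp add: vectorspace_zero_smult[OF V])
next
  case (insert i I)
  then show ?case
    using assms(3) by (simp add: V.finsum_insert coordinates_add Pi_def)
qed

end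

text \<open>This is the matrix of a linear map read in two bases. Both traces in the cyclicity law below become
the same double sum of products of such coordinates.\<close>

lemma coordinates_image:
  fixes V :: "('k::field, 'v) module" and W :: "('k, 'w) module"
  assumes V: "vectorspace class_ring V" and B: "finite B" "vectorspace.basis class_ring V B"
    and W: "vectorspace class_ring W" and D: "finite D" "vectorspace.basis class_ring W D"
    and f: "f \<in> LinearCombinations.module_hom class_ring W V"
    and w: "w \<in> carrier W" and b: "b \<in> B"
  shows "coordinates V B (f w) b = (\<Sum>d\<in>D. coordinates W D w d * coordinates V B (f d) b)"
proof -
  interpret V: vectorspace "class_ring :: 'k ring" V by fact
  interpret W: vectorspace "class_ring :: 'k ring" W by fact
  have DW: "D \<subseteq> carrier W" by (rule basis_in_carrier[OF W D])
  then have fd: "d \<in> D \<Longrightarrow> d \<in> carrier W" "d \<in> D \<Longrightarrow> f d \<in> carrier V" for d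
    using module_homD(1)[OF f] by auto
  have "f w = f (finsum W (\<lambda>d. coordinates W D w d \<odot>\<^bsub>W\<^esub> d) D)"
    using lincomb_coordinates[OF W D w] by (simp add: W.lincomb_def)
  also have "\<dots> = finsum V (\<lambda>d. f (coordinates W D w d \<odot>\<^bsub>W\<^esub> d)) D"
    by (rule module_hom_finsum[OF f W V D(1)]) (use fd in auto)
  also have "\<dots> = finsum V (\<lambda>d. coordinates W D w d \<odot>\<^bsub>V\<^esub> f d) D"
    by (rule V.finsum_cong') (use fd module_homD(3)[OF f] in auto)
  finally have "coordinates V B (f w) b
      = (\<Sum>d\<in>D. coordinates V B (coordinates W D w d \<odot>\<^bsub>V\<^esub> f d) b)"
    using coordinates_finsum[OF V B D(1) _ b, of "\<lambda>d. coordinates W D w d \<odot>\<^bsub>V\<^esub> f d"] fd by auto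
  then show ?thesis using coordinates_smult[OF V B _ b] fd by simp
qed

lemma lin_trace_basis:
  fixes V :: "('k::field, 'v) module"
  assumes V: "vectorspace class_ring V" and fd: "vectorspace.fin_dim class_ring V"
  obtains B where "finite B" "vectorspace.basis class_ring V B"
    "\<And>T. lin_trace V T = (\<Sum>b\<in>B. coordinates V B (T b) b)"
proof -
  interpret V: vectorspace "class_ring :: 'k ring" V by fact
  have "\<exists>B. finite B \<and> V.basis B" by (rule V.finite_basis_exists[OF fd])
  from someI_ex[OF this] show thesis by (intro that) (auto simp: lin_trace_def Let_def)
qed

lemma finsum_const_on:
  fixes U :: "('k::field, 'u) module"
  assumes V: "vectorspace class_ring U" and v: "v \<in> carrier U" and I: "finite I"
  shows "finsum U (\<lambda>i. if Q i then v else \<zero>\<^bsub>U\<^esub>) I = of_nat (card {i \<in> I. Q i}) \<odot>\<^bsub>U\<^esub> v"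
proof -
  interpret U: vectorspace "class_ring :: 'k ring" U by fact
  show ?thesis using I
  proof (induction I)
    case empty
    then show ?case by (simp add: vectorspace_zero_smult[OF V v])
  next
    case (insert i I)
    have "{j \<in> insert i I. Q j} = (if Q i then insert i {j \<in> I. Q j} else {j \<in> I. Q j})" by auto
    then show ?case
      using insert v U.smult_one[OF v] U.smult_l_distr[of 1 "of_nat (card {i \<in> I. Q i})" v] U.smult_closed[of "of_nat (card {i \<in> I. Q i})" v]
      by (simp add: U.finsum_insert Pi_def)
  qed
qed

lemma lin_trace_cong:
  fixes V :: "('k::field, 'v) module"
  assumes V: "vectorspace class_ring V" "vectorspace.fin_dim class_ring V"
    and eq: "\<And>v. v \<in> carrier V \<Longrightarrow> f v = f' v"
  shows "lin_trace V f = lin_trace V f'"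
proof -
  obtain B where B: "finite B" "vectorspace.basis class_ring V B"
    and tr: "\<And>T. lin_trace V T = (\<Sum>b\<in>B. coordinates V B (T b) b)"
    using lin_trace_basis[OF V] by blast
  show ?thesis
    unfolding tr using basis_in_carrier[OF V(1) B] eq by (intro sum.cong refl) auto
qed

lemma lin_trace_zero:
  fixes V :: "('k::field, 'v) module"
  assumes V: "vectorspace class_ring V" "vectorspace.fin_dim class_ring V"
  shows "lin_trace V (\<lambda>v. \<zero>\<^bsub>V\<^esub>) = 0"
proof -
  obtain B where B: "finite B" "vectorspace.basis class_ring V B"
    and tr: "\<And>T. lin_trace V T = (\<Sum>b\<in>B. coordinates V B (T b) b)"
    using lin_trace_basis[OF V] by blast
  show ?thesis
    unfolding tr using coordinates_finsum[OF V(1) B, of "{}" "\<lambda>_. \<zero>\<^bsub>V\<^esub>"]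
    by (simp add: abelian_monoid.finsum_empty[OF abelian_group.axioms(1)[OF module.axioms(2)[OF vectorspace.axioms(1)[OF V(1)]]]])
qed

lemma lin_trace_commute:
  fixes V :: "('k::field, 'v) module" and W :: "('k, 'w) module"
  assumes V: "vectorspace class_ring V" "vectorspace.fin_dim class_ring V"
    and W: "vectorspace class_ring W" "vectorspace.fin_dim class_ring W"
    and f: "f \<in> LinearCombinations.module_hom class_ring W V"
    and g: "g \<in> LinearCombinations.module_hom class_ring V W"
  shows "lin_trace V (\<lambda>v. f (g v)) = lin_trace W (\<lambda>w. g (f w))"
proof -
  obtain B where B: "finite B" "vectorspace.basis class_ring V B"
    and trV: "\<And>T. lin_trace V T = (\<Sum>b\<in>B. coordinates V B (T b) b)"
    using lin_trace_basis[OF V] by blast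
  obtain D where D: "finite D" "vectorspace.basis class_ring W D"
    and trW: "\<And>T. lin_trace W T = (\<Sum>d\<in>D. coordinates W D (T d) d)"
    using lin_trace_basis[OF W] by blast
  have gB: "b \<in> B \<Longrightarrow> g b \<in> carrier W" for b
    using basis_in_carrier[OF V(1) B] module_homD(1)[OF g] by auto
  have fD: "d \<in> D \<Longrightarrow> f d \<in> carrier V" for d
    using basis_in_carrier[OF W(1) D] module_homD(1)[OF f] by auto
  have "lin_trace V (\<lambda>v. f (g v))
      = (\<Sum>b\<in>B. \<Sum>d\<in>D. coordinates W D (g b) d * coordinates V B (f d) b)"
    unfolding trV by (intro sum.cong refl coordinates_image[OF V(1) B W(1) D f gB])
  also have "\<dots> = (\<Sum>d\<in>D. \<Sum>b\<in>B. coordinates V B (f d) b * coordinates W D (g b) d)"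
    by (subst sum.swap) (simp add: mult.commute)
  also have "\<dots> = lin_trace W (\<lambda>w. g (f w))"
    unfolding trW by (intro sum.cong refl coordinates_image[OF W(1) D V(1) B g fD, symmetric])
  finally show ?thesis .
qed

text \<open>A resolution of the identity writes the identity of \<open>V\<close> as a multiple of a sum of maps that factor
through the spaces \<open>W i\<close>. The factors need not be projections onto independent summands: an
overcomplete resolution, with the redundancy divided out by \<open>c\<close>, computes traces equally well.\<close>

context
  fixes V :: "('k::field, 'v) module" and W :: "'i \<Rightarrow> ('k, 'w) module"
    and I :: "'i set" and c :: 'k
    and \<iota> :: "'i \<Rightarrow> 'w \<Rightarrow> 'v" and \<pi> :: "'i \<Rightarrow> 'v \<Rightarrow> 'w"
  assumes V: "vectorspace class_ring V" and I: "finite I"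
    and W: "\<And>i. i \<in> I \<Longrightarrow> vectorspace class_ring (W i)"
    and fdW: "\<And>i. i \<in> I \<Longrightarrow> vectorspace.fin_dim class_ring (W i)"
    and \<iota>: "\<And>i. i \<in> I \<Longrightarrow> \<iota> i \<in> LinearCombinations.module_hom class_ring (W i) V"
    and \<pi>: "\<And>i. i \<in> I \<Longrightarrow> \<pi> i \<in> LinearCombinations.module_hom class_ring V (W i)"
    and resolution: "\<And>v. v \<in> carrier V \<Longrightarrow> v = c \<odot>\<^bsub>V\<^esub> finsum V (\<lambda>i. \<iota> i (\<pi> i v)) I"
begin

interpretation V: vectorspace "class_ring :: 'k ring" V by (fact V)

text \<open>The images of bases of the spaces \<open>W i\<close> span \<open>V\<close>.\<close>

lemma fin_dim_of_resolution: "V.fin_dim"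
proof -
  have "\<exists>D. finite D \<and> vectorspace.basis class_ring (W i) D" if "i \<in> I" for i
    by (rule vectorspace.finite_basis_exists[OF W[OF that] fdW[OF that]])
  then obtain D where D: "\<And>i. i \<in> I \<Longrightarrow> finite (D i)"
      "\<And>i. i \<in> I \<Longrightarrow> vectorspace.basis class_ring (W i) (D i)"
    by metis
  let ?A = "\<Union>i\<in>I. \<iota> i ` D i"
  have DW: "D i \<subseteq> carrier (W i)" if "i \<in> I" for i
    by (rule basis_in_carrier[OF W D]) (use that in auto)
  have A: "?A \<subseteq> carrier V" using DW module_homD(1)[OF \<iota>] by fast
  have sub: "submodule class_ring (V.span ?A) V" by (rule V.span_is_submodule[OF A])
  have sum_in: "finsum V g J \<in> V.span ?A"
    if "finite J" "\<And>j. j \<in> J \<Longrightarrow> g j \<in> V.span ?A" for J and g :: "'j \<Rightarrow> 'v"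
    using that
  proof (induction J)
    case empty
    then show ?case using submodule.zero_closed[OF sub] by simp
  next
    case (insert j J)
    then have "g \<in> J \<rightarrow> carrier V" "g j \<in> carrier V" using submodule.subset[OF sub] by auto
    with insert show ?case using submodule.m_closed[OF sub] by (simp add: V.finsum_insert)
  qed
  have \<iota>_in: "\<iota> i w \<in> V.span ?A" if i: "i \<in> I" and w: "w \<in> carrier (W i)" for i w
  proof -
    interpret W: vectorspace "class_ring :: 'k ring" "W i" by (rule W[OF i])
    have "\<iota> i w = \<iota> i (finsum (W i) (\<lambda>d. coordinates (W i) (D i) w d \<odot>\<^bsub>W i\<^esub> d) (D i))"
      using lincomb_coordinates[OF W D w] i by (simp add: W.lincomb_def)
    also have "\<dots> = finsum V (\<lambda>d. \<iota> i (coordinates (W i) (D i) w d \<odot>\<^bsub>W i\<^esub> d)) (D i)"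
      by (rule module_hom_finsum[OF \<iota> W V D(1)]) (use i DW[OF i] W.smult_closed in auto)
    also have "\<dots> \<in> V.span ?A"
    proof (rule sum_in)
      show "\<iota> i (coordinates (W i) (D i) w d \<odot>\<^bsub>W i\<^esub> d) \<in> V.span ?A" if d: "d \<in> D i" for d
      proof -
        have "\<iota> i d \<in> V.span ?A" using V.in_own_span[OF A] i d by auto
        then show ?thesis
          using submodule.smult_closed[OF sub] module_homD(3)[OF \<iota>[OF i]] DW[OF i] d by auto
      qed
    qed (use D i in auto)
    finally show ?thesis .
  qed
  have "carrier V \<subseteq> V.span ?A"
  proof
    fix v assume v: "v \<in> carrier V"
    have "finsum V (\<lambda>i. \<iota> i (\<pi> i v)) I \<in> V.span ?A"
      by (rule sum_in[OF I]) (use \<iota>_in module_homD(1)[OF \<pi>] v in auto)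
    then have "c \<odot>\<^bsub>V\<^esub> finsum V (\<lambda>i. \<iota> i (\<pi> i v)) I \<in> V.span ?A"
      using submodule.smult_closed[OF sub] by simp
    then show "v \<in> V.span ?A" using resolution[OF v] by simp
  qed
  with submodule.subset[OF sub] have "V.span ?A = carrier V" by blast
  moreover have "finite ?A" using I D by blast
  ultimately show ?thesis unfolding V.fin_dim_def using A by blast
qed

text \<open>Insert the resolution to the right of \<open>T\<close>, split the trace into summands, and move each
\<open>\<pi> i\<close> to the front by cyclicity.\<close>

lemma lin_trace_of_resolution:
  assumes T: "T \<in> LinearCombinations.module_hom class_ring V V"
  shows "lin_trace V T = c * (\<Sum>i\<in>I. lin_trace (W i) (\<lambda>w. \<pi> i (T (\<iota> i w))))"
proof -
  obtain B where B: "finite B" "V.basis B"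
    and tr: "\<And>T. lin_trace V T = (\<Sum>b\<in>B. coordinates V B (T b) b)"
    using lin_trace_basis[OF V fin_dim_of_resolution] by blast
  have \<iota>\<pi>: "\<iota> i (\<pi> i v) \<in> carrier V" "T (\<iota> i (\<pi> i v)) \<in> carrier V"
    if "i \<in> I" "v \<in> carrier V" for i v
    using that module_homD(1)[OF \<iota>] module_homD(1)[OF \<pi>] module_homD(1)[OF T] by auto
  have "coordinates V B (T v) b = c * (\<Sum>i\<in>I. coordinates V B (T (\<iota> i (\<pi> i v))) b)"
    if v: "v \<in> carrier V" and b: "b \<in> B" for v b
  proof -
    let ?s = "finsum V (\<lambda>i. \<iota> i (\<pi> i v)) I"
    have s: "?s \<in> carrier V" using \<iota>\<pi>(1) v by (intro V.finsum_closed) auto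
    have "T v = T (c \<odot>\<^bsub>V\<^esub> ?s)" using resolution[OF v] by simp
    also have "\<dots> = c \<odot>\<^bsub>V\<^esub> T ?s" by (rule module_homD(3)[OF T s])
    also have "T ?s = finsum V (\<lambda>i. T (\<iota> i (\<pi> i v))) I"
      by (rule module_hom_finsum[OF T V V I]) (use \<iota>\<pi>(1) v in auto)
    finally have "coordinates V B (T v) b
        = c * coordinates V B (finsum V (\<lambda>i. T (\<iota> i (\<pi> i v))) I) b"
      using coordinates_smult[OF V B _ b, of "finsum V (\<lambda>i. T (\<iota> i (\<pi> i v))) I"] \<iota>\<pi>(2) v
      by (auto intro: V.finsum_closed)
    also have "\<dots> = c * (\<Sum>i\<in>I. coordinates V B (T (\<iota> i (\<pi> i v))) b)"
      by (subst coordinates_finsum[OF V B I _ b]) (use \<iota>\<pi>(2) v in auto)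
    finally show ?thesis .
  qed
  then have "lin_trace V T = (\<Sum>b\<in>B. c * (\<Sum>i\<in>I. coordinates V B (T (\<iota> i (\<pi> i b))) b))"
    unfolding tr by (intro sum.cong refl) (use basis_in_carrier[OF V B] in auto)
  also have "\<dots> = c * (\<Sum>i\<in>I. lin_trace V (\<lambda>v. T (\<iota> i (\<pi> i v))))"
    unfolding tr sum_distrib_left[symmetric] by (subst sum.swap) simp
  also have "\<dots> = c * (\<Sum>i\<in>I. lin_trace (W i) (\<lambda>w. \<pi> i (T (\<iota> i w))))"
    by (intro arg_cong[where f = "(*) c"] sum.cong refl
        lin_trace_commute[OF V fin_dim_of_resolution W fdW module_hom_compose[OF \<iota> T] \<pi>])
  finally show ?thesis .
qed

end

section \<open>Linear categories and categorical traces\<close>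

text \<open>Both the space of natural transformations and the morphism spaces of the induced category are
spaces of extensional families with pointwise operations, cut out by linear conditions.\<close>

lemma vectorspace_pointwise:
  fixes M :: "'i \<Rightarrow> ('k::field, 'v) module"
  assumes M: "\<And>i. i \<in> I \<Longrightarrow> vectorspace class_ring (M i)"
    and S: "S \<subseteq> (\<Pi>\<^sub>E i\<in>I. carrier (M i))"
    and zero: "(\<lambda>i\<in>I. \<zero>\<^bsub>M i\<^esub>) \<in> S"
    and add: "\<And>v w. v \<in> S \<Longrightarrow> w \<in> S \<Longrightarrow> (\<lambda>i\<in>I. v i \<oplus>\<^bsub>M i\<^esub> w i) \<in> S"
    and smult: "\<And>c v. v \<in> S \<Longrightarrow> (\<lambda>i\<in>I. c \<odot>\<^bsub>M i\<^esub> v i) \<in> S"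
  shows "vectorspace class_ring
     \<lparr>carrier = S, monoid.mult = m, one = e, zero = (\<lambda>i\<in>I. \<zero>\<^bsub>M i\<^esub>),
      add = (\<lambda>v w. \<lambda>i\<in>I. v i \<oplus>\<^bsub>M i\<^esub> w i),
      module.smult = (\<lambda>c v. \<lambda>i\<in>I. c \<odot>\<^bsub>M i\<^esub> v i)\<rparr>" (is "vectorspace ?K ?L")
proof -
  have mem: "v \<in> S \<Longrightarrow> i \<in> I \<Longrightarrow> v i \<in> carrier (M i)" for v i
    using S by (auto simp: PiE_iff)
  have eqI: "v = w" if "v \<in> extensional I" "w \<in> S" "\<And>i. i \<in> I \<Longrightarrow> v i = w i" for v w
    using that S by (intro extensionalityI[where A = I]) (auto simp: PiE_iff)
  have M': "Module.module ?K (M i)" "abelian_group (M i)" if "i \<in> I" for i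
    using M[OF that] by (auto simp: vectorspace_def Module.module_def)
  have ag: "\<And>i x y z. i \<in> I \<Longrightarrow> x \<in> carrier (M i) \<Longrightarrow> y \<in> carrier (M i) \<Longrightarrow> z \<in> carrier (M i)
      \<Longrightarrow> (x \<oplus>\<^bsub>M i\<^esub> y) \<oplus>\<^bsub>M i\<^esub> z = x \<oplus>\<^bsub>M i\<^esub> (y \<oplus>\<^bsub>M i\<^esub> z)"
    and ac: "\<And>i x y. i \<in> I \<Longrightarrow> x \<in> carrier (M i) \<Longrightarrow> y \<in> carrier (M i) \<Longrightarrow> x \<oplus>\<^bsub>M i\<^esub> y = y \<oplus>\<^bsub>M i\<^esub> x"
    and a0: "\<And>i x. i \<in> I \<Longrightarrow> x \<in> carrier (M i) \<Longrightarrow> x \<oplus>\<^bsub>M i\<^esub> \<zero>\<^bsub>M i\<^esub> = x"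
    using M'(2) by (auto simp: abelian_group_def abelian_monoid.a_assoc abelian_monoid.a_comm abelian_monoid.r_zero)
  note ms = Module.module.smult_l_distr[OF M'(1), simplified] Module.module.smult_r_distr[OF M'(1), simplified]
    Module.module.smult_assoc1[OF M'(1), simplified] Module.module.smult_one[OF M'(1), simplified]
  have neg: "x \<oplus>\<^bsub>M i\<^esub> ((-1) \<odot>\<^bsub>M i\<^esub> x) = \<zero>\<^bsub>M i\<^esub>" if "i \<in> I" "x \<in> carrier (M i)" for i x
    using ms(1)[OF that, of 1 "-1"] ms(4)[OF that] vectorspace_zero_smult[OF M that(2)] that(1)
    by simp
  have "Module.module ?K ?L"
  proof (rule module_criteria, goal_cases)
    case 1 then show ?case by (rule class_cring.is_cring)
  next
    case 2 then show ?case using zero by simp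
  next
    case 3 then show ?case using add by simp
  next
    case 4
    show ?case
    proof
      fix v assume "v \<in> carrier ?L"
      then have v: "v \<in> S" by simp
      have "v \<oplus>\<^bsub>?L\<^esub> (\<lambda>i\<in>I. (-1) \<odot>\<^bsub>M i\<^esub> v i) = \<zero>\<^bsub>?L\<^esub>"
        using v mem neg by (auto intro!: restrict_ext)
      then show "\<exists>w\<in>carrier ?L. v \<oplus>\<^bsub>?L\<^esub> w = \<zero>\<^bsub>?L\<^esub>"
        using smult[OF v, of "-1"] by (intro bexI[of _ "\<lambda>i\<in>I. (-1) \<odot>\<^bsub>M i\<^esub> v i"]) auto
    qed
  next
    case 5 then show ?case using smult by simp
  next
    case 6 then show ?case using ac mem by (auto intro!: restrict_ext)
  next
    case 7 then show ?case using ag mem by (auto intro!: restrict_ext)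
  next
    case 8 then show ?case
      using a0 mem by (auto intro!: eqI)
  next
    case 9 then show ?case using ms mem by (auto intro!: restrict_ext)
  next
    case 10 then show ?case
      using ms mem by (auto intro!: eqI)
  next
    case 11 then show ?case using ms mem by (auto intro!: restrict_ext)
  next
    case 12 then show ?case using ms mem by (auto intro!: restrict_ext)
  qed
  then show ?thesis by (intro vectorspace.intro class_field)
qed

context linear_category
begin

lemma Comp_in [simp, intro]:
  assumes "x \<in> Ob C" "y \<in> Ob C" "z \<in> Ob C" "a \<in> mor C x y" "b \<in> mor C y z"
  shows "Comp C x y z b a \<in> mor C x z"
  using module_homD(1)[OF Comp_linear_left] assms by blast

declare Id_in [simp, intro] Comp_Id_left [simp] Comp_Id_right [simp]

lemma Hom_closed [simp, intro]:
  assumes "x \<in> Ob C" "y \<in> Ob C"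
  shows "\<zero>\<^bsub>Hom C x y\<^esub> \<in> mor C x y"
    and "a \<in> mor C x y \<Longrightarrow> b \<in> mor C x y \<Longrightarrow> a \<oplus>\<^bsub>Hom C x y\<^esub> b \<in> mor C x y"
    and "a \<in> mor C x y \<Longrightarrow> c \<odot>\<^bsub>Hom C x y\<^esub> a \<in> mor C x y"
proof -
  interpret vectorspace "class_ring :: 'k ring" "Hom C x y" by (rule vectorspace_Hom[OF assms])
  show "\<zero>\<^bsub>Hom C x y\<^esub> \<in> mor C x y"
    and "a \<in> mor C x y \<Longrightarrow> b \<in> mor C x y \<Longrightarrow> a \<oplus>\<^bsub>Hom C x y\<^esub> b \<in> mor C x y"
    and "a \<in> mor C x y \<Longrightarrow> c \<odot>\<^bsub>Hom C x y\<^esub> a \<in> mor C x y"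
    by auto
qed

lemma Comp_add_left:
  assumes "x \<in> Ob C" "y \<in> Ob C" "z \<in> Ob C" "a \<in> mor C x y" "b \<in> mor C y z" "b' \<in> mor C y z"
  shows "Comp C x y z (b \<oplus>\<^bsub>Hom C y z\<^esub> b') a = Comp C x y z b a \<oplus>\<^bsub>Hom C x z\<^esub> Comp C x y z b' a"
  using module_homD(2)[OF Comp_linear_left] assms by blast

lemma Comp_smult_left:
  assumes "x \<in> Ob C" "y \<in> Ob C" "z \<in> Ob C" "a \<in> mor C x y" "b \<in> mor C y z"
  shows "Comp C x y z (c \<odot>\<^bsub>Hom C y z\<^esub> b) a = c \<odot>\<^bsub>Hom C x z\<^esub> Comp C x y z b a"
  using module_homD(3)[OF Comp_linear_left] assms by blast

lemma Comp_zero_left: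
  assumes "x \<in> Ob C" "y \<in> Ob C" "z \<in> Ob C" "a \<in> mor C x y"
  shows "Comp C x y z \<zero>\<^bsub>Hom C y z\<^esub> a = \<zero>\<^bsub>Hom C x z\<^esub>"
  using module_hom_zero[OF Comp_linear_left] vectorspace_Hom assms by blast

lemma Comp_add_right:
  assumes "x \<in> Ob C" "y \<in> Ob C" "z \<in> Ob C" "a \<in> mor C x y" "a' \<in> mor C x y" "b \<in> mor C y z"
  shows "Comp C x y z b (a \<oplus>\<^bsub>Hom C x y\<^esub> a') = Comp C x y z b a \<oplus>\<^bsub>Hom C x z\<^esub> Comp C x y z b a'"
  using module_homD(2)[OF Comp_linear_right] assms by blast

lemma Comp_smult_right:
  assumes "x \<in> Ob C" "y \<in> Ob C" "z \<in> Ob C" "a \<in> mor C x y" "b \<in> mor C y z"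
  shows "Comp C x y z b (c \<odot>\<^bsub>Hom C x y\<^esub> a) = c \<odot>\<^bsub>Hom C x z\<^esub> Comp C x y z b a"
  using module_homD(3)[OF Comp_linear_right] assms by blast

lemma Comp_zero_right:
  assumes "x \<in> Ob C" "y \<in> Ob C" "z \<in> Ob C" "b \<in> mor C y z"
  shows "Comp C x y z b \<zero>\<^bsub>Hom C x y\<^esub> = \<zero>\<^bsub>Hom C x z\<^esub>"
  using module_hom_zero[OF Comp_linear_right] vectorspace_Hom assms by blast

lemmas Comp_linear_simps = Comp_add_left Comp_smult_left Comp_zero_left
  Comp_add_right Comp_smult_right Comp_zero_right

lemma inverse_of_unique:
  assumes "x \<in> Ob C" "y \<in> Ob C" "inverse_of C x y a b" "inverse_of C x y a b'"
  shows "b = b'"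
proof -
  have "b = Comp C y x x (Comp C x y x b' a) b"
    using assms by (simp add: inverse_of_def)
  also have "\<dots> = Comp C y y x b' (Comp C y x y a b)"
    using assms by (intro Comp_assoc) (auto simp: inverse_of_def)
  also have "\<dots> = b'" using assms by (simp add: inverse_of_def)
  finally show ?thesis .
qed

lemma inv_mor_eqI:
  assumes "x \<in> Ob C" "y \<in> Ob C" "inverse_of C x y a b"
  shows "inv_mor C x y a = b"
  unfolding inv_mor_def using assms inverse_of_unique by blast

lemma is_iso_in: "is_iso C x y a \<Longrightarrow> a \<in> mor C x y"
  by (auto simp: is_iso_def inverse_of_def)

lemma
  assumes "x \<in> Ob C" "y \<in> Ob C" "is_iso C x y a"
  shows inv_mor_in: "inv_mor C x y a \<in> mor C y x"
    and inv_mor_left: "Comp C x y x (inv_mor C x y a) a = Id C x"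
    and inv_mor_right: "Comp C y x y a (inv_mor C x y a) = Id C y"
    and is_iso_inv_mor: "is_iso C y x (inv_mor C x y a)"
proof -
  obtain b where b: "inverse_of C x y a b" using assms(3) by (auto simp: is_iso_def)
  then have "inv_mor C x y a = b" using assms by (intro inv_mor_eqI)
  then show "inv_mor C x y a \<in> mor C y x" "Comp C x y x (inv_mor C x y a) a = Id C x"
    "Comp C y x y a (inv_mor C x y a) = Id C y" "is_iso C y x (inv_mor C x y a)"
    using b by (auto simp: inverse_of_def is_iso_def)
qed

lemma is_iso_Comp:
  assumes "x \<in> Ob C" "y \<in> Ob C" "z \<in> Ob C" "is_iso C x y a" "is_iso C y z b"
  shows "is_iso C x z (Comp C x y z b a)"
proof -
  note [simp] = is_iso_in[OF assms(4)] is_iso_in[OF assms(5)]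
    inv_mor_in[OF assms(1,2,4)] inv_mor_in[OF assms(2,3,5)]
  let ?a = "inv_mor C x y a" and ?b = "inv_mor C y z b"
  have "Comp C x z x (Comp C z y x ?a ?b) (Comp C x y z b a) = Id C x"
  proof -
    have "Comp C x z x (Comp C z y x ?a ?b) (Comp C x y z b a)
        = Comp C x y x ?a (Comp C x z y ?b (Comp C x y z b a))"
      using assms by (simp add: Comp_assoc)
    also have "Comp C x z y ?b (Comp C x y z b a) = Comp C x y y (Comp C y z y ?b b) a"
      using assms by (simp add: Comp_assoc)
    finally show ?thesis using assms by (simp add: inv_mor_left)
  qed
  moreover have "Comp C z x z (Comp C x y z b a) (Comp C z y x ?a ?b) = Id C z"
  proof -
    have "Comp C z x z (Comp C x y z b a) (Comp C z y x ?a ?b)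
        = Comp C z y z b (Comp C z x y a (Comp C z y x ?a ?b))"
      using assms by (simp add: Comp_assoc)
    also have "Comp C z x y a (Comp C z y x ?a ?b) = Comp C z y y (Comp C y x y a ?a) ?b"
      using assms by (simp add: Comp_assoc)
    finally show ?thesis using assms by (simp add: inv_mor_right)
  qed
  ultimately have "inverse_of C x z (Comp C x y z b a) (Comp C z y x ?a ?b)"
    using assms by (simp add: inverse_of_def)
  then show ?thesis by (auto simp: is_iso_def)
qed

lemma iso_cancel_left:
  assumes "x \<in> Ob C" "y \<in> Ob C" "z \<in> Ob C" "is_iso C y z b" "a \<in> mor C x y" "a' \<in> mor C x y"
    and "Comp C x y z b a = Comp C x y z b a'"
  shows "a = a'"
proof -
  note [simp] = is_iso_in[OF assms(4)] inv_mor_in[OF assms(2,3,4)] inv_mor_left[OF assms(2,3,4)]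
  have "Comp C x y y (Comp C y z y (inv_mor C y z b) b) a
      = Comp C x y y (Comp C y z y (inv_mor C y z b) b) a'"
    using assms(1-3,5-7) by (simp only: Comp_assoc is_iso_in[OF assms(4)] inv_mor_in[OF assms(2,3,4)])
  then show ?thesis using assms by simp
qed

lemma comp_inv_left:
  assumes "x \<in> Ob C" "y \<in> Ob C" "z \<in> Ob C" "is_iso C y z b" "a \<in> mor C x y"
  shows "Comp C x z y (inv_mor C y z b) (Comp C x y z b a) = a"
  using assms Comp_assoc[of x y z y a b "inv_mor C y z b"]
  by (simp add: is_iso_in inv_mor_in inv_mor_left)

lemma comp_inv_right:
  assumes "x \<in> Ob C" "y \<in> Ob C" "z \<in> Ob C" "is_iso C y z b" "a \<in> mor C x z"
  shows "Comp C x y z b (Comp C x z y (inv_mor C y z b) a) = a"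
  using assms Comp_assoc[of x z y z a "inv_mor C y z b" b]
  by (simp add: is_iso_in inv_mor_in inv_mor_right)

lemma inv_mor_Id: "x \<in> Ob C \<Longrightarrow> inv_mor C x x (Id C x) = Id C x"
  by (auto intro!: inv_mor_eqI simp: inverse_of_def)

lemma linear_endofunctorD:
  assumes "linear_endofunctor C F"
  shows "x \<in> Ob C \<Longrightarrow> OMap F x \<in> Ob C"
    and "x \<in> Ob C \<Longrightarrow> y \<in> Ob C \<Longrightarrow> a \<in> mor C x y \<Longrightarrow> MMap F x y a \<in> mor C (OMap F x) (OMap F y)"
    and "x \<in> Ob C \<Longrightarrow> y \<in> Ob C \<Longrightarrow> a \<in> mor C x y \<Longrightarrow> b \<in> mor C x y \<Longrightarrow>
      MMap F x y (a \<oplus>\<^bsub>Hom C x y\<^esub> b) = MMap F x y a \<oplus>\<^bsub>Hom C (OMap F x) (OMap F y)\<^esub> MMap F x y b"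
    and "x \<in> Ob C \<Longrightarrow> y \<in> Ob C \<Longrightarrow> a \<in> mor C x y \<Longrightarrow>
      MMap F x y (c \<odot>\<^bsub>Hom C x y\<^esub> a) = c \<odot>\<^bsub>Hom C (OMap F x) (OMap F y)\<^esub> MMap F x y a"
    and "x \<in> Ob C \<Longrightarrow> y \<in> Ob C \<Longrightarrow> MMap F x y \<zero>\<^bsub>Hom C x y\<^esub> = \<zero>\<^bsub>Hom C (OMap F x) (OMap F y)\<^esub>"
    and "x \<in> Ob C \<Longrightarrow> MMap F x x (Id C x) = Id C (OMap F x)"
    and "x \<in> Ob C \<Longrightarrow> y \<in> Ob C \<Longrightarrow> z \<in> Ob C \<Longrightarrow> a \<in> mor C x y \<Longrightarrow> b \<in> mor C y z \<Longrightarrow>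
      MMap F x z (Comp C x y z b a) =
        Comp C (OMap F x) (OMap F y) (OMap F z) (MMap F y z b) (MMap F x y a)"
proof -
  have O: "x \<in> Ob C \<Longrightarrow> OMap F x \<in> Ob C" for x using assms by (auto simp: linear_endofunctor_def)
  have hom: "x \<in> Ob C \<Longrightarrow> y \<in> Ob C \<Longrightarrow>
      MMap F x y \<in> LinearCombinations.module_hom class_ring (Hom C x y) (Hom C (OMap F x) (OMap F y))" for x y
    using assms by (auto simp: linear_endofunctor_def)
  show "x \<in> Ob C \<Longrightarrow> OMap F x \<in> Ob C"
    "x \<in> Ob C \<Longrightarrow> MMap F x x (Id C x) = Id C (OMap F x)"
    "x \<in> Ob C \<Longrightarrow> y \<in> Ob C \<Longrightarrow> z \<in> Ob C \<Longrightarrow> a \<in> mor C x y \<Longrightarrow> b \<in> mor C y z \<Longrightarrow>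
      MMap F x z (Comp C x y z b a) =
        Comp C (OMap F x) (OMap F y) (OMap F z) (MMap F y z b) (MMap F x y a)"
    using assms by (auto simp: linear_endofunctor_def)
  show "x \<in> Ob C \<Longrightarrow> y \<in> Ob C \<Longrightarrow> a \<in> mor C x y \<Longrightarrow> MMap F x y a \<in> mor C (OMap F x) (OMap F y)"
    using module_homD(1)[OF hom] by blast
  show "x \<in> Ob C \<Longrightarrow> y \<in> Ob C \<Longrightarrow> a \<in> mor C x y \<Longrightarrow> b \<in> mor C x y \<Longrightarrow>
      MMap F x y (a \<oplus>\<^bsub>Hom C x y\<^esub> b) = MMap F x y a \<oplus>\<^bsub>Hom C (OMap F x) (OMap F y)\<^esub> MMap F x y b"
    using module_homD(2)[OF hom] by blast
  show "x \<in> Ob C \<Longrightarrow> y \<in> Ob C \<Longrightarrow> a \<in> mor C x y \<Longrightarrow>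
      MMap F x y (c \<odot>\<^bsub>Hom C x y\<^esub> a) = c \<odot>\<^bsub>Hom C (OMap F x) (OMap F y)\<^esub> MMap F x y a"
    using module_homD(3)[OF hom] by blast
  show "x \<in> Ob C \<Longrightarrow> y \<in> Ob C \<Longrightarrow> MMap F x y \<zero>\<^bsub>Hom C x y\<^esub> = \<zero>\<^bsub>Hom C (OMap F x) (OMap F y)\<^esub>"
    using module_hom_zero[OF hom vectorspace_Hom vectorspace_Hom] O by blast
qed

lemma functor_is_iso:
  assumes F: "linear_endofunctor C F" and "x \<in> Ob C" "y \<in> Ob C" "is_iso C x y a"
  shows "is_iso C (OMap F x) (OMap F y) (MMap F x y a)"
proof -
  note F = linear_endofunctorD[OF F]
  have "inverse_of C (OMap F x) (OMap F y) (MMap F x y a) (MMap F y x (inv_mor C x y a))"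
    unfolding inverse_of_def
    using assms(2-) F(2) F(7)[of x y x a "inv_mor C x y a"] F(7)[of y x y "inv_mor C x y a" a]
    by (auto simp: F(6) is_iso_in inv_mor_in inv_mor_left inv_mor_right)
  then show ?thesis by (auto simp: is_iso_def)
qed

lemma Hom_zero_simps:
  assumes "x \<in> Ob C" "y \<in> Ob C"
  shows "\<zero>\<^bsub>Hom C x y\<^esub> \<oplus>\<^bsub>Hom C x y\<^esub> \<zero>\<^bsub>Hom C x y\<^esub> = \<zero>\<^bsub>Hom C x y\<^esub>"
    and "c \<odot>\<^bsub>Hom C x y\<^esub> \<zero>\<^bsub>Hom C x y\<^esub> = \<zero>\<^bsub>Hom C x y\<^esub>"
proof -
  interpret vectorspace "class_ring :: 'k ring" "Hom C x y" by (rule vectorspace_Hom[OF assms])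
  show "\<zero>\<^bsub>Hom C x y\<^esub> \<oplus>\<^bsub>Hom C x y\<^esub> \<zero>\<^bsub>Hom C x y\<^esub> = \<zero>\<^bsub>Hom C x y\<^esub>" by simp
  show "c \<odot>\<^bsub>Hom C x y\<^esub> \<zero>\<^bsub>Hom C x y\<^esub> = \<zero>\<^bsub>Hom C x y\<^esub>" using smult_r_null[of c] by simp
qed

text \<open>Naturality of a composite of several transformations is obtained by pasting their naturality squares.\<close>

lemma paste_squares:
  assumes "x0 \<in> Ob C" "x1 \<in> Ob C" "x2 \<in> Ob C" "y0 \<in> Ob C" "y1 \<in> Ob C" "y2 \<in> Ob C"
    and "p1 \<in> mor C x0 x1" "p2 \<in> mor C x1 x2" "q1 \<in> mor C y0 y1" "q2 \<in> mor C y1 y2"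
    and "f0 \<in> mor C x0 y0" "f1 \<in> mor C x1 y1" "f2 \<in> mor C x2 y2"
    and sq1: "Comp C x0 y0 y1 q1 f0 = Comp C x0 x1 y1 f1 p1"
    and sq2: "Comp C x1 y1 y2 q2 f1 = Comp C x1 x2 y2 f2 p2"
  shows "Comp C x0 y0 y2 (Comp C y0 y1 y2 q2 q1) f0 = Comp C x0 x2 y2 f2 (Comp C x0 x1 x2 p2 p1)"
proof -
  have "Comp C x0 y0 y2 (Comp C y0 y1 y2 q2 q1) f0 = Comp C x0 x1 y2 (Comp C x1 y1 y2 q2 f1) p1"
    using assms(1-13) by (simp add: Comp_assoc sq1)
  also have "\<dots> = Comp C x0 x2 y2 f2 (Comp C x0 x1 x2 p2 p1)"
    unfolding sq2 using assms(1-13) by (simp add: Comp_assoc)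
  finally show ?thesis .
qed

lemma inverse_square:
  assumes "x \<in> Ob C" "x' \<in> Ob C" "y \<in> Ob C" "y' \<in> Ob C"
    and p: "is_iso C x x' p" and q: "is_iso C y y' q" and f: "f \<in> mor C x y" "f' \<in> mor C x' y'"
    and sq: "Comp C x y y' q f = Comp C x x' y' f' p"
  shows "Comp C x' y' y (inv_mor C y y' q) f' = Comp C x' x y f (inv_mor C x x' p)"
proof -
  let ?p = "inv_mor C x x' p" and ?q = "inv_mor C y y' q"
  note [simp] = assms(1-4) f is_iso_in[OF p] is_iso_in[OF q] inv_mor_in[OF assms(1,2) p] inv_mor_in[OF assms(3,4) q]
  have "Comp C x' y' y ?q f' = Comp C x' y' y ?q (Comp C x' x y' (Comp C x x' y' f' p) ?p)"
    by (simp add: Comp_assoc inv_mor_right p)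
  also have "\<dots> = Comp C x' y' y ?q (Comp C x' y y' q (Comp C x' x y f ?p))"
    by (simp add: Comp_assoc flip: sq)
  also have "\<dots> = Comp C x' x y f ?p" by (rule comp_inv_left) (simp_all add: q)
  finally show ?thesis .
qed

lemma trace_elementD:
  assumes "\<xi> \<in> carrier (cat_trace C A)"
  shows "\<xi> \<in> extensional (Ob C)"
    and "x \<in> Ob C \<Longrightarrow> \<xi> x \<in> mor C x (OMap A x)"
    and "x \<in> Ob C \<Longrightarrow> y \<in> Ob C \<Longrightarrow> a \<in> mor C x y \<Longrightarrow>
      Comp C x y (OMap A y) (\<xi> y) a = Comp C x (OMap A x) (OMap A y) (MMap A x y a) (\<xi> x)"
  using assms by (auto simp: cat_trace_def nat_trans_def id_functor_def PiE_iff)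

lemma trace_elementI:
  assumes "\<xi> \<in> extensional (Ob C)"
    and "\<And>x. x \<in> Ob C \<Longrightarrow> \<xi> x \<in> mor C x (OMap A x)"
    and "\<And>x y a. x \<in> Ob C \<Longrightarrow> y \<in> Ob C \<Longrightarrow> a \<in> mor C x y \<Longrightarrow>
      Comp C x y (OMap A y) (\<xi> y) a = Comp C x (OMap A x) (OMap A y) (MMap A x y a) (\<xi> x)"
  shows "\<xi> \<in> carrier (cat_trace C A)"
  using assms by (auto simp: cat_trace_def nat_trans_def id_functor_def PiE_iff)

lemma trace_element_eqI:
  assumes "\<xi> \<in> carrier (cat_trace C A)" "\<eta> \<in> carrier (cat_trace C A)"
    and "\<And>x. x \<in> Ob C \<Longrightarrow> \<xi> x = \<eta> x"
  shows "\<xi> = \<eta>"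
  using trace_elementD(1)[OF assms(1)] trace_elementD(1)[OF assms(2)] assms(3)
  by (rule extensionalityI)

lemma vectorspace_cat_trace:
  assumes A: "linear_endofunctor C A"
  shows "vectorspace class_ring (cat_trace C A)"
  unfolding cat_trace_def
proof (rule vectorspace_pointwise)
  note A = linear_endofunctorD[OF A]
  show "nat_trans C id_functor A \<subseteq> (\<Pi>\<^sub>E x\<in>Ob C. mor C x (OMap A x))"
    by (auto simp: nat_trans_def id_functor_def)
  show "vectorspace class_ring (Hom C x (OMap A x))" if "x \<in> Ob C" for x
    using that by (simp add: vectorspace_Hom A)
  have tr: "nat_trans C id_functor A = carrier (cat_trace C A)" by (simp add: cat_trace_def)
  show "(\<lambda>x\<in>Ob C. \<zero>\<^bsub>Hom C x (OMap A x)\<^esub>) \<in> nat_trans C id_functor A"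
    unfolding tr by (rule trace_elementI) (auto simp: A Comp_linear_simps)
  show "(\<lambda>x\<in>Ob C. \<xi> x \<oplus>\<^bsub>Hom C x (OMap A x)\<^esub> \<eta> x) \<in> nat_trans C id_functor A"
    if "\<xi> \<in> nat_trans C id_functor A" "\<eta> \<in> nat_trans C id_functor A" for \<xi> \<eta>
    using trace_elementD(2-)[OF that(1)[unfolded tr]] trace_elementD(2-)[OF that(2)[unfolded tr]]
    unfolding tr by (intro trace_elementI) (auto simp: A Comp_linear_simps)
  show "(\<lambda>x\<in>Ob C. c \<odot>\<^bsub>Hom C x (OMap A x)\<^esub> \<xi> x) \<in> nat_trans C id_functor A"
    if "\<xi> \<in> nat_trans C id_functor A" for c \<xi>
    using trace_elementD(2-)[OF that[unfolded tr]]
    unfolding tr by (intro trace_elementI) (auto simp: A Comp_linear_simps)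
qed

text \<open>Evaluations reduce identities between sums in the trace to identities between sums of morphisms.\<close>

lemma eval_trace_module_hom:
  assumes "x \<in> Ob C"
  shows "(\<lambda>\<xi>. \<xi> x) \<in> LinearCombinations.module_hom class_ring (cat_trace C A) (Hom C x (OMap A x))"
proof (rule module_homI)
  show "\<xi> x \<in> mor C x (OMap A x)" if "\<xi> \<in> carrier (cat_trace C A)" for \<xi>
    using trace_elementD(2)[OF that assms] .
qed (use assms in \<open>auto simp: cat_trace_def\<close>)

end

section \<open>The induced category\<close>

locale induced_action = group G + linear_category V + act: linear_action "G\<lparr>carrier := H\<rparr>" V \<rho>
  for G :: "('g, 'b) monoid_scheme" (structure) and H :: "'g set"
    and V :: "('o, 'm, 'k::field) lincat" and \<rho> :: "('g, 'o, 'm) cat_action" +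
  assumes finite_G: "finite (carrier G)" and subgroup_H: "subgroup H G"
begin

lemma H_in_G [simp]: "h \<in> H \<Longrightarrow> h \<in> carrier G"
  using subgroup.subset[OF subgroup_H] by blast

lemma H_closed [simp]: "h \<in> H \<Longrightarrow> k \<in> H \<Longrightarrow> h \<otimes> k \<in> H" "h \<in> H \<Longrightarrow> inv h \<in> H" "\<one> \<in> H"
  using subgroup_H by (auto simp: subgroup.m_closed subgroup.m_inv_closed subgroup.one_closed)

lemma inv_H [simp]: "h \<in> H \<Longrightarrow> inv\<^bsub>G\<lparr>carrier := H\<rparr>\<^esub> h = inv h"
  by (rule m_inv_consistent[OF subgroup_H])

lemma act_functor_H: "h \<in> H \<Longrightarrow> linear_endofunctor V (act \<rho> h)"
  using act.act_functor by simp

lemmas act_simps [simp] = linear_endofunctorD(1,2,5,6)[OF act_functor_H]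
lemmas act_linear = linear_endofunctorD(3,4,5)[OF act_functor_H]
lemmas act_Comp = linear_endofunctorD(7)[OF act_functor_H]
lemmas act_is_iso = functor_is_iso[OF act_functor_H]

lemma phi_is_iso:
  "h \<in> H \<Longrightarrow> k \<in> H \<Longrightarrow> x \<in> Ob V \<Longrightarrow>
     is_iso V (act_ob \<rho> h (act_ob \<rho> k x)) (act_ob \<rho> (h \<otimes> k) x) (phi \<rho> h k x)"
  using act.phi_nat_iso[of h k] by (simp add: nat_iso_def comp_functor_def)

lemmas phi_in [simp] = is_iso_in[OF phi_is_iso]

lemma phi_natural:
  "h \<in> H \<Longrightarrow> k \<in> H \<Longrightarrow> x \<in> Ob V \<Longrightarrow> y \<in> Ob V \<Longrightarrow> a \<in> mor V x y \<Longrightarrow>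
     Comp V (act_ob \<rho> h (act_ob \<rho> k x)) (act_ob \<rho> h (act_ob \<rho> k y)) (act_ob \<rho> (h \<otimes> k) y)
       (phi \<rho> h k y) (act_mor \<rho> h (act_ob \<rho> k x) (act_ob \<rho> k y) (act_mor \<rho> k x y a)) =
     Comp V (act_ob \<rho> h (act_ob \<rho> k x)) (act_ob \<rho> (h \<otimes> k) x) (act_ob \<rho> (h \<otimes> k) y)
       (act_mor \<rho> (h \<otimes> k) x y a) (phi \<rho> h k x)"
  using act.phi_nat_iso[of h k] by (simp add: nat_iso_def nat_trans_def comp_functor_def)

lemma phi1_is_iso: "x \<in> Ob V \<Longrightarrow> is_iso V (act_ob \<rho> \<one> x) x (phi1 \<rho> x)"
  using act.phi1_nat_iso by (simp add: nat_iso_def id_functor_def)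

lemmas phi1_in [simp] = is_iso_in[OF phi1_is_iso]
lemmas inv_phi1_in [simp] = inv_mor_in[OF _ _ phi1_is_iso]
lemmas inv_phi_in [simp] = inv_mor_in[OF _ _ phi_is_iso]

lemma phi1_natural:
  "x \<in> Ob V \<Longrightarrow> y \<in> Ob V \<Longrightarrow> a \<in> mor V x y \<Longrightarrow>
     Comp V (act_ob \<rho> \<one> x) (act_ob \<rho> \<one> y) y (phi1 \<rho> y) (act_mor \<rho> \<one> x y a) =
     Comp V (act_ob \<rho> \<one> x) x y a (phi1 \<rho> x)"
  using act.phi1_nat_iso by (simp add: nat_iso_def nat_trans_def id_functor_def)

lemmas phi_assoc_H = act.phi_assoc[simplified]
lemmas phi_one_left_H = act.phi_one_left[simplified]

lemma ind_ob_iff: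
  "P \<in> ind_ob G H V \<rho> \<longleftrightarrow>
     fst P \<in> extensional (carrier G) \<and> (\<forall>t\<in>carrier G. fst P t \<in> Ob V) \<and>
     snd P \<in> extensional (carrier G \<times> H) \<and>
     (\<forall>t\<in>carrier G. \<forall>h\<in>H. is_iso V (fst P (t \<otimes> h)) (act_ob \<rho> (inv h) (fst P t)) (snd P (t, h))) \<and>
     (\<forall>t\<in>carrier G. snd P (t, \<one>) = inv_mor V (act_ob \<rho> \<one> (fst P t)) (fst P t) (phi1 \<rho> (fst P t))) \<and>
     (\<forall>t\<in>carrier G. \<forall>h\<in>H. \<forall>k\<in>H.
        snd P (t, h \<otimes> k) =
        Comp V (fst P (t \<otimes> h \<otimes> k)) (act_ob \<rho> (inv k) (act_ob \<rho> (inv h) (fst P t)))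
            (act_ob \<rho> (inv (h \<otimes> k)) (fst P t))
          (phi \<rho> (inv k) (inv h) (fst P t))
          (Comp V (fst P (t \<otimes> h \<otimes> k)) (act_ob \<rho> (inv k) (fst P (t \<otimes> h)))
              (act_ob \<rho> (inv k) (act_ob \<rho> (inv h) (fst P t)))
            (act_mor \<rho> (inv k) (fst P (t \<otimes> h)) (act_ob \<rho> (inv h) (fst P t)) (snd P (t, h)))
            (snd P (t \<otimes> h, k))))"
  by (cases P) (auto simp: ind_ob_def PiE_iff Let_def)

lemma
  assumes "P \<in> ind_ob G H V \<rho>"
  shows ob_in [simp]: "t \<in> carrier G \<Longrightarrow> fst P t \<in> Ob V"
    and str_is_iso: "t \<in> carrier G \<Longrightarrow> h \<in> H \<Longrightarrow>
      is_iso V (fst P (t \<otimes> h)) (act_ob \<rho> (inv h) (fst P t)) (snd P (t, h))"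
    and str_one: "t \<in> carrier G \<Longrightarrow>
      snd P (t, \<one>) = inv_mor V (act_ob \<rho> \<one> (fst P t)) (fst P t) (phi1 \<rho> (fst P t))"
    and str_mult: "t \<in> carrier G \<Longrightarrow> h \<in> H \<Longrightarrow> k \<in> H \<Longrightarrow>
      snd P (t, h \<otimes> k) =
        Comp V (fst P (t \<otimes> h \<otimes> k)) (act_ob \<rho> (inv k) (act_ob \<rho> (inv h) (fst P t)))
            (act_ob \<rho> (inv (h \<otimes> k)) (fst P t))
          (phi \<rho> (inv k) (inv h) (fst P t))
          (Comp V (fst P (t \<otimes> h \<otimes> k)) (act_ob \<rho> (inv k) (fst P (t \<otimes> h)))
              (act_ob \<rho> (inv k) (act_ob \<rho> (inv h) (fst P t)))
            (act_mor \<rho> (inv k) (fst P (t \<otimes> h)) (act_ob \<rho> (inv h) (fst P t)) (snd P (t, h)))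
            (snd P (t \<otimes> h, k)))"
  using assms unfolding ind_ob_iff by blast+

lemmas str_in [simp] = is_iso_in[OF str_is_iso]

lemma ind_mor_iff:
  "a \<in> ind_mor G H V \<rho> P Q \<longleftrightarrow>
     a \<in> extensional (carrier G) \<and> (\<forall>t\<in>carrier G. a t \<in> mor V (fst P t) (fst Q t)) \<and>
     (\<forall>t\<in>carrier G. \<forall>h\<in>H.
        Comp V (fst P (t \<otimes> h)) (fst Q (t \<otimes> h)) (act_ob \<rho> (inv h) (fst Q t)) (snd Q (t, h)) (a (t \<otimes> h)) =
        Comp V (fst P (t \<otimes> h)) (act_ob \<rho> (inv h) (fst P t)) (act_ob \<rho> (inv h) (fst Q t))
          (act_mor \<rho> (inv h) (fst P t) (fst Q t) (a t)) (snd P (t, h)))"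
  by (cases P; cases Q) (auto simp: ind_mor_def PiE_iff)

lemma
  assumes "a \<in> ind_mor G H V \<rho> P Q"
  shows ind_mor_ext: "a \<in> extensional (carrier G)"
    and ind_mor_in [simp]: "t \<in> carrier G \<Longrightarrow> a t \<in> mor V (fst P t) (fst Q t)"
    and equivariance: "t \<in> carrier G \<Longrightarrow> h \<in> H \<Longrightarrow>
        Comp V (fst P (t \<otimes> h)) (fst Q (t \<otimes> h)) (act_ob \<rho> (inv h) (fst Q t)) (snd Q (t, h)) (a (t \<otimes> h)) =
        Comp V (fst P (t \<otimes> h)) (act_ob \<rho> (inv h) (fst P t)) (act_ob \<rho> (inv h) (fst Q t))
          (act_mor \<rho> (inv h) (fst P t) (fst Q t) (a t)) (snd P (t, h))"
  using assms unfolding ind_mor_iff by blast+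

lemma ind_mor_eqI:
  assumes "a \<in> ind_mor G H V \<rho> P Q" "b \<in> ind_mor G H V \<rho> P' Q'" "\<And>t. t \<in> carrier G \<Longrightarrow> a t = b t"
  shows "a = b"
  using assms by (intro extensionalityI[OF ind_mor_ext ind_mor_ext]) auto

abbreviation D where "D \<equiv> ind_cat G H V \<rho>"

lemma ind_cat_simps [simp]:
  "Ob D = ind_ob G H V \<rho>"
  "mor D P Q = ind_mor G H V \<rho> P Q"
  "\<zero>\<^bsub>Hom D P Q\<^esub> = (\<lambda>t\<in>carrier G. \<zero>\<^bsub>Hom V (fst P t) (fst Q t)\<^esub>)"
  "a \<oplus>\<^bsub>Hom D P Q\<^esub> b = (\<lambda>t\<in>carrier G. a t \<oplus>\<^bsub>Hom V (fst P t) (fst Q t)\<^esub> b t)"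
  "c \<odot>\<^bsub>Hom D P Q\<^esub> a = (\<lambda>t\<in>carrier G. c \<odot>\<^bsub>Hom V (fst P t) (fst Q t)\<^esub> a t)"
  "Id D P = (\<lambda>t\<in>carrier G. Id V (fst P t))"
  "Comp D P Q R b a = (\<lambda>t\<in>carrier G. Comp V (fst P t) (fst Q t) (fst R t) (b t) (a t))"
  by (simp_all add: ind_cat_def)

lemma vectorspace_Hom_ind:
  assumes [simp]: "P \<in> ind_ob G H V \<rho>" "Q \<in> ind_ob G H V \<rho>"
  shows "vectorspace class_ring (Hom D P Q)"
proof -
  have "vectorspace class_ring
     \<lparr>carrier = ind_mor G H V \<rho> P Q, monoid.mult = undefined, one = undefined,
      zero = (\<lambda>t\<in>carrier G. \<zero>\<^bsub>Hom V (fst P t) (fst Q t)\<^esub>),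
      add = (\<lambda>a b. \<lambda>t\<in>carrier G. a t \<oplus>\<^bsub>Hom V (fst P t) (fst Q t)\<^esub> b t),
      module.smult = (\<lambda>c a. \<lambda>t\<in>carrier G. c \<odot>\<^bsub>Hom V (fst P t) (fst Q t)\<^esub> a t)\<rparr>"
  proof (rule vectorspace_pointwise)
    show "vectorspace class_ring (Hom V (fst P t) (fst Q t))" if "t \<in> carrier G" for t
      using that by (simp add: vectorspace_Hom)
    show "ind_mor G H V \<rho> P Q \<subseteq> (\<Pi>\<^sub>E t\<in>carrier G. mor V (fst P t) (fst Q t))"
      by (intro subsetI) (simp add: ind_mor_iff PiE_iff)
    show "(\<lambda>t\<in>carrier G. \<zero>\<^bsub>Hom V (fst P t) (fst Q t)\<^esub>) \<in> ind_mor G H V \<rho> P Q"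
      by (auto simp: ind_mor_iff Comp_linear_simps)
    show "(\<lambda>t\<in>carrier G. a t \<oplus>\<^bsub>Hom V (fst P t) (fst Q t)\<^esub> b t) \<in> ind_mor G H V \<rho> P Q"
      if a: "a \<in> ind_mor G H V \<rho> P Q" and b: "b \<in> ind_mor G H V \<rho> P Q" for a b
      using ind_mor_in[OF a] ind_mor_in[OF b] equivariance[OF a] equivariance[OF b]
      by (auto simp: ind_mor_iff Comp_linear_simps act_linear)
    show "(\<lambda>t\<in>carrier G. c \<odot>\<^bsub>Hom V (fst P t) (fst Q t)\<^esub> a t) \<in> ind_mor G H V \<rho> P Q"
      if a: "a \<in> ind_mor G H V \<rho> P Q" for c a
      using ind_mor_in[OF a] equivariance[OF a]
      by (auto simp: ind_mor_iff Comp_linear_simps act_linear)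
  qed
  then show ?thesis by (simp add: ind_cat_def)
qed

lemma ind_Comp_in:
  assumes [simp]: "P \<in> ind_ob G H V \<rho>" "Q \<in> ind_ob G H V \<rho>" "R \<in> ind_ob G H V \<rho>"
    and a: "a \<in> ind_mor G H V \<rho> P Q" and b: "b \<in> ind_mor G H V \<rho> Q R"
  shows "(\<lambda>t\<in>carrier G. Comp V (fst P t) (fst Q t) (fst R t) (b t) (a t)) \<in> ind_mor G H V \<rho> P R"
proof -
  note [simp] = ind_mor_in[OF a] ind_mor_in[OF b]
  have "Comp V (fst P (t \<otimes> h)) (fst R (t \<otimes> h)) (act_ob \<rho> (inv h) (fst R t)) (snd R (t, h))
          (Comp V (fst P (t \<otimes> h)) (fst Q (t \<otimes> h)) (fst R (t \<otimes> h)) (b (t \<otimes> h)) (a (t \<otimes> h))) =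
        Comp V (fst P (t \<otimes> h)) (act_ob \<rho> (inv h) (fst P t)) (act_ob \<rho> (inv h) (fst R t))
          (act_mor \<rho> (inv h) (fst P t) (fst R t) (Comp V (fst P t) (fst Q t) (fst R t) (b t) (a t)))
          (snd P (t, h))" (is "?l = ?r") if [simp]: "t \<in> carrier G" "h \<in> H" for t h
  proof -
    have "?l = Comp V (fst P (t \<otimes> h)) (fst Q (t \<otimes> h)) (act_ob \<rho> (inv h) (fst R t))
       (Comp V (fst Q (t \<otimes> h)) (fst R (t \<otimes> h)) (act_ob \<rho> (inv h) (fst R t)) (snd R (t, h)) (b (t \<otimes> h)))
       (a (t \<otimes> h))"
      by (rule Comp_assoc[symmetric]) simp_all
    also have "\<dots> = Comp V (fst P (t \<otimes> h)) (act_ob \<rho> (inv h) (fst Q t)) (act_ob \<rho> (inv h) (fst R t))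
       (act_mor \<rho> (inv h) (fst Q t) (fst R t) (b t))
       (Comp V (fst P (t \<otimes> h)) (fst Q (t \<otimes> h)) (act_ob \<rho> (inv h) (fst Q t)) (snd Q (t, h)) (a (t \<otimes> h)))"
      unfolding equivariance[OF b that] by (rule Comp_assoc) simp_all
    also have "\<dots> = ?r"
      unfolding equivariance[OF a that] by (simp add: act_Comp Comp_assoc)
    finally show ?thesis .
  qed
  then show ?thesis by (auto simp: ind_mor_iff)
qed

lemma linear_category_ind: "linear_category D"
proof (rule linear_category.intro)
  fix P assume P: "P \<in> Ob D"
  show "Id D P \<in> mor D P P"
    using P by (auto simp: ind_mor_iff)
  fix Q assume Q: "Q \<in> Ob D"
  show "vectorspace class_ring (Hom D P Q)" using P Q by (simp add: vectorspace_Hom_ind)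
  show "Comp D P Q Q (Id D Q) a = a" "Comp D P P Q a (Id D P) = a" if a: "a \<in> mor D P Q" for a
    using P Q a ind_mor_ext[of a P Q] ind_mor_in[of a P Q]
    by (auto intro!: extensionalityI[where A = "carrier G"])
  fix R assume R: "R \<in> Ob D"
  note PQR = P[simplified] Q[simplified] R[simplified]
  show "(\<lambda>b. Comp D P Q R b a) \<in> LinearCombinations.module_hom class_ring (Hom D Q R) (Hom D P R)"
    if "a \<in> mor D P Q" for a
    using that PQR by (intro module_homI) (auto intro!: ind_Comp_in restrict_ext simp: Comp_linear_simps)
  show "(\<lambda>a. Comp D P Q R b a) \<in> LinearCombinations.module_hom class_ring (Hom D P Q) (Hom D P R)"
    if "b \<in> mor D Q R" for b
    using that PQR by (intro module_homI) (auto intro!: ind_Comp_in restrict_ext simp: Comp_linear_simps)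
  fix S a b c assume S: "S \<in> Ob D" and "a \<in> mor D P Q" "b \<in> mor D Q R" "c \<in> mor D R S"
  then show "Comp D P Q S (Comp D Q R S c b) a = Comp D P R S c (Comp D P Q R b a)"
    using PQR by (auto intro!: restrict_ext simp: Comp_assoc)
qed

sublocale ind: linear_category D
  by (rule linear_category_ind)

abbreviation \<sigma> where "\<sigma> \<equiv> ind_functor G H"

lemma shift_simps [simp]:
  "t \<in> carrier G \<Longrightarrow> fst (OMap (\<sigma> g) P) t = fst P (inv g \<otimes> t)"
  "t \<in> carrier G \<Longrightarrow> h \<in> H \<Longrightarrow> snd (OMap (\<sigma> g) P) (t, h) = snd P (inv g \<otimes> t, h)"
  "MMap (\<sigma> g) P Q a = (\<lambda>t\<in>carrier G. a (inv g \<otimes> t))"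
  by (auto simp: ind_functor_def split: prod.splits)

lemma shift_in [simp]:
  assumes [simp]: "g \<in> carrier G" and P: "P \<in> ind_ob G H V \<rho>"
  shows "OMap (\<sigma> g) P \<in> ind_ob G H V \<rho>"
proof -
  have "fst (OMap (\<sigma> g) P) \<in> extensional (carrier G)" "snd (OMap (\<sigma> g) P) \<in> extensional (carrier G \<times> H)"
    by (cases P; simp add: ind_functor_def)+
  then show ?thesis
    using str_is_iso[OF P] str_one[OF P] str_mult[OF P] ob_in[OF P]
    unfolding ind_ob_iff by (simp add: m_assoc[symmetric])
qed

lemma shift_mor_in [simp]:
  assumes [simp]: "g \<in> carrier G" "P \<in> ind_ob G H V \<rho>" "Q \<in> ind_ob G H V \<rho>" and a: "a \<in> ind_mor G H V \<rho> P Q"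
  shows "(\<lambda>t\<in>carrier G. a (inv g \<otimes> t)) \<in> ind_mor G H V \<rho> (OMap (\<sigma> g) P) (OMap (\<sigma> g) Q)"
  using ind_mor_in[OF a] equivariance[OF a] unfolding ind_mor_iff by (simp add: m_assoc[symmetric])

lemma shift_functor:
  assumes "g \<in> carrier G"
  shows "linear_endofunctor D (\<sigma> g)"
  unfolding linear_endofunctor_def
proof (intro conjI ballI)
  show "MMap (\<sigma> g) P Q \<in> LinearCombinations.module_hom class_ring (Hom D P Q) (Hom D (OMap (\<sigma> g) P) (OMap (\<sigma> g) Q))"
    if "P \<in> Ob D" "Q \<in> Ob D" for P Q
    using that assms by (intro module_homI) (auto intro!: restrict_ext)
qed (use assms in \<open>auto intro!: restrict_ext\<close>)

text \<open>The structure maps of the induced action are identities; this is well typed because shifting by \<open>h\<close>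
and then by \<open>g\<close> gives literally the same object as shifting by \<open>g \<otimes> h\<close>. Extensionality makes this an
equality also outside the group.\<close>

lemma shift_strict:
  assumes "P \<in> ind_ob G H V \<rho>"
  shows "g \<in> carrier G \<Longrightarrow> h \<in> carrier G \<Longrightarrow> OMap (\<sigma> g) (OMap (\<sigma> h) P) = OMap (\<sigma> (g \<otimes> h)) P"
    and "OMap (\<sigma> \<one>) P = P"
proof -
  obtain f u where P: "P = (f, u)" "f \<in> extensional (carrier G)" "u \<in> extensional (carrier G \<times> H)"
    using assms by (cases P) (auto simp: ind_ob_iff)
  show "g \<in> carrier G \<Longrightarrow> h \<in> carrier G \<Longrightarrow> OMap (\<sigma> g) (OMap (\<sigma> h) P) = OMap (\<sigma> (g \<otimes> h)) P"
    by (auto simp: P ind_functor_def inv_mult_group m_assoc intro!: restrict_ext)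
  have "(\<lambda>t\<in>carrier G. f (inv \<one> \<otimes> t)) = f" "(\<lambda>(t, h)\<in>carrier G \<times> H. u (inv \<one> \<otimes> t, h)) = u"
    using P by (auto intro!: extensionalityI[where A = "carrier G"] extensionalityI[where A = "carrier G \<times> H"])
  then show "OMap (\<sigma> \<one>) P = P" by (simp add: P ind_functor_def)
qed

section \<open>Morphisms supported on one coset\<close>

lemma H_mult_iff:
  assumes "h \<in> H" "g \<in> carrier G"
  shows "h \<otimes> g \<in> H \<longleftrightarrow> g \<in> H" and "g \<otimes> h \<in> H \<longleftrightarrow> g \<in> H"
proof -
  have "inv h \<otimes> (h \<otimes> g) = g" "(g \<otimes> h) \<otimes> inv h = g"
    using assms by (simp_all add: m_assoc inv_solve_left')
  then show "h \<otimes> g \<in> H \<longleftrightarrow> g \<in> H" "g \<otimes> h \<in> H \<longleftrightarrow> g \<in> H"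
    using assms H_closed by metis+
qed

lemma str_mult':
  assumes "P \<in> ind_ob G H V \<rho>" "t \<in> carrier G" "h \<in> H" "k \<in> H"
  shows "snd P (t, h \<otimes> k) =
        Comp V (fst P (t \<otimes> (h \<otimes> k))) (act_ob \<rho> (inv k) (act_ob \<rho> (inv h) (fst P t)))
            (act_ob \<rho> (inv k \<otimes> inv h) (fst P t))
          (phi \<rho> (inv k) (inv h) (fst P t))
          (Comp V (fst P (t \<otimes> (h \<otimes> k))) (act_ob \<rho> (inv k) (fst P (t \<otimes> h)))
              (act_ob \<rho> (inv k) (act_ob \<rho> (inv h) (fst P t)))
            (act_mor \<rho> (inv k) (fst P (t \<otimes> h)) (act_ob \<rho> (inv h) (fst P t)) (snd P (t, h)))
            (snd P (t \<otimes> h, k)))"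
  using str_mult[OF assms] assms(2-) by (simp add: m_assoc inv_mult_group)

lemma str_is_iso':
  assumes "P \<in> ind_ob G H V \<rho>" "t \<in> carrier G" "h \<in> H" "k \<in> H"
  shows "is_iso V (fst P (t \<otimes> (h \<otimes> k))) (act_ob \<rho> (inv k) (fst P (t \<otimes> h))) (snd P (t \<otimes> h, k))"
  using str_is_iso[OF assms(1), of "t \<otimes> h" k] assms(2-) by (simp add: m_assoc)

lemma left_inv_assoc: "s \<in> carrier G \<Longrightarrow> t \<in> carrier G \<Longrightarrow> inv s \<otimes> (s \<otimes> t) = t"
  and right_inv_assoc: "s \<in> carrier G \<Longrightarrow> t \<in> carrier G \<Longrightarrow> s \<otimes> (inv s \<otimes> t) = t"
  by (simp_all add: m_assoc[symmetric])

text \<open>Equivariance forces the value at \<open>t = s \<otimes> k\<close> of a morphism with value \<open>a\<close> at \<open>s\<close>; off the coset \<open>sH\<close> the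
morphism is set to zero.\<close>

definition extend where
  "extend s P Q a = (\<lambda>t\<in>carrier G.
     if inv s \<otimes> t \<in> H
     then Comp V (fst P t) (act_ob \<rho> (inv (inv s \<otimes> t)) (fst Q s)) (fst Q t)
            (inv_mor V (fst Q t) (act_ob \<rho> (inv (inv s \<otimes> t)) (fst Q s)) (snd Q (s, inv s \<otimes> t)))
            (Comp V (fst P t) (act_ob \<rho> (inv (inv s \<otimes> t)) (fst P s)) (act_ob \<rho> (inv (inv s \<otimes> t)) (fst Q s))
              (act_mor \<rho> (inv (inv s \<otimes> t)) (fst P s) (fst Q s) a) (snd P (s, inv s \<otimes> t)))
     else \<zero>\<^bsub>Hom V (fst P t) (fst Q t)\<^esub>)"

text \<open>The equivariance of the extension on \<open>sH\<close> combines the cocycle identities of \<open>P\<close> and \<open>Q\<close> with the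
naturality of the isomorphisms \<open>\<phi>\<close>. Off \<open>sH\<close> it is an identity between zero morphisms, since
\<open>t\<close> and \<open>t \<otimes> h\<close> lie in the same coset. The value at \<open>s\<close> is \<open>a\<close> by the unit law of the objects and the naturality of \<open>\<phi>\<^sub>1\<close>.\<close>

lemma
  assumes [simp]: "P \<in> ind_ob G H V \<rho>" "Q \<in> ind_ob G H V \<rho>" "s \<in> carrier G" "a \<in> mor V (fst P s) (fst Q s)"
  shows extend_coset: "k \<in> H \<Longrightarrow> extend s P Q a (s \<otimes> k) \<in> mor V (fst P (s \<otimes> k)) (fst Q (s \<otimes> k))"
    "k \<in> H \<Longrightarrow>
      Comp V (fst P (s \<otimes> k)) (fst Q (s \<otimes> k)) (act_ob \<rho> (inv k) (fst Q s)) (snd Q (s, k)) (extend s P Q a (s \<otimes> k)) =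
      Comp V (fst P (s \<otimes> k)) (act_ob \<rho> (inv k) (fst P s)) (act_ob \<rho> (inv k) (fst Q s))
        (act_mor \<rho> (inv k) (fst P s) (fst Q s) a) (snd P (s, k))"
    and extend_off: "t \<in> carrier G \<Longrightarrow> inv s \<otimes> t \<notin> H \<Longrightarrow> extend s P Q a t = \<zero>\<^bsub>Hom V (fst P t) (fst Q t)\<^esub>"
    and extend_in: "extend s P Q a \<in> ind_mor G H V \<rho> P Q"
    and extend_at: "extend s P Q a s = a"
proof -
  let ?e = "extend s P Q a"
  show in_coset: "?e (s \<otimes> k) \<in> mor V (fst P (s \<otimes> k)) (fst Q (s \<otimes> k))" if [simp]: "k \<in> H" for k
    using inv_mor_in[OF _ _ str_is_iso[of Q s k]] by (simp add: extend_def left_inv_assoc)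
  show coset: "Comp V (fst P (s \<otimes> k)) (fst Q (s \<otimes> k)) (act_ob \<rho> (inv k) (fst Q s)) (snd Q (s, k)) (?e (s \<otimes> k)) =
      Comp V (fst P (s \<otimes> k)) (act_ob \<rho> (inv k) (fst P s)) (act_ob \<rho> (inv k) (fst Q s))
        (act_mor \<rho> (inv k) (fst P s) (fst Q s) a) (snd P (s, k))" if [simp]: "k \<in> H" for k
    by (simp add: extend_def left_inv_assoc comp_inv_right str_is_iso)
  show off: "?e t = \<zero>\<^bsub>Hom V (fst P t) (fst Q t)\<^esub>" if "t \<in> carrier G" "inv s \<otimes> t \<notin> H" for t
    using that by (simp add: extend_def)
  have eq_coset: "Comp V (fst P (s \<otimes> (k \<otimes> h))) (fst Q (s \<otimes> (k \<otimes> h))) (act_ob \<rho> (inv h) (fst Q (s \<otimes> k)))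
          (snd Q (s \<otimes> k, h)) (?e (s \<otimes> (k \<otimes> h))) =
        Comp V (fst P (s \<otimes> (k \<otimes> h))) (act_ob \<rho> (inv h) (fst P (s \<otimes> k))) (act_ob \<rho> (inv h) (fst Q (s \<otimes> k)))
          (act_mor \<rho> (inv h) (fst P (s \<otimes> k)) (fst Q (s \<otimes> k)) (?e (s \<otimes> k))) (snd P (s \<otimes> k, h))"
     (is "?l = ?r") if [simp]: "k \<in> H" "h \<in> H" for k h
  proof -
    note [simp] = in_coset
    define p0 p1 p2 q0 q1 q2 where pq: "p0 = fst P s" "p1 = fst P (s \<otimes> k)" "p2 = fst P (s \<otimes> (k \<otimes> h))"
      "q0 = fst Q s" "q1 = fst Q (s \<otimes> k)" "q2 = fst Q (s \<otimes> (k \<otimes> h))"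
    have ob [simp]: "p0 \<in> Ob V" "p1 \<in> Ob V" "p2 \<in> Ob V" "q0 \<in> Ob V" "q1 \<in> Ob V" "q2 \<in> Ob V" by (simp_all add: pq)
    have iso: "is_iso V p1 (act_ob \<rho> (inv k) p0) (snd P (s, k))"
      "is_iso V p2 (act_ob \<rho> (inv h) p1) (snd P (s \<otimes> k, h))"
      "is_iso V q1 (act_ob \<rho> (inv k) q0) (snd Q (s, k))"
      "is_iso V q2 (act_ob \<rho> (inv h) q1) (snd Q (s \<otimes> k, h))"
      using str_is_iso' str_is_iso by (simp_all add: pq)
    note iso_in [simp] = iso[THEN is_iso_in]
    have [simp]: "a \<in> mor V p0 q0" "?e (s \<otimes> k) \<in> mor V p1 q1" "?e (s \<otimes> (k \<otimes> h)) \<in> mor V p2 q2"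
      by (simp_all add: pq)
    let ?h = "act_ob \<rho> (inv h)" and ?k = "act_ob \<rho> (inv k)" and ?kh = "act_ob \<rho> (inv h \<otimes> inv k)"
    let ?mh = "act_mor \<rho> (inv h)" and ?mk = "act_mor \<rho> (inv k)" and ?mkh = "act_mor \<rho> (inv h \<otimes> inv k)"
    \<comment> \<open>the factor by which the structure isomorphism of \<open>Q\<close> at \<open>k \<otimes> h\<close> differs from the one based at \<open>s \<otimes> k\<close>\<close>
    let ?W = "Comp V (?h q1) (?h (?k q0)) (?kh q0) (phi \<rho> (inv h) (inv k) q0) (?mh q1 (?k q0) (snd Q (s, k)))"
    have W: "is_iso V (?h q1) (?kh q0) ?W"
      by (rule is_iso_Comp[OF _ _ _ act_is_iso phi_is_iso]) (simp_all add: iso)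
    have "Comp V p2 (?h q1) (?kh q0) ?W (Comp V p2 q2 (?h q1) (snd Q (s \<otimes> k, h)) (?e (s \<otimes> (k \<otimes> h))))
      = Comp V p2 q2 (?kh q0) (snd Q (s, k \<otimes> h)) (?e (s \<otimes> (k \<otimes> h)))"
      by (simp add: str_mult' Comp_assoc pq[symmetric])
    also have "\<dots> = Comp V p2 (?kh p0) (?kh q0) (?mkh p0 q0 a) (snd P (s, k \<otimes> h))"
      using coset[of "k \<otimes> h"] by (simp add: pq inv_mult_group)
    also have "\<dots> = Comp V p2 (?h (?k p0)) (?kh q0)
        (Comp V (?h (?k p0)) (?kh p0) (?kh q0) (?mkh p0 q0 a) (phi \<rho> (inv h) (inv k) p0))
        (Comp V p2 (?h p1) (?h (?k p0)) (?mh p1 (?k p0) (snd P (s, k))) (snd P (s \<otimes> k, h)))"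
      by (simp add: str_mult' Comp_assoc pq[symmetric])
    also have "\<dots> = Comp V p2 (?h (?k q0)) (?kh q0) (phi \<rho> (inv h) (inv k) q0)
        (Comp V p2 (?h p1) (?h (?k q0))
          (?mh p1 (?k q0) (Comp V p1 (?k p0) (?k q0) (?mk p0 q0 a) (snd P (s, k)))) (snd P (s \<otimes> k, h)))"
      by (simp add: phi_natural[symmetric] Comp_assoc act_Comp)
    also have "Comp V p1 (?k p0) (?k q0) (?mk p0 q0 a) (snd P (s, k))
      = Comp V p1 q1 (?k q0) (snd Q (s, k)) (?e (s \<otimes> k))"
      using coset[of k] by (simp add: pq)
    also have "Comp V p2 (?h (?k q0)) (?kh q0) (phi \<rho> (inv h) (inv k) q0)
        (Comp V p2 (?h p1) (?h (?k q0))
          (?mh p1 (?k q0) (Comp V p1 q1 (?k q0) (snd Q (s, k)) (?e (s \<otimes> k)))) (snd P (s \<otimes> k, h)))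
      = Comp V p2 (?h q1) (?kh q0) ?W (Comp V p2 (?h p1) (?h q1) (?mh p1 q1 (?e (s \<otimes> k))) (snd P (s \<otimes> k, h)))"
      by (simp add: Comp_assoc act_Comp)
    finally show ?thesis unfolding pq[symmetric]
      by (rule iso_cancel_left[OF _ _ _ W, rotated 5]) simp_all
  qed
  show extend: "?e \<in> ind_mor G H V \<rho> P Q"
    unfolding ind_mor_iff
  proof (intro conjI ballI)
    show "?e \<in> extensional (carrier G)" by (simp add: extend_def)
    fix t assume [simp]: "t \<in> carrier G"
    define k where "k = inv s \<otimes> t"
    have kG [simp]: "k \<in> carrier G" and t: "t = s \<otimes> k" by (simp_all add: k_def right_inv_assoc)
    show "?e t \<in> mor V (fst P t) (fst Q t)"
      using off[of t] in_coset[of k] by (cases "k \<in> H") (simp_all add: k_def right_inv_assoc)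
    fix h assume [simp]: "h \<in> H"
    show "Comp V (fst P (t \<otimes> h)) (fst Q (t \<otimes> h)) (act_ob \<rho> (inv h) (fst Q t)) (snd Q (t, h)) (?e (t \<otimes> h)) =
        Comp V (fst P (t \<otimes> h)) (act_ob \<rho> (inv h) (fst P t)) (act_ob \<rho> (inv h) (fst Q t))
          (act_mor \<rho> (inv h) (fst P t) (fst Q t) (?e t)) (snd P (t, h))"
    proof (cases "k \<in> H")
      case True
      then show ?thesis using eq_coset[of k h] by (simp add: t m_assoc)
    next
      case False
      then have "inv s \<otimes> t \<notin> H" "inv s \<otimes> (t \<otimes> h) \<notin> H"
        using H_mult_iff[of h k] by (simp_all add: k_def m_assoc)
      then show ?thesis using off[of t] off[of "t \<otimes> h"] by (simp add: Comp_linear_simps)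
    qed
  qed
  show "?e s = a"
  proof -
    have e: "?e s \<in> mor V (fst P s) (fst Q s)" using ind_mor_in[OF extend, of s] by simp
    let ?p = "fst P s" and ?q = "fst Q s" and ?o = "act_ob \<rho> \<one>"
    have "?e s = Comp V ?p (?o ?q) ?q (phi1 \<rho> ?q)
        (Comp V ?p ?q (?o ?q) (inv_mor V (?o ?q) ?q (phi1 \<rho> ?q)) (?e s))"
      by (rule comp_inv_right[symmetric]) (simp_all add: e phi1_is_iso)
    also have "Comp V ?p ?q (?o ?q) (inv_mor V (?o ?q) ?q (phi1 \<rho> ?q)) (?e s)
      = Comp V ?p (?o ?p) (?o ?q) (act_mor \<rho> \<one> ?p ?q a) (inv_mor V (?o ?p) ?p (phi1 \<rho> ?p))"
      using coset[of \<one>] by (simp add: str_one)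
    also have "Comp V ?p (?o ?q) ?q (phi1 \<rho> ?q)
       (Comp V ?p (?o ?p) (?o ?q) (act_mor \<rho> \<one> ?p ?q a) (inv_mor V (?o ?p) ?p (phi1 \<rho> ?p)))
      = Comp V ?p (?o ?p) ?q (Comp V (?o ?p) ?p ?q a (phi1 \<rho> ?p)) (inv_mor V (?o ?p) ?p (phi1 \<rho> ?p))"
      by (simp add: phi1_natural[symmetric] Comp_assoc)
    also have "\<dots> = a" by (simp add: Comp_assoc inv_mor_right phi1_is_iso)
    finally show ?thesis .
  qed
qed

text \<open>At a point of \<open>sH\<close> the equivariance condition expresses a morphism through its value at \<open>s\<close>, up to
the structure isomorphism of the target, which can be cancelled.\<close>

lemma ind_mor_eq_coset:
  assumes [simp]: "P \<in> ind_ob G H V \<rho>" "Q \<in> ind_ob G H V \<rho>" "s \<in> carrier G"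
    and a: "a \<in> ind_mor G H V \<rho> P Q" and b: "b \<in> ind_mor G H V \<rho> P Q" and eq: "a s = b s"
    and t [simp]: "t \<in> carrier G" "inv s \<otimes> t \<in> H"
  shows "a t = b t"
proof -
  note [simp] = ind_mor_in[OF a] ind_mor_in[OF b]
  show ?thesis
    using iso_cancel_left[OF _ _ _ str_is_iso[of Q s "inv s \<otimes> t"], of "fst P t" "a t" "b t"]
      equivariance[OF a, of s "inv s \<otimes> t"] equivariance[OF b, of s "inv s \<otimes> t"] eq
    by (simp add: right_inv_assoc)
qed

text \<open>This uniqueness principle replaces computations with the explicit extension: linearity and naturality of
extended families are checked at the single point \<open>s\<close>.\<close>

lemma ind_mor_eqI_support:
  assumes "P \<in> ind_ob G H V \<rho>" "Q \<in> ind_ob G H V \<rho>" "s \<in> carrier G"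
    and a: "a \<in> ind_mor G H V \<rho> P Q" and b: "b \<in> ind_mor G H V \<rho> P Q" and eq: "a s = b s"
    and off: "\<And>t. t \<in> carrier G \<Longrightarrow> inv s \<otimes> t \<notin> H \<Longrightarrow> a t = b t"
  shows "a = b"
  using ind_mor_eq_coset[OF assms(1-6)] off by (intro ind_mor_eqI[OF a b]) blast

section \<open>Objects with a prescribed value\<close>

text \<open>If \<open>r\<close> is the representative chosen in the coset \<open>tH\<close>, then \<open>t = r \<otimes> inv (offset s t)\<close>. The coset of \<open>s\<close> gets the
representative \<open>s\<close>, so that the object built from these offsets has a known value at \<open>s\<close>.\<close>

definition offset where
  "offset s t = inv t \<otimes> (SOME r. r \<in> carrier G \<and> inv t \<otimes> r \<in> H \<and> (inv t \<otimes> s \<in> H \<longrightarrow> r = s))"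

lemma
  assumes [simp]: "s \<in> carrier G" "t \<in> carrier G"
  shows offset_in [simp]: "offset s t \<in> H"
    and offset_mult: "h \<in> H \<Longrightarrow> offset s (t \<otimes> h) = inv h \<otimes> offset s t"
proof -
  let ?R = "\<lambda>t r. r \<in> carrier G \<and> inv t \<otimes> r \<in> H \<and> (inv t \<otimes> s \<in> H \<longrightarrow> r = s)"
  have ex: "\<exists>r. ?R t r" if "t \<in> carrier G" for t
  proof (cases "inv t \<otimes> s \<in> H")
    case False
    with that show ?thesis by (intro exI[of _ t]) simp
  qed auto
  have some: "?R t (SOME r. ?R t r)" if "t \<in> carrier G" for t by (rule someI_ex[OF ex[OF that]])
  then show "offset s t \<in> H" by (simp add: offset_def)
  show "offset s (t \<otimes> h) = inv h \<otimes> offset s t" if [simp]: "h \<in> H"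
  proof -
    have "inv (t \<otimes> h) \<otimes> r \<in> H \<longleftrightarrow> inv t \<otimes> r \<in> H" if "r \<in> carrier G" for r
      using that H_mult_iff(1)[of "inv h" "inv t \<otimes> r"] by (simp add: inv_mult_group m_assoc)
    then have "?R (t \<otimes> h) = ?R t" by (auto simp: fun_eq_iff)
    moreover have "(SOME r. ?R t r) \<in> carrier G" using some[of t] by simp
    ultimately show ?thesis by (simp add: offset_def inv_mult_group m_assoc)
  qed
qed

lemma offset_self:
  assumes "s \<in> carrier G" shows "offset s s = \<one>"
proof -
  have "(SOME r. r \<in> carrier G \<and> inv s \<otimes> r \<in> H \<and> (inv s \<otimes> s \<in> H \<longrightarrow> r = s)) = s"
    using assms by (intro some_equality) auto
  then show ?thesis using assms by (simp add: offset_def)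
qed

text \<open>In the coset with representative \<open>r\<close> the value at \<open>r \<otimes> k\<close> is \<open>\<rho>(k\<^sup>-\<^sup>1)x\<close>, as equivariance dictates.
The value at \<open>s\<close> is \<open>\<rho>(1)x\<close>, which \<open>\<phi>\<^sub>1\<close> identifies with \<open>x\<close>; hence every object of \<open>V\<close> is
isomorphic to the value at \<open>s\<close> of an induced object.\<close>

definition free_ob where
  "free_ob s x = (\<lambda>t\<in>carrier G. act_ob \<rho> (offset s t) x,
     \<lambda>(t, h)\<in>carrier G \<times> H. inv_mor V (act_ob \<rho> (inv h) (act_ob \<rho> (offset s t) x))
        (act_ob \<rho> (inv h \<otimes> offset s t) x) (phi \<rho> (inv h) (offset s t) x))"

lemma
  assumes [simp]: "s \<in> carrier G" "x \<in> Ob V"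
  shows free_ob_in [simp]: "free_ob s x \<in> ind_ob G H V \<rho>"
    and free_ob_at [simp]: "fst (free_ob s x) s = act_ob \<rho> \<one> x"
proof -
  show "fst (free_ob s x) s = act_ob \<rho> \<one> x" by (simp add: free_ob_def offset_self)
  have cocycle:
    "inv_mor V (act_ob \<rho> (k \<otimes> h) (act_ob \<rho> d x)) (act_ob \<rho> (k \<otimes> h \<otimes> d) x) (phi \<rho> (k \<otimes> h) d x) =
     Comp V (act_ob \<rho> (k \<otimes> h \<otimes> d) x) (act_ob \<rho> k (act_ob \<rho> h (act_ob \<rho> d x))) (act_ob \<rho> (k \<otimes> h) (act_ob \<rho> d x))
       (phi \<rho> k h (act_ob \<rho> d x))
       (Comp V (act_ob \<rho> (k \<otimes> h \<otimes> d) x) (act_ob \<rho> k (act_ob \<rho> (h \<otimes> d) x)) (act_ob \<rho> k (act_ob \<rho> h (act_ob \<rho> d x)))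
         (act_mor \<rho> k (act_ob \<rho> (h \<otimes> d) x) (act_ob \<rho> h (act_ob \<rho> d x))
            (inv_mor V (act_ob \<rho> h (act_ob \<rho> d x)) (act_ob \<rho> (h \<otimes> d) x) (phi \<rho> h d x)))
         (inv_mor V (act_ob \<rho> k (act_ob \<rho> (h \<otimes> d) x)) (act_ob \<rho> (k \<otimes> h \<otimes> d) x) (phi \<rho> k (h \<otimes> d) x)))"
    (is "?l = ?r") if [simp]: "k \<in> H" "h \<in> H" "d \<in> H" for k h d
  proof -
    let ?d = "act_ob \<rho> d x" let ?hd = "act_ob \<rho> (h \<otimes> d) x" let ?khd = "act_ob \<rho> (k \<otimes> h \<otimes> d) x"
    let ?k = "act_ob \<rho> k" and ?h = "act_ob \<rho> h" and ?kh = "act_ob \<rho> (k \<otimes> h)"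
    let ?u = "inv_mor V (?h ?d) ?hd (phi \<rho> h d x)" and ?v = "inv_mor V (?k ?hd) ?khd (phi \<rho> k (h \<otimes> d) x)"
    have [simp]: "phi \<rho> k (h \<otimes> d) x \<in> mor V (?k ?hd) ?khd" "?v \<in> mor V ?khd (?k ?hd)"
      "?u \<in> mor V ?hd (?h ?d)"
      using phi_in[of k "h \<otimes> d" x] inv_phi_in[of k "h \<otimes> d" x] inv_phi_in[of h d x] by (simp_all add: m_assoc)
    have v: "Comp V ?khd (?k ?hd) ?khd (phi \<rho> k (h \<otimes> d) x) ?v = Id V ?khd"
      using inv_mor_right[OF _ _ phi_is_iso[of k "h \<otimes> d" x]] by (simp add: m_assoc)
    have "Comp V ?khd (?kh ?d) ?khd (phi \<rho> (k \<otimes> h) d x) ?r =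
      Comp V ?khd (?k (?h ?d)) ?khd
        (Comp V (?k (?h ?d)) (?kh ?d) ?khd (phi \<rho> (k \<otimes> h) d x) (phi \<rho> k h ?d))
        (Comp V ?khd (?k ?hd) (?k (?h ?d)) (act_mor \<rho> k ?hd (?h ?d) ?u) ?v)"
      by (simp add: Comp_assoc)
    also have "Comp V (?k (?h ?d)) (?kh ?d) ?khd (phi \<rho> (k \<otimes> h) d x) (phi \<rho> k h ?d)
      = Comp V (?k (?h ?d)) (?k ?hd) ?khd (phi \<rho> k (h \<otimes> d) x) (act_mor \<rho> k (?h ?d) ?hd (phi \<rho> h d x))"
      using phi_assoc_H[of k h d x] by (simp add: m_assoc)
    also have "Comp V ?khd (?k (?h ?d)) ?khd
        (Comp V (?k (?h ?d)) (?k ?hd) ?khd (phi \<rho> k (h \<otimes> d) x) (act_mor \<rho> k (?h ?d) ?hd (phi \<rho> h d x)))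
        (Comp V ?khd (?k ?hd) (?k (?h ?d)) (act_mor \<rho> k ?hd (?h ?d) ?u) ?v) =
      Comp V ?khd (?k ?hd) ?khd (phi \<rho> k (h \<otimes> d) x)
        (Comp V ?khd (?k ?hd) (?k ?hd)
          (act_mor \<rho> k ?hd ?hd (Comp V ?hd (?h ?d) ?hd (phi \<rho> h d x) ?u)) ?v)"
      by (simp add: Comp_assoc act_Comp)
    also have "\<dots> = Id V ?khd" by (simp add: inv_mor_right phi_is_iso v)
    also have "\<dots> = Comp V ?khd (?kh ?d) ?khd (phi \<rho> (k \<otimes> h) d x) ?l"
      by (simp add: inv_mor_right phi_is_iso)
    finally have "?r = ?l"
      by (rule iso_cancel_left[OF _ _ _ phi_is_iso[of "k \<otimes> h" d x], rotated 8]) simp_all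
    then show ?thesis by (rule sym)
  qed
  show "free_ob s x \<in> ind_ob G H V \<rho>"
    unfolding ind_ob_iff
    using is_iso_inv_mor[OF _ _ phi_is_iso] cocycle
    by (simp add: free_ob_def offset_mult inv_mult_group m_assoc phi_one_left_H)
qed

section \<open>Components of a natural transformation\<close>

definition conjugate where "conjugate s g = inv s \<otimes> g \<otimes> s"

lemma
  assumes [simp]: "s \<in> carrier G" "g \<in> carrier G"
  shows conjugate_in: "conjugate s g \<in> carrier G"
    and mult_inv_conjugate: "s \<otimes> inv (conjugate s g) = inv g \<otimes> s"
  by (simp_all add: conjugate_def inv_mult_group m_assoc right_inv_assoc)

text \<open>The value at \<open>s\<close> of a transformation \<open>id \<Rightarrow> \<sigma>(g)\<close> ends at \<open>f(g\<^sup>-\<^sup>1s) = f(s\<gamma>\<^sup>-\<^sup>1)\<close> with \<open>\<gamma> = s\<^sup>-\<^sup>1gs\<close>. The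
structure isomorphism carries this end to \<open>\<rho>(\<gamma>)f(s)\<close>.\<close>

definition germ where
  "germ g s \<xi> P = Comp V (fst P s) (fst P (inv g \<otimes> s)) (act_ob \<rho> (conjugate s g) (fst P s))
     (snd P (s, inv (conjugate s g))) (\<xi> P s)"

lemma trace_shift_in:
  assumes "\<xi> \<in> carrier (cat_trace D (\<sigma> g))" "P \<in> ind_ob G H V \<rho>" "g \<in> carrier G"
  shows "\<xi> P \<in> ind_mor G H V \<rho> P (OMap (\<sigma> g) P)"
    and "t \<in> carrier G \<Longrightarrow> \<xi> P t \<in> mor V (fst P t) (fst P (inv g \<otimes> t))"
proof -
  show *: "\<xi> P \<in> ind_mor G H V \<rho> P (OMap (\<sigma> g) P)"
    using ind.trace_elementD(2)[OF assms(1)] assms(2) by simp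
  show "t \<in> carrier G \<Longrightarrow> \<xi> P t \<in> mor V (fst P t) (fst P (inv g \<otimes> t))"
    using ind_mor_in[OF *] by simp
qed

lemma trace_shift_natural:
  assumes "\<xi> \<in> carrier (cat_trace D (\<sigma> g))" "P \<in> ind_ob G H V \<rho>" "Q \<in> ind_ob G H V \<rho>"
    "a \<in> ind_mor G H V \<rho> P Q" "t \<in> carrier G"
  shows "Comp V (fst P t) (fst Q t) (fst Q (inv g \<otimes> t)) (\<xi> Q t) (a t) =
    Comp V (fst P t) (fst P (inv g \<otimes> t)) (fst Q (inv g \<otimes> t)) (a (inv g \<otimes> t)) (\<xi> P t)"
proof -
  have "Comp D P Q (OMap (\<sigma> g) Q) (\<xi> Q) a t = Comp D P (OMap (\<sigma> g) P) (OMap (\<sigma> g) Q) (MMap (\<sigma> g) P Q a) (\<xi> P) t"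
    using ind.trace_elementD(3)[OF assms(1), of P Q a] assms(2-4) by simp
  then show ?thesis using assms(5) by simp
qed

text \<open>If \<open>s\<^sup>-\<^sup>1gs \<notin> H\<close>, then \<open>g\<^sup>-\<^sup>1s\<close> is not in \<open>sH\<close>. The endomorphism of \<open>P\<close> that is the identity at \<open>s\<close> and zero off
\<open>sH\<close> is therefore zero at \<open>g\<^sup>-\<^sup>1s\<close>, and naturality with respect to it gives \<open>\<xi> P s = 0\<close>.\<close>

lemma trace_shift_vanishes:
  assumes \<xi>: "\<xi> \<in> carrier (cat_trace D (\<sigma> g))" and [simp]: "P \<in> ind_ob G H V \<rho>"
    "g \<in> carrier G" "s \<in> carrier G" and off: "conjugate s g \<notin> H"
  shows "\<xi> P s = \<zero>\<^bsub>Hom V (fst P s) (fst P (inv g \<otimes> s))\<^esub>"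
proof -
  \<comment> \<open>the idempotent of \<open>P\<close> that cuts out the coset \<open>sH\<close>\<close>
  let ?e = "extend s P P (Id V (fst P s))"
  note [simp] = trace_shift_in(2)[OF \<xi>]
  have "inv (conjugate s g) \<notin> H"
    using off H_closed(2)[of "inv (conjugate s g)"] by (auto simp: conjugate_in)
  then have "inv s \<otimes> (inv g \<otimes> s) \<notin> H"
    by (simp add: conjugate_def inv_mult_group m_assoc)
  then have e: "?e (inv g \<otimes> s) = \<zero>\<^bsub>Hom V (fst P (inv g \<otimes> s)) (fst P (inv g \<otimes> s))\<^esub>"
    by (simp add: extend_off)
  have "\<xi> P s = Comp V (fst P s) (fst P s) (fst P (inv g \<otimes> s)) (\<xi> P s) (?e s)"
    by (simp add: extend_at)
  also have "\<dots> = Comp V (fst P s) (fst P (inv g \<otimes> s)) (fst P (inv g \<otimes> s)) (?e (inv g \<otimes> s)) (\<xi> P s)"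
    by (rule trace_shift_natural[OF \<xi>]) (simp_all add: extend_in)
  finally show ?thesis by (simp add: e Comp_linear_simps)
qed

context
  fixes g s
  assumes g [simp]: "g \<in> carrier G" and s [simp]: "s \<in> carrier G"
    and conj [simp]: "conjugate s g \<in> H"
begin

abbreviation \<gamma> where "\<gamma> \<equiv> conjugate s g"

lemma str_conj_is_iso:
  assumes "P \<in> ind_ob G H V \<rho>"
  shows "is_iso V (fst P (inv g \<otimes> s)) (act_ob \<rho> \<gamma> (fst P s)) (snd P (s, inv \<gamma>))"
  using str_is_iso[OF assms s, of "inv \<gamma>"] by (simp add: mult_inv_conjugate)

lemma str_conj_in [simp]:
  assumes "P \<in> ind_ob G H V \<rho>"
  shows "snd P (s, inv \<gamma>) \<in> mor V (fst P (inv g \<otimes> s)) (act_ob \<rho> \<gamma> (fst P s))"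
    and "inv_mor V (fst P (inv g \<otimes> s)) (act_ob \<rho> \<gamma> (fst P s)) (snd P (s, inv \<gamma>)) \<in> mor V (act_ob \<rho> \<gamma> (fst P s)) (fst P (inv g \<otimes> s))"
  using str_conj_is_iso[OF assms] assms by (simp_all add: is_iso_in inv_mor_in)

lemma equivariance_conj:
  assumes "P \<in> ind_ob G H V \<rho>" "Q \<in> ind_ob G H V \<rho>" "a \<in> ind_mor G H V \<rho> P Q"
  shows "Comp V (fst P (inv g \<otimes> s)) (fst Q (inv g \<otimes> s)) (act_ob \<rho> \<gamma> (fst Q s)) (snd Q (s, inv \<gamma>)) (a (inv g \<otimes> s)) =
     Comp V (fst P (inv g \<otimes> s)) (act_ob \<rho> \<gamma> (fst P s)) (act_ob \<rho> \<gamma> (fst Q s))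
       (act_mor \<rho> \<gamma> (fst P s) (fst Q s) (a s)) (snd P (s, inv \<gamma>))"
  using equivariance[OF assms(3) s, of "inv \<gamma>"] by (simp add: mult_inv_conjugate)

lemma germ_in [simp]:
  assumes "\<xi> \<in> carrier (cat_trace D (\<sigma> g))" "P \<in> ind_ob G H V \<rho>"
  shows "germ g s \<xi> P \<in> mor V (fst P s) (act_ob \<rho> \<gamma> (fst P s))"
  using assms trace_shift_in(2)[OF assms] by (simp add: germ_def)

text \<open>A morphism between the values at \<open>s\<close> of two induced objects extends to the objects, so the naturality
of \<open>\<xi>\<close> descends to naturality of its germ at \<open>s\<close> with respect to all such morphisms. In particular the germ
depends only on the value of the object at \<open>s\<close>.\<close>

lemma germ_natural:
  assumes \<xi>: "\<xi> \<in> carrier (cat_trace D (\<sigma> g))" and [simp]: "P \<in> ind_ob G H V \<rho>" "Q \<in> ind_ob G H V \<rho>"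
    and a [simp]: "a \<in> mor V (fst P s) (fst Q s)"
  shows "Comp V (fst P s) (fst Q s) (act_ob \<rho> \<gamma> (fst Q s)) (germ g s \<xi> Q) a =
    Comp V (fst P s) (act_ob \<rho> \<gamma> (fst P s)) (act_ob \<rho> \<gamma> (fst Q s)) (act_mor \<rho> \<gamma> (fst P s) (fst Q s) a) (germ g s \<xi> P)"
proof -
  let ?e = "extend s P Q a" and ?P = "fst P s" and ?Q = "fst Q s"
    and ?P' = "fst P (inv g \<otimes> s)" and ?Q' = "fst Q (inv g \<otimes> s)"
  note [simp] = trace_shift_in(2)[OF \<xi>]
  have e: "?e \<in> ind_mor G H V \<rho> P Q" by (simp add: extend_in)
  note [simp] = ind_mor_in[OF e]
  have "Comp V ?P ?Q (act_ob \<rho> \<gamma> ?Q) (germ g s \<xi> Q) a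
    = Comp V ?P ?Q' (act_ob \<rho> \<gamma> ?Q) (snd Q (s, inv \<gamma>)) (Comp V ?P ?Q ?Q' (\<xi> Q s) (?e s))"
    by (simp add: germ_def Comp_assoc extend_at)
  also have "\<dots> = Comp V ?P ?P' (act_ob \<rho> \<gamma> ?Q) (Comp V ?P' ?Q' (act_ob \<rho> \<gamma> ?Q) (snd Q (s, inv \<gamma>)) (?e (inv g \<otimes> s))) (\<xi> P s)"
    using trace_shift_natural[OF \<xi> _ _ e s] by (simp add: Comp_assoc)
  also have "\<dots> = Comp V ?P (act_ob \<rho> \<gamma> ?P) (act_ob \<rho> \<gamma> ?Q) (act_mor \<rho> \<gamma> ?P ?Q a) (germ g s \<xi> P)"
    using equivariance_conj[OF _ _ e] by (simp add: germ_def Comp_assoc extend_at)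
  finally show ?thesis .
qed

text \<open>The germ is defined on the objects of \<open>V\<close> that are values of induced objects; conjugation by \<open>\<phi>\<^sub>1\<close> transports
it from \<open>\<rho>(1)x\<close> to an arbitrary object \<open>x\<close>.\<close>

definition trace_component where
  "trace_component \<xi> = (\<lambda>x\<in>Ob V.
     Comp V x (act_ob \<rho> \<gamma> (act_ob \<rho> \<one> x)) (act_ob \<rho> \<gamma> x)
       (act_mor \<rho> \<gamma> (act_ob \<rho> \<one> x) x (phi1 \<rho> x))
       (Comp V x (act_ob \<rho> \<one> x) (act_ob \<rho> \<gamma> (act_ob \<rho> \<one> x))
         (germ g s \<xi> (free_ob s x)) (inv_mor V (act_ob \<rho> \<one> x) x (phi1 \<rho> x))))"

lemma germ_free_in:
  assumes "\<xi> \<in> carrier (cat_trace D (\<sigma> g))" "x \<in> Ob V"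
  shows "germ g s \<xi> (free_ob s x) \<in> mor V (act_ob \<rho> \<one> x) (act_ob \<rho> \<gamma> (act_ob \<rho> \<one> x))"
  using germ_in[OF assms(1), of "free_ob s x"] assms(2) by simp

text \<open>Naturality of the germ along \<open>\<phi>\<^sub>1\<close> shows that the choice of the free object is immaterial.\<close>

lemma trace_component_at:
  assumes \<xi>: "\<xi> \<in> carrier (cat_trace D (\<sigma> g))" and [simp]: "P \<in> ind_ob G H V \<rho>"
  shows "trace_component \<xi> (fst P s) = germ g s \<xi> P"
proof -
  let ?x = "fst P s"
  note [simp] = germ_free_in[OF \<xi>]
  let ?o = "act_ob \<rho> \<one> ?x" let ?c = "act_ob \<rho> \<gamma> ?x" and ?j = "inv_mor V ?o ?x (phi1 \<rho> ?x)"
  have "trace_component \<xi> ?x = Comp V ?x ?o ?c (Comp V ?o (act_ob \<rho> \<gamma> ?o) ?c (act_mor \<rho> \<gamma> ?o ?x (phi1 \<rho> ?x))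
      (germ g s \<xi> (free_ob s ?x))) ?j"
    by (simp add: trace_component_def Comp_assoc)
  also have "\<dots> = Comp V ?x ?o ?c (Comp V ?o ?x ?c (germ g s \<xi> P) (phi1 \<rho> ?x)) ?j"
    using germ_natural[OF \<xi>, of "free_ob s ?x" P "phi1 \<rho> ?x"] by simp
  also have "\<dots> = germ g s \<xi> P"
    by (simp add: Comp_assoc inv_mor_right phi1_is_iso germ_in[OF \<xi>])
  finally show ?thesis .
qed

lemma trace_component_in:
  assumes \<xi>: "\<xi> \<in> carrier (cat_trace D (\<sigma> g))"
  shows "trace_component \<xi> \<in> carrier (cat_trace V (act \<rho> \<gamma>))"
proof (rule trace_elementI)
  note [simp] = germ_free_in[OF \<xi>]
  show "trace_component \<xi> \<in> extensional (Ob V)" by (simp add: trace_component_def)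
  show "trace_component \<xi> x \<in> mor V x (act_ob \<rho> \<gamma> x)" if "x \<in> Ob V" for x
    using that by (simp add: trace_component_def)
  show "Comp V x y (act_ob \<rho> \<gamma> y) (trace_component \<xi> y) a =
      Comp V x (act_ob \<rho> \<gamma> x) (act_ob \<rho> \<gamma> y) (act_mor \<rho> \<gamma> x y a) (trace_component \<xi> x)"
    if [simp]: "x \<in> Ob V" "y \<in> Ob V" "a \<in> mor V x y" for x y a
  proof -
    let ?o = "act_ob \<rho> \<one>" and ?c = "act_ob \<rho> \<gamma>" and ?m = "act_mor \<rho> \<gamma>"
    let ?jx = "inv_mor V (?o x) x (phi1 \<rho> x)" and ?jy = "inv_mor V (?o y) y (phi1 \<rho> y)"
    let ?gx = "germ g s \<xi> (free_ob s x)" and ?gy = "germ g s \<xi> (free_ob s y)"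
    \<comment> \<open>the morphism \<open>a\<close> transported to the values at \<open>s\<close> of the free objects on \<open>x\<close> and \<open>y\<close>\<close>
    define b where "b = Comp V (?o x) y (?o y) ?jy (Comp V (?o x) x y a (phi1 \<rho> x))"
    have b [simp]: "b \<in> mor V (?o x) (?o y)" by (simp add: b_def)
    have b1: "Comp V x (?o x) (?o y) b ?jx = Comp V x y (?o y) ?jy a"
      by (simp add: b_def Comp_assoc inv_mor_right phi1_is_iso)
    have b2: "Comp V (?o x) (?o y) y (phi1 \<rho> y) b = Comp V (?o x) x y a (phi1 \<rho> x)"
      unfolding b_def by (rule comp_inv_right) (simp_all add: phi1_is_iso)
    have "Comp V x y (?c y) (trace_component \<xi> y) a = Comp V x (?c (?o y)) (?c y) (?m (?o y) y (phi1 \<rho> y))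
        (Comp V x (?o y) (?c (?o y)) ?gy (Comp V x y (?o y) ?jy a))"
      by (simp add: trace_component_def Comp_assoc)
    also have "\<dots> = Comp V x (?c (?o y)) (?c y) (?m (?o y) y (phi1 \<rho> y))
        (Comp V x (?o x) (?c (?o y)) (Comp V (?o x) (?o y) (?c (?o y)) ?gy b) ?jx)"
      by (simp add: b1[symmetric] Comp_assoc)
    also have "Comp V (?o x) (?o y) (?c (?o y)) ?gy b = Comp V (?o x) (?c (?o x)) (?c (?o y)) (?m (?o x) (?o y) b) ?gx"
      using germ_natural[OF \<xi>, of "free_ob s x" "free_ob s y" b] by simp
    also have "Comp V x (?c (?o y)) (?c y) (?m (?o y) y (phi1 \<rho> y))
        (Comp V x (?o x) (?c (?o y)) (Comp V (?o x) (?c (?o x)) (?c (?o y)) (?m (?o x) (?o y) b) ?gx) ?jx)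
      = Comp V x (?c (?o x)) (?c y) (?m (?o x) y (Comp V (?o x) (?o y) y (phi1 \<rho> y) b))
          (Comp V x (?o x) (?c (?o x)) ?gx ?jx)"
      by (simp add: Comp_assoc act_Comp)
    also have "\<dots> = Comp V x (?c x) (?c y) (?m x y a) (trace_component \<xi> x)"
      by (simp add: b2 trace_component_def Comp_assoc act_Comp)
    finally show ?thesis .
  qed
qed

text \<open>The morphism extended from \<open>s\<close> is the unique one whose germ at \<open>s\<close> is \<open>\<eta>\<close>.\<close>

definition trace_extension where
  "trace_extension \<eta> = (\<lambda>P\<in>ind_ob G H V \<rho>. extend s P (OMap (\<sigma> g) P)
     (Comp V (fst P s) (act_ob \<rho> \<gamma> (fst P s)) (fst P (inv g \<otimes> s))
       (inv_mor V (fst P (inv g \<otimes> s)) (act_ob \<rho> \<gamma> (fst P s)) (snd P (s, inv \<gamma>)))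
       (\<eta> (fst P s))))"

lemma
  assumes \<eta>: "\<eta> \<in> carrier (cat_trace V (act \<rho> \<gamma>))" and [simp]: "P \<in> ind_ob G H V \<rho>"
  shows trace_extension_in_mor: "trace_extension \<eta> P \<in> ind_mor G H V \<rho> P (OMap (\<sigma> g) P)"
    and trace_extension_off: "t \<in> carrier G \<Longrightarrow> inv s \<otimes> t \<notin> H \<Longrightarrow> trace_extension \<eta> P t = \<zero>\<^bsub>Hom V (fst P t) (fst P (inv g \<otimes> t))\<^esub>"
    and germ_trace_extension: "germ g s (trace_extension \<eta>) P = \<eta> (fst P s)"
proof -
  note [simp] = trace_elementD(2)[OF \<eta>]
  show "trace_extension \<eta> P \<in> ind_mor G H V \<rho> P (OMap (\<sigma> g) P)"
    by (simp add: trace_extension_def extend_in)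
  show "t \<in> carrier G \<Longrightarrow> inv s \<otimes> t \<notin> H \<Longrightarrow> trace_extension \<eta> P t = \<zero>\<^bsub>Hom V (fst P t) (fst P (inv g \<otimes> t))\<^esub>"
    by (simp add: trace_extension_def extend_off)
  have at: "trace_extension \<eta> P s = Comp V (fst P s) (act_ob \<rho> \<gamma> (fst P s)) (fst P (inv g \<otimes> s))
       (inv_mor V (fst P (inv g \<otimes> s)) (act_ob \<rho> \<gamma> (fst P s)) (snd P (s, inv \<gamma>))) (\<eta> (fst P s))"
    by (simp add: trace_extension_def extend_at)
  show "germ g s (trace_extension \<eta>) P = \<eta> (fst P s)"
    unfolding germ_def at by (rule comp_inv_right) (simp_all add: str_conj_is_iso)
qed

lemma germ_determines:
  assumes [simp]: "P \<in> ind_ob G H V \<rho>" "Q \<in> ind_ob G H V \<rho>"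
    and a: "a \<in> mor V (fst P s) (fst Q (inv g \<otimes> s))" "b \<in> mor V (fst P s) (fst Q (inv g \<otimes> s))"
    and eq: "Comp V (fst P s) (fst Q (inv g \<otimes> s)) (act_ob \<rho> \<gamma> (fst Q s)) (snd Q (s, inv \<gamma>)) a =
      Comp V (fst P s) (fst Q (inv g \<otimes> s)) (act_ob \<rho> \<gamma> (fst Q s)) (snd Q (s, inv \<gamma>)) b"
  shows "a = b"
  by (rule iso_cancel_left[OF _ _ _ str_conj_is_iso[of Q] a eq]) simp_all

text \<open>Both sides of a naturality square are morphisms of the induced category vanishing off \<open>sH\<close>, so it
suffices to compare their germs at \<open>s\<close>, where naturality of \<open>\<eta>\<close> and equivariance apply.\<close>

lemma trace_extension_in:
  assumes \<eta>: "\<eta> \<in> carrier (cat_trace V (act \<rho> \<gamma>))"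
  shows "trace_extension \<eta> \<in> carrier (cat_trace D (\<sigma> g))"
proof (rule ind.trace_elementI)
  show "trace_extension \<eta> \<in> extensional (Ob D)" by (simp add: trace_extension_def)
  show "trace_extension \<eta> P \<in> mor D P (OMap (\<sigma> g) P)" if "P \<in> Ob D" for P
    using that by (simp add: trace_extension_in_mor[OF \<eta>])
  fix P Q a assume "P \<in> Ob D" "Q \<in> Ob D" "a \<in> mor D P Q"
  then have [simp]: "P \<in> ind_ob G H V \<rho>" "Q \<in> ind_ob G H V \<rho>" and a: "a \<in> ind_mor G H V \<rho> P Q"
    by simp_all
  note [simp] = trace_elementD(2)[OF \<eta>] ind_mor_in[OF a]
  have iP: "\<And>t. t \<in> carrier G \<Longrightarrow> trace_extension \<eta> P t \<in> mor V (fst P t) (fst P (inv g \<otimes> t))"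
    and iQ: "\<And>t. t \<in> carrier G \<Longrightarrow> trace_extension \<eta> Q t \<in> mor V (fst Q t) (fst Q (inv g \<otimes> t))"
    using ind_mor_in[OF trace_extension_in_mor[OF \<eta>, of P]] ind_mor_in[OF trace_extension_in_mor[OF \<eta>, of Q]] by simp_all
  note [simp] = iP[OF s] iQ[OF s]
  have "Comp V (fst P s) (fst Q s) (fst Q (inv g \<otimes> s)) (trace_extension \<eta> Q s) (a s)
    = Comp V (fst P s) (fst P (inv g \<otimes> s)) (fst Q (inv g \<otimes> s)) (a (inv g \<otimes> s)) (trace_extension \<eta> P s)"
  proof (rule germ_determines)
    let ?P = "fst P s" and ?Q = "fst Q s" and ?P' = "fst P (inv g \<otimes> s)" and ?Q' = "fst Q (inv g \<otimes> s)"
    have "Comp V ?P ?Q' (act_ob \<rho> \<gamma> ?Q) (snd Q (s, inv \<gamma>)) (Comp V ?P ?Q ?Q' (trace_extension \<eta> Q s) (a s))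
      = Comp V ?P ?Q (act_ob \<rho> \<gamma> ?Q) (germ g s (trace_extension \<eta>) Q) (a s)"
      by (simp add: germ_def Comp_assoc)
    also have "\<dots> = Comp V ?P (act_ob \<rho> \<gamma> ?P) (act_ob \<rho> \<gamma> ?Q) (act_mor \<rho> \<gamma> ?P ?Q (a s)) (germ g s (trace_extension \<eta>) P)"
      by (simp add: germ_trace_extension[OF \<eta>] trace_elementD(3)[OF \<eta>])
    also have "\<dots> = Comp V ?P ?P' (act_ob \<rho> \<gamma> ?Q)
        (Comp V ?P' (act_ob \<rho> \<gamma> ?P) (act_ob \<rho> \<gamma> ?Q) (act_mor \<rho> \<gamma> ?P ?Q (a s)) (snd P (s, inv \<gamma>))) (trace_extension \<eta> P s)"
      by (simp add: germ_def Comp_assoc)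
    also have "\<dots> = Comp V ?P ?Q' (act_ob \<rho> \<gamma> ?Q) (snd Q (s, inv \<gamma>)) (Comp V ?P ?P' ?Q' (a (inv g \<otimes> s)) (trace_extension \<eta> P s))"
      by (simp add: equivariance_conj[OF _ _ a, symmetric] Comp_assoc)
    finally show "Comp V ?P ?Q' (act_ob \<rho> \<gamma> ?Q) (snd Q (s, inv \<gamma>)) (Comp V ?P ?Q ?Q' (trace_extension \<eta> Q s) (a s)) =
      Comp V ?P ?Q' (act_ob \<rho> \<gamma> ?Q) (snd Q (s, inv \<gamma>)) (Comp V ?P ?P' ?Q' (a (inv g \<otimes> s)) (trace_extension \<eta> P s))" .
  qed simp_all
  moreover have "Comp V (fst P t) (fst Q t) (fst Q (inv g \<otimes> t)) (trace_extension \<eta> Q t) (a t)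
    = Comp V (fst P t) (fst P (inv g \<otimes> t)) (fst Q (inv g \<otimes> t)) (a (inv g \<otimes> t)) (trace_extension \<eta> P t)"
    if "t \<in> carrier G" "inv s \<otimes> t \<notin> H" for t
    using that by (simp add: trace_extension_off[OF \<eta>] Comp_linear_simps)
  moreover have "Comp D P Q (OMap (\<sigma> g) Q) (trace_extension \<eta> Q) a \<in> mor D P (OMap (\<sigma> g) Q)"
    by (rule ind.Comp_in) (use a in \<open>simp_all add: trace_extension_in_mor[OF \<eta>]\<close>)
  moreover have "Comp D P (OMap (\<sigma> g) P) (OMap (\<sigma> g) Q) (MMap (\<sigma> g) P Q a) (trace_extension \<eta> P) \<in> mor D P (OMap (\<sigma> g) Q)"
    by (rule ind.Comp_in) (use a in \<open>simp_all add: trace_extension_in_mor[OF \<eta>]\<close>)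
  ultimately show "Comp D P Q (OMap (\<sigma> g) Q) (trace_extension \<eta> Q) a =
      Comp D P (OMap (\<sigma> g) P) (OMap (\<sigma> g) Q) (MMap (\<sigma> g) P Q a) (trace_extension \<eta> P)"
    by (intro ind_mor_eqI_support[of P "OMap (\<sigma> g) Q" s]) simp_all
qed

end

lemma trace_component_module_hom:
  assumes "g \<in> carrier G" "s \<in> carrier G" "conjugate s g \<in> H"
  shows "trace_component g s \<in> LinearCombinations.module_hom class_ring (cat_trace D (\<sigma> g)) (cat_trace V (act \<rho> (conjugate s g)))"
proof (rule module_homI)
  note [simp] = assms germ_free_in[OF assms] trace_shift_in(2)[OF _ _ assms(1)] str_conj_in[OF assms]
  interpret Tr: vectorspace "class_ring :: 'k ring" "cat_trace D (\<sigma> g)"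
    by (rule ind.vectorspace_cat_trace[OF shift_functor[OF assms(1)]])
  have P: "free_ob s x \<in> ind_ob G H V \<rho>" "inv g \<otimes> s \<in> carrier G" if "x \<in> Ob V" for x using that by simp_all
  have germ_add: "germ g s (\<xi> \<oplus>\<^bsub>cat_trace D (\<sigma> g)\<^esub> \<xi>') P =
      germ g s \<xi> P \<oplus>\<^bsub>Hom V (fst P s) (act_ob \<rho> (conjugate s g) (fst P s))\<^esub> germ g s \<xi>' P"
    if "\<xi> \<in> carrier (cat_trace D (\<sigma> g))" "\<xi>' \<in> carrier (cat_trace D (\<sigma> g))" "P \<in> ind_ob G H V \<rho>" for \<xi> \<xi>' P
    using that by (simp add: germ_def cat_trace_def Comp_linear_simps trace_shift_in(2)[unfolded cat_trace_def])
  have germ_smult: "germ g s (c \<odot>\<^bsub>cat_trace D (\<sigma> g)\<^esub> \<xi>) P =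
      c \<odot>\<^bsub>Hom V (fst P s) (act_ob \<rho> (conjugate s g) (fst P s))\<^esub> germ g s \<xi> P"
    if "\<xi> \<in> carrier (cat_trace D (\<sigma> g))" "P \<in> ind_ob G H V \<rho>" for c \<xi> P
    using that by (simp add: germ_def cat_trace_def Comp_linear_simps trace_shift_in(2)[unfolded cat_trace_def])
  fix \<xi> assume \<xi> [simp]: "\<xi> \<in> carrier (cat_trace D (\<sigma> g))"
  show "trace_component g s \<xi> \<in> carrier (cat_trace V (act \<rho> (conjugate s g)))"
    by (rule trace_component_in[OF assms \<xi>])
  show "trace_component g s (c \<odot>\<^bsub>cat_trace D (\<sigma> g)\<^esub> \<xi>) = c \<odot>\<^bsub>cat_trace V (act \<rho> (conjugate s g))\<^esub> trace_component g s \<xi>" for c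
    by (auto simp: cat_trace_def[of V] trace_component_def[OF assms] germ_smult Comp_linear_simps intro!: restrict_ext)
  fix \<xi>' assume \<xi>' [simp]: "\<xi>' \<in> carrier (cat_trace D (\<sigma> g))"
  show "trace_component g s (\<xi> \<oplus>\<^bsub>cat_trace D (\<sigma> g)\<^esub> \<xi>')
    = trace_component g s \<xi> \<oplus>\<^bsub>cat_trace V (act \<rho> (conjugate s g))\<^esub> trace_component g s \<xi>'"
    by (auto simp: cat_trace_def[of V] trace_component_def[OF assms] germ_add Comp_linear_simps intro!: restrict_ext)
qed

lemma extend_linear:
  assumes [simp]: "P \<in> ind_ob G H V \<rho>" "Q \<in> ind_ob G H V \<rho>" "s \<in> carrier G" "a \<in> mor V (fst P s) (fst Q s)"
  shows "b \<in> mor V (fst P s) (fst Q s) \<Longrightarrow>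
      extend s P Q (a \<oplus>\<^bsub>Hom V (fst P s) (fst Q s)\<^esub> b) = extend s P Q a \<oplus>\<^bsub>Hom D P Q\<^esub> extend s P Q b"
    and "extend s P Q (c \<odot>\<^bsub>Hom V (fst P s) (fst Q s)\<^esub> a) = c \<odot>\<^bsub>Hom D P Q\<^esub> extend s P Q a"
proof -
  show "extend s P Q (a \<oplus>\<^bsub>Hom V (fst P s) (fst Q s)\<^esub> b) = extend s P Q a \<oplus>\<^bsub>Hom D P Q\<^esub> extend s P Q b"
    if [simp]: "b \<in> mor V (fst P s) (fst Q s)"
  proof (rule ind_mor_eqI_support[of P Q s])
    show "extend s P Q a \<oplus>\<^bsub>Hom D P Q\<^esub> extend s P Q b \<in> ind_mor G H V \<rho> P Q"
      using ind.Hom_closed(2)[of P Q "extend s P Q a" "extend s P Q b"] by (simp add: extend_in)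
  qed (simp_all add: extend_in extend_at extend_off Hom_zero_simps)
  show "extend s P Q (c \<odot>\<^bsub>Hom V (fst P s) (fst Q s)\<^esub> a) = c \<odot>\<^bsub>Hom D P Q\<^esub> extend s P Q a"
  proof (rule ind_mor_eqI_support[of P Q s])
    show "c \<odot>\<^bsub>Hom D P Q\<^esub> extend s P Q a \<in> ind_mor G H V \<rho> P Q"
      using ind.Hom_closed(3)[of P Q "extend s P Q a" c] by (simp add: extend_in)
  qed (simp_all add: extend_in extend_at extend_off Hom_zero_simps)
qed

lemma trace_extension_module_hom:
  assumes "g \<in> carrier G" "s \<in> carrier G" "conjugate s g \<in> H"
  shows "trace_extension g s \<in> LinearCombinations.module_hom class_ring (cat_trace V (act \<rho> (conjugate s g))) (cat_trace D (\<sigma> g))"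
proof (rule module_homI)
  note [simp] = assms str_conj_in[OF assms]
  fix \<eta> assume \<eta> [simp]: "\<eta> \<in> carrier (cat_trace V (act \<rho> (conjugate s g)))"
  note [simp] = trace_elementD(2)[OF \<eta>]
  show "trace_extension g s \<eta> \<in> carrier (cat_trace D (\<sigma> g))" by (rule trace_extension_in[OF assms \<eta>])
  show "trace_extension g s (c \<odot>\<^bsub>cat_trace V (act \<rho> (conjugate s g))\<^esub> \<eta>) = c \<odot>\<^bsub>cat_trace D (\<sigma> g)\<^esub> trace_extension g s \<eta>" for c
  proof -
    have "extend s P (OMap (\<sigma> g) P) (c \<odot>\<^bsub>Hom V (fst P s) (fst P (inv g \<otimes> s))\<^esub> a)
      = c \<odot>\<^bsub>Hom D P (OMap (\<sigma> g) P)\<^esub> extend s P (OMap (\<sigma> g) P) a"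
      if "P \<in> ind_ob G H V \<rho>" "a \<in> mor V (fst P s) (fst P (inv g \<otimes> s))" for P a
      using extend_linear(2)[of P "OMap (\<sigma> g) P" s a c] that by simp
    then show ?thesis
      by (simp add: cat_trace_def trace_extension_def[OF assms] Comp_linear_simps del: ind_cat_simps(2-) cong: restrict_cong)
  qed
  fix \<eta>' assume \<eta>' [simp]: "\<eta>' \<in> carrier (cat_trace V (act \<rho> (conjugate s g)))"
  note [simp] = trace_elementD(2)[OF \<eta>']
  show "trace_extension g s (\<eta> \<oplus>\<^bsub>cat_trace V (act \<rho> (conjugate s g))\<^esub> \<eta>') = trace_extension g s \<eta> \<oplus>\<^bsub>cat_trace D (\<sigma> g)\<^esub> trace_extension g s \<eta>'"
  proof -
    have "extend s P (OMap (\<sigma> g) P) (a \<oplus>\<^bsub>Hom V (fst P s) (fst P (inv g \<otimes> s))\<^esub> b)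
      = extend s P (OMap (\<sigma> g) P) a \<oplus>\<^bsub>Hom D P (OMap (\<sigma> g) P)\<^esub> extend s P (OMap (\<sigma> g) P) b"
      if "P \<in> ind_ob G H V \<rho>" "a \<in> mor V (fst P s) (fst P (inv g \<otimes> s))" "b \<in> mor V (fst P s) (fst P (inv g \<otimes> s))" for P a b
      using extend_linear(1)[of P "OMap (\<sigma> g) P" s a b] that by simp
    then show ?thesis
      by (simp add: cat_trace_def trace_extension_def[OF assms] Comp_linear_simps del: ind_cat_simps(2-) cong: restrict_cong)
  qed
qed

text \<open>Extending the component at \<open>s\<close> recovers the restriction of \<open>\<xi>\<close> to \<open>sH\<close>: both are morphisms of the induced
category on this coset with the same germ at \<open>s\<close>.\<close>

lemma extension_of_component:
  assumes "g \<in> carrier G" "s \<in> carrier G" "conjugate s g \<in> H"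
    and \<xi>: "\<xi> \<in> carrier (cat_trace D (\<sigma> g))" and P: "P \<in> ind_ob G H V \<rho>" and t: "t \<in> carrier G"
  shows "trace_extension g s (trace_component g s \<xi>) P t = (if inv s \<otimes> t \<in> H then \<xi> P t else \<zero>\<^bsub>Hom V (fst P t) (fst P (inv g \<otimes> t))\<^esub>)"
proof -
  note g = assms(1-3) and [simp] = assms(1-3) P t
  note \<eta> = trace_component_in[OF g \<xi>]
  have i: "trace_extension g s (trace_component g s \<xi>) P \<in> ind_mor G H V \<rho> P (OMap (\<sigma> g) P)" by (rule trace_extension_in_mor[OF g \<eta> P])
  have "trace_extension g s (trace_component g s \<xi>) P s = \<xi> P s"
  proof (rule germ_determines[OF g P P])
    have "germ g s (trace_extension g s (trace_component g s \<xi>)) P = germ g s \<xi> P"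
      by (simp add: germ_trace_extension[OF g \<eta>] trace_component_at[OF g \<xi>])
    then show "Comp V (fst P s) (fst P (inv g \<otimes> s)) (act_ob \<rho> (conjugate s g) (fst P s)) (snd P (s, inv (conjugate s g)))
        (trace_extension g s (trace_component g s \<xi>) P s) =
      Comp V (fst P s) (fst P (inv g \<otimes> s)) (act_ob \<rho> (conjugate s g) (fst P s)) (snd P (s, inv (conjugate s g))) (\<xi> P s)"
      by (simp add: germ_def)
  qed (use ind_mor_in[OF i, of s] trace_shift_in(2)[OF \<xi>] in simp_all)
  then show ?thesis
    using ind_mor_eq_coset[OF P _ _ i trace_shift_in(1)[OF \<xi>], of s t] trace_extension_off[OF g \<eta> P t] by simp
qed

lemma card_coset_reps:
  assumes "t \<in> carrier G" "conjugate t g \<in> H" "g \<in> carrier G"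
  shows "card {s \<in> carrier G. conjugate s g \<in> H \<and> inv s \<otimes> t \<in> H} = card H"
proof (rule bij_betw_same_card[symmetric])
  have conj: "conjugate (t \<otimes> inv h) g \<in> H" if "h \<in> H" for h
  proof -
    have "conjugate (t \<otimes> inv h) g = h \<otimes> conjugate t g \<otimes> inv h"
      using assms that by (simp add: conjugate_def inv_mult_group m_assoc)
    then show ?thesis using assms that by simp
  qed
  show "bij_betw (\<lambda>h. t \<otimes> inv h) H {s \<in> carrier G. conjugate s g \<in> H \<and> inv s \<otimes> t \<in> H}"
    by (rule bij_betw_byWitness[where f' = "\<lambda>s. inv s \<otimes> t"])
      (use assms conj in \<open>auto simp: inv_mult_group m_assoc right_inv_assoc\<close>)
qed

text \<open>At a point \<open>t\<close> the sum has one summand \<open>\<xi> P t\<close> for every \<open>s\<close> with \<open>s\<^sup>-\<^sup>1gs \<in> H\<close> and \<open>t \<in> sH\<close>. There are \<open>|H|\<close>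
such \<open>s\<close> if \<open>t\<^sup>-\<^sup>1gt \<in> H\<close>, and otherwise \<open>\<xi> P t\<close> is zero.\<close>

lemma trace_resolution:
  assumes card: "of_nat (card H) \<noteq> (0 :: 'k)" and g: "g \<in> carrier G" and \<xi>: "\<xi> \<in> carrier (cat_trace D (\<sigma> g))"
  shows "\<xi> = (1 / of_nat (card H)) \<odot>\<^bsub>cat_trace D (\<sigma> g)\<^esub>
    finsum (cat_trace D (\<sigma> g)) (\<lambda>s. trace_extension g s (trace_component g s \<xi>)) {s \<in> carrier G. conjugate s g \<in> H}"
    (is "_ = _ \<odot>\<^bsub>?T\<^esub> finsum _ ?f ?I")
proof -
  have T: "vectorspace class_ring ?T" by (rule ind.vectorspace_cat_trace[OF shift_functor[OF g]])
  interpret T: vectorspace "class_ring :: 'k ring" ?T by (rule T)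
  have I: "finite ?I" using finite_G by simp
  have f: "?f s \<in> carrier ?T" if "s \<in> ?I" for s
    using trace_extension_in[OF g] trace_component_in[OF g] \<xi> that by simp
  then have S: "finsum ?T ?f ?I \<in> carrier ?T" by (intro T.finsum_closed) auto
  show ?thesis
  proof (rule ind.trace_element_eqI[OF \<xi>])
    show "(1 / of_nat (card H)) \<odot>\<^bsub>?T\<^esub> finsum ?T ?f ?I \<in> carrier ?T" using S by simp
    fix P assume "P \<in> Ob D"
    then have P [simp]: "P \<in> ind_ob G H V \<rho>" by simp
    note [simp] = g
    have Hom: "vectorspace class_ring (Hom D P (OMap (\<sigma> g) P))" by (rule ind.vectorspace_Hom) simp_all
    have fP: "?f s P \<in> mor D P (OMap (\<sigma> g) P)" if "s \<in> ?I" for s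
      using ind.trace_elementD(2)[OF f[OF that], of P] by simp
    show "\<xi> P = ((1 / of_nat (card H)) \<odot>\<^bsub>?T\<^esub> finsum ?T ?f ?I) P"
    proof (rule ind_mor_eqI[OF trace_shift_in(1)[OF \<xi>] trace_shift_in(1)])
      show "(1 / of_nat (card H)) \<odot>\<^bsub>?T\<^esub> finsum ?T ?f ?I \<in> carrier ?T" using S by simp
      fix t assume [simp]: "t \<in> carrier G"
      let ?U = "Hom V (fst P t) (fst P (inv g \<otimes> t))"
      have U: "vectorspace class_ring ?U" by (rule vectorspace_Hom) simp_all
      interpret U: vectorspace "class_ring :: 'k ring" ?U by (rule U)
      have \<xi>t: "\<xi> P t \<in> carrier ?U" using trace_shift_in(2)[OF \<xi>] by simp
      have eval: "(\<lambda>a. a t) \<in> LinearCombinations.module_hom class_ring (Hom D P (OMap (\<sigma> g) P)) ?U"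
        by (rule module_homI) (use ind_mor_in[of _ P "OMap (\<sigma> g) P"] in auto)
      have "finsum ?T ?f ?I P t = finsum (Hom D P (OMap (\<sigma> g) P)) (\<lambda>s. ?f s P) ?I t"
        using module_hom_finsum[OF ind.eval_trace_module_hom[of P "\<sigma> g"] T Hom I, of ?f] f by auto
      also have "\<dots> = finsum ?U (\<lambda>s. ?f s P t) ?I"
        by (rule module_hom_finsum[OF eval Hom U I]) (use fP in auto)
      also have "\<dots> = finsum ?U (\<lambda>s. if inv s \<otimes> t \<in> H then \<xi> P t else \<zero>\<^bsub>?U\<^esub>) ?I"
        by (rule U.finsum_cong') (use extension_of_component[OF g _ _ \<xi>] \<xi>t in auto)
      also have "\<dots> = of_nat (card {s \<in> ?I. inv s \<otimes> t \<in> H}) \<odot>\<^bsub>?U\<^esub> \<xi> P t"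
        by (rule finsum_const_on[OF U \<xi>t I])
      also have "\<dots> = of_nat (card H) \<odot>\<^bsub>?U\<^esub> \<xi> P t"
      proof (cases "conjugate t g \<in> H")
        case True
        then show ?thesis using card_coset_reps[of t g] by (simp add: conj_assoc)
      next
        case False
        then have "\<xi> P t = \<zero>\<^bsub>?U\<^esub>" by (intro trace_shift_vanishes[OF \<xi>]) simp_all
        then show ?thesis by (simp add: Hom_zero_simps)
      qed
      finally have sum: "finsum ?T ?f ?I P t = of_nat (card H) \<odot>\<^bsub>?U\<^esub> \<xi> P t" .
      have "((1 / of_nat (card H)) \<odot>\<^bsub>?T\<^esub> finsum ?T ?f ?I) P t = (1 / of_nat (card H)) \<odot>\<^bsub>?U\<^esub> finsum ?T ?f ?I P t"
        by (simp add: cat_trace_def)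
      also have "\<dots> = \<xi> P t"
        using U.smult_assoc1[of "1 / of_nat (card H)" "of_nat (card H)" "\<xi> P t"] \<xi>t card
          U.smult_one[OF \<xi>t] by (simp add: sum)
      finally show "\<xi> P t = ((1 / of_nat (card H)) \<odot>\<^bsub>?T\<^esub> finsum ?T ?f ?I) P t" by simp
    qed simp_all
  qed
qed

section \<open>The conjugation operators\<close>

lemma phi_inv_is_iso:
  assumes "\<kappa> \<in> H" "x \<in> Ob V"
  shows "is_iso V (act_ob \<rho> \<kappa> (act_ob \<rho> (inv \<kappa>) x)) (act_ob \<rho> \<one> x) (phi \<rho> \<kappa> (inv \<kappa>) x)"
  using phi_is_iso[of \<kappa> "inv \<kappa>" x] assms by simp

lemma psi_unfold:
  assumes "\<kappa> \<in> H" "\<delta> \<in> H" "\<kappa> \<otimes> \<delta> \<otimes> inv \<kappa> = \<delta>" "x \<in> Ob V"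
  shows "psi (G\<lparr>carrier := H\<rparr>) V \<rho> \<delta> \<kappa> \<eta> x =
    Comp V x (act_ob \<rho> \<kappa> (act_ob \<rho> \<delta> (act_ob \<rho> (inv \<kappa>) x))) (act_ob \<rho> \<delta> x)
      (Comp V (act_ob \<rho> \<kappa> (act_ob \<rho> \<delta> (act_ob \<rho> (inv \<kappa>) x))) (act_ob \<rho> (\<kappa> \<otimes> \<delta>) (act_ob \<rho> (inv \<kappa>) x)) (act_ob \<rho> \<delta> x)
        (phi \<rho> (\<kappa> \<otimes> \<delta>) (inv \<kappa>) x) (phi \<rho> \<kappa> \<delta> (act_ob \<rho> (inv \<kappa>) x)))
      (Comp V x (act_ob \<rho> \<kappa> (act_ob \<rho> (inv \<kappa>) x)) (act_ob \<rho> \<kappa> (act_ob \<rho> \<delta> (act_ob \<rho> (inv \<kappa>) x)))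
        (act_mor \<rho> \<kappa> (act_ob \<rho> (inv \<kappa>) x) (act_ob \<rho> \<delta> (act_ob \<rho> (inv \<kappa>) x)) (\<eta> (act_ob \<rho> (inv \<kappa>) x)))
        (Comp V x (act_ob \<rho> \<one> x) (act_ob \<rho> \<kappa> (act_ob \<rho> (inv \<kappa>) x))
          (inv_mor V (act_ob \<rho> \<kappa> (act_ob \<rho> (inv \<kappa>) x)) (act_ob \<rho> \<one> x) (phi \<rho> \<kappa> (inv \<kappa>) x))
          (inv_mor V (act_ob \<rho> \<one> x) x (phi1 \<rho> x))))"
  using assms by (simp add: psi_def phi3_def Let_def)

lemma psi_in_trace:
  assumes [simp]: "\<kappa> \<in> H" "\<delta> \<in> H" and fix_\<delta>: "\<kappa> \<otimes> \<delta> \<otimes> inv \<kappa> = \<delta>"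
    and \<eta>: "\<eta> \<in> carrier (cat_trace V (act \<rho> \<delta>))"
  shows "psi (G\<lparr>carrier := H\<rparr>) V \<rho> \<delta> \<kappa> \<eta> \<in> carrier (cat_trace V (act \<rho> \<delta>))"
proof (rule trace_elementI)
  let ?o = "act_ob \<rho> \<one>" and ?K = "act_ob \<rho> \<kappa>" and ?K' = "act_ob \<rho> (inv \<kappa>)" and ?C = "act_ob \<rho> \<delta>"
    and ?KC = "act_ob \<rho> (\<kappa> \<otimes> \<delta>)"
  note [simp] = trace_elementD(2)[OF \<eta>]
  have [simp]: "phi \<rho> (\<kappa> \<otimes> \<delta>) (inv \<kappa>) x \<in> mor V (?KC (?K' x)) (?C x)" if "x \<in> Ob V" for x
    using phi_in[of "\<kappa> \<otimes> \<delta>" "inv \<kappa>" x] that by (simp add: fix_\<delta>)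
  have [simp]: "inv_mor V (?K (?K' x)) (?o x) (phi \<rho> \<kappa> (inv \<kappa>) x) \<in> mor V (?o x) (?K (?K' x))"
    if "x \<in> Ob V" for x
    using that by (intro inv_mor_in phi_inv_is_iso) simp_all
  show "psi (G\<lparr>carrier := H\<rparr>) V \<rho> \<delta> \<kappa> \<eta> \<in> extensional (Ob V)" by (simp add: psi_def)
  show "psi (G\<lparr>carrier := H\<rparr>) V \<rho> \<delta> \<kappa> \<eta> x \<in> mor V x (?C x)" if "x \<in> Ob V" for x
    using that by (simp add: psi_unfold fix_\<delta>)
  fix x y a assume [simp]: "x \<in> Ob V" "y \<in> Ob V" "a \<in> mor V x y"
  let ?a = "act_mor \<rho> (inv \<kappa>) x y a"
  have 1: "Comp V x y (?o y) (inv_mor V (?o y) y (phi1 \<rho> y)) a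
    = Comp V x (?o x) (?o y) (act_mor \<rho> \<one> x y a) (inv_mor V (?o x) x (phi1 \<rho> x))"
    by (rule inverse_square) (simp_all add: phi1_is_iso phi1_natural)
  have 2: "Comp V (?o x) (?o y) (?K (?K' y)) (inv_mor V (?K (?K' y)) (?o y) (phi \<rho> \<kappa> (inv \<kappa>) y)) (act_mor \<rho> \<one> x y a)
    = Comp V (?o x) (?K (?K' x)) (?K (?K' y)) (act_mor \<rho> \<kappa> (?K' x) (?K' y) ?a)
        (inv_mor V (?K (?K' x)) (?o x) (phi \<rho> \<kappa> (inv \<kappa>) x))"
    using phi_natural[of \<kappa> "inv \<kappa>" x y a]
    by (intro inverse_square) (simp_all add: phi_inv_is_iso)
  have 3: "Comp V (?K (?K' x)) (?K (?K' y)) (?K (?C (?K' y))) (act_mor \<rho> \<kappa> (?K' y) (?C (?K' y)) (\<eta> (?K' y)))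
        (act_mor \<rho> \<kappa> (?K' x) (?K' y) ?a)
    = Comp V (?K (?K' x)) (?K (?C (?K' x))) (?K (?C (?K' y))) (act_mor \<rho> \<kappa> (?C (?K' x)) (?C (?K' y)) (act_mor \<rho> \<delta> (?K' x) (?K' y) ?a))
        (act_mor \<rho> \<kappa> (?K' x) (?C (?K' x)) (\<eta> (?K' x)))"
    using trace_elementD(3)[OF \<eta>, of "?K' x" "?K' y" ?a] by (simp flip: act_Comp)
  have 4: "Comp V (?K (?C (?K' x))) (?K (?C (?K' y))) (?KC (?K' y)) (phi \<rho> \<kappa> \<delta> (?K' y))
        (act_mor \<rho> \<kappa> (?C (?K' x)) (?C (?K' y)) (act_mor \<rho> \<delta> (?K' x) (?K' y) ?a))
    = Comp V (?K (?C (?K' x))) (?KC (?K' x)) (?KC (?K' y)) (act_mor \<rho> (\<kappa> \<otimes> \<delta>) (?K' x) (?K' y) ?a) (phi \<rho> \<kappa> \<delta> (?K' x))"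
    by (rule phi_natural) simp_all
  have 5: "Comp V (?KC (?K' x)) (?KC (?K' y)) (?C y) (phi \<rho> (\<kappa> \<otimes> \<delta>) (inv \<kappa>) y) (act_mor \<rho> (\<kappa> \<otimes> \<delta>) (?K' x) (?K' y) ?a)
    = Comp V (?KC (?K' x)) (?C x) (?C y) (act_mor \<rho> \<delta> x y a) (phi \<rho> (\<kappa> \<otimes> \<delta>) (inv \<kappa>) x)"
    using phi_natural[of "\<kappa> \<otimes> \<delta>" "inv \<kappa>" x y a] by (simp add: fix_\<delta>)
  show "Comp V x y (?C y) (psi (G\<lparr>carrier := H\<rparr>) V \<rho> \<delta> \<kappa> \<eta> y) a =
      Comp V x (?C x) (?C y) (act_mor \<rho> \<delta> x y a) (psi (G\<lparr>carrier := H\<rparr>) V \<rho> \<delta> \<kappa> \<eta> x)"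
    unfolding psi_unfold[OF assms(1-3) \<open>x \<in> Ob V\<close>] psi_unfold[OF assms(1-3) \<open>y \<in> Ob V\<close>]
    by (rule paste_squares[OF _ _ _ _ _ _ _ _ _ _ _ _ _
          paste_squares[OF _ _ _ _ _ _ _ _ _ _ _ _ _ paste_squares[OF _ _ _ _ _ _ _ _ _ _ _ _ _ 1 2] 3]
          paste_squares[OF _ _ _ _ _ _ _ _ _ _ _ _ _ 4 5]]) simp_all
qed

text \<open>As the induced action is strict, the operator \<open>\<psi>(h)\<close> is plain transport of structure.\<close>

lemma psi_ind:
  assumes [simp]: "g \<in> carrier G" "h \<in> carrier G" and \<xi>: "\<xi> \<in> carrier (cat_trace D (\<sigma> g))"
  shows "psi G D (ind_action G H V \<rho>) g h \<xi> =
    (\<lambda>P\<in>ind_ob G H V \<rho>. \<lambda>t\<in>carrier G. \<xi> (OMap (\<sigma> (inv h)) P) (inv h \<otimes> t))"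
proof -
  have "psi G D (ind_action G H V \<rho>) g h \<xi> P = (\<lambda>t\<in>carrier G. \<xi> (OMap (\<sigma> (inv h)) P) (inv h \<otimes> t))"
    if P [simp]: "P \<in> ind_ob G H V \<rho>" for P
  proof -
    define P' where "P' = OMap (\<sigma> (inv h)) P"
    define Q where "Q = OMap (\<sigma> (h \<otimes> g \<otimes> inv h)) P"
    have [simp]: "P' \<in> ind_ob G H V \<rho>" "Q \<in> ind_ob G H V \<rho>" by (simp_all add: P'_def Q_def)
    have obs: "OMap (\<sigma> \<one>) P = P" "OMap (\<sigma> h) P' = P" "OMap (\<sigma> (h \<otimes> g)) P' = Q" "OMap (\<sigma> h) (OMap (\<sigma> g) P') = Q"
      "OMap (\<sigma> (h \<otimes> g \<otimes> inv h)) P = Q"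
      by (simp_all add: P'_def Q_def shift_strict m_assoc)
    have in_mor: "MMap (\<sigma> h) P' (OMap (\<sigma> g) P') (\<xi> P') \<in> mor D P Q"
      using shift_mor_in[of h P' "OMap (\<sigma> g) P'" "\<xi> P'"] trace_shift_in(1)[OF \<xi>, of P'] by (simp add: obs)
    have "psi G D (ind_action G H V \<rho>) g h \<xi> P = MMap (\<sigma> h) P' (OMap (\<sigma> g) P') (\<xi> P')"
      using in_mor ind.Comp_Id_left[of P Q] ind.Comp_Id_right[of P Q] ind.Comp_Id_left[of Q Q] ind.Comp_Id_left[of P P]
        ind.Id_in ind.inv_mor_Id[of P]
      by (simp add: psi_def phi3_def Let_def ind_action_def P'_def[symmetric] obs del: ind_cat_simps(2-) shift_simps)
    then show ?thesis by (simp add: P'_def)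
  qed
  then show ?thesis
    by (intro extensionalityI[where A = "ind_ob G H V \<rho>"]) (simp_all add: psi_def)
qed

lemma psi_ind_module_hom:
  assumes g [simp]: "g \<in> carrier G" and h [simp]: "h \<in> carrier G" and comm: "g \<otimes> h = h \<otimes> g"
  shows "psi G D (ind_action G H V \<rho>) g h \<in> LinearCombinations.module_hom class_ring (cat_trace D (\<sigma> g)) (cat_trace D (\<sigma> g))"
proof (rule module_homI)
  have hg: "h \<otimes> (inv g \<otimes> (inv h \<otimes> t)) = inv g \<otimes> t" if "t \<in> carrier G" for t
  proof -
    have "h \<otimes> inv g = inv g \<otimes> h"
      using comm by (metis g h inv_closed inv_solve_left inv_solve_right m_assoc m_closed)
    then have "h \<otimes> (inv g \<otimes> (inv h \<otimes> t)) = inv g \<otimes> h \<otimes> (inv h \<otimes> t)"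
      using that by (subst m_assoc[symmetric]) simp_all
    also have "\<dots> = inv g \<otimes> t" using that by (simp add: m_assoc right_inv_assoc)
    finally show ?thesis .
  qed
  show "psi G D (ind_action G H V \<rho>) g h \<xi> \<in> carrier (cat_trace D (\<sigma> g))"
    if \<xi>: "\<xi> \<in> carrier (cat_trace D (\<sigma> g))" for \<xi>
    unfolding psi_ind[OF g h \<xi>]
  proof (rule ind.trace_elementI)
    have "(\<lambda>t\<in>carrier G. \<xi> (OMap (\<sigma> (inv h)) P) (inv h \<otimes> t)) \<in> ind_mor G H V \<rho> P (OMap (\<sigma> g) P)"
      if [simp]: "P \<in> ind_ob G H V \<rho>" for P
    proof -
      have "OMap (\<sigma> h) (OMap (\<sigma> g) (OMap (\<sigma> (inv h)) P)) = OMap (\<sigma> g) P"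
        using comm by (simp add: shift_strict m_assoc[symmetric]) (simp add: m_assoc flip: comm)
      moreover have "OMap (\<sigma> h) (OMap (\<sigma> (inv h)) P) = P" by (simp add: shift_strict)
      ultimately show ?thesis
        using shift_mor_in[of h _ _ "\<xi> (OMap (\<sigma> (inv h)) P)"] trace_shift_in(1)[OF \<xi>, of "OMap (\<sigma> (inv h)) P"]
        by (metis g h inv_closed shift_in that)
    qed
    then show "(\<lambda>P\<in>ind_ob G H V \<rho>. \<lambda>t\<in>carrier G. \<xi> (OMap (\<sigma> (inv h)) P) (inv h \<otimes> t)) P \<in> mor D P (OMap (\<sigma> g) P)"
      if "P \<in> Ob D" for P using that by simp
    fix P Q a assume "P \<in> Ob D" "Q \<in> Ob D" "a \<in> mor D P Q"
    then have [simp]: "P \<in> ind_ob G H V \<rho>" "Q \<in> ind_ob G H V \<rho>" and a: "a \<in> ind_mor G H V \<rho> P Q" by simp_all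
    have "Comp V (fst P t) (fst Q t) (fst Q (inv g \<otimes> t)) (\<xi> (OMap (\<sigma> (inv h)) Q) (inv h \<otimes> t)) (a t) =
      Comp V (fst P t) (fst P (inv g \<otimes> t)) (fst Q (inv g \<otimes> t)) (a (inv g \<otimes> t)) (\<xi> (OMap (\<sigma> (inv h)) P) (inv h \<otimes> t))"
      if [simp]: "t \<in> carrier G" for t
      using trace_shift_natural[OF \<xi> _ _ shift_mor_in[OF _ _ _ a, of "inv h"], of "inv h \<otimes> t"]
      by (simp add: hg right_inv_assoc)
    then show "Comp D P Q (OMap (\<sigma> g) Q) ((\<lambda>P\<in>ind_ob G H V \<rho>. \<lambda>t\<in>carrier G. \<xi> (OMap (\<sigma> (inv h)) P) (inv h \<otimes> t)) Q) a =
      Comp D P (OMap (\<sigma> g) P) (OMap (\<sigma> g) Q) (MMap (\<sigma> g) P Q a) ((\<lambda>P\<in>ind_ob G H V \<rho>. \<lambda>t\<in>carrier G. \<xi> (OMap (\<sigma> (inv h)) P) (inv h \<otimes> t)) P)"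
      by (auto intro!: restrict_ext)
  qed simp
  interpret Tr: vectorspace "class_ring :: 'k ring" "cat_trace D (\<sigma> g)"
    by (rule ind.vectorspace_cat_trace[OF shift_functor[OF g]])
  fix \<xi> assume \<xi>: "\<xi> \<in> carrier (cat_trace D (\<sigma> g))"
  have "c \<odot>\<^bsub>cat_trace D (\<sigma> g)\<^esub> \<xi> \<in> carrier (cat_trace D (\<sigma> g))" for c using \<xi> by simp
  then show "psi G D (ind_action G H V \<rho>) g h (c \<odot>\<^bsub>cat_trace D (\<sigma> g)\<^esub> \<xi>)
    = c \<odot>\<^bsub>cat_trace D (\<sigma> g)\<^esub> psi G D (ind_action G H V \<rho>) g h \<xi>" for c
    by (simp add: psi_ind \<xi>) (auto simp: cat_trace_def hg right_inv_assoc intro!: restrict_ext)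
  fix \<xi>' assume \<xi>': "\<xi>' \<in> carrier (cat_trace D (\<sigma> g))"
  then have "\<xi> \<oplus>\<^bsub>cat_trace D (\<sigma> g)\<^esub> \<xi>' \<in> carrier (cat_trace D (\<sigma> g))" using \<xi> by simp
  then show "psi G D (ind_action G H V \<rho>) g h (\<xi> \<oplus>\<^bsub>cat_trace D (\<sigma> g)\<^esub> \<xi>')
    = psi G D (ind_action G H V \<rho>) g h \<xi> \<oplus>\<^bsub>cat_trace D (\<sigma> g)\<^esub> psi G D (ind_action G H V \<rho>) g h \<xi>'"
    by (simp add: psi_ind \<xi> \<xi>') (auto simp: cat_trace_def hg right_inv_assoc intro!: restrict_ext)
qed

text \<open>The calculation that matches the induced operator with the one of \<open>\<rho>\<close>. For an induced object
\<open>(f, u)\<close> and \<open>\<delta> = s\<^sup>-\<^sup>1gs\<close>, \<open>\<kappa> = s\<^sup>-\<^sup>1hs\<close> in \<open>H\<close>, it is applied to \<open>p0 = f(s)\<close>, \<open>p1 = f(s\<kappa>)\<close>, \<open>p2 = f(s\<kappa>\<delta>\<^sup>-\<^sup>1)\<close>,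
\<open>p3 = f(s\<delta>\<^sup>-\<^sup>1)\<close> and the structure isomorphisms \<open>w\<close>, \<open>v\<close>, \<open>y\<close>, \<open>z\<close> between them. The long expression on the left
is the cocycle expansion of \<open>u\<close> at \<open>\<delta>\<^sup>-\<^sup>1 = \<kappa>\<delta>\<^sup>-\<^sup>1\<kappa>\<^sup>-\<^sup>1\<close>; \<open>e\<close> is the value at \<open>s\<close> of the
transformation extended from the germ \<open>\<eta>\<close>, on the object shifted by \<open>h\<^sup>-\<^sup>1\<close>, and \<open>e'\<close> is its value at \<open>s\<kappa>\<^sup>-\<^sup>1\<close>. Stating it for abstract objects and morphisms
keeps the group computations apart from the diagram chase.\<close>

lemma psi_from_cocycle:
  fixes p0 p1 p2 p3 :: 'o
  assumes H [simp]: "\<kappa> \<in> H" "\<delta> \<in> H" and fix_\<delta>: "\<kappa> \<otimes> \<delta> \<otimes> inv \<kappa> = \<delta>"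
    and \<eta>: "\<eta> \<in> carrier (cat_trace V (act \<rho> \<delta>))"
    and [simp]: "p0 \<in> Ob V" "p1 \<in> Ob V" "p2 \<in> Ob V" "p3 \<in> Ob V"
    and w [simp]: "w \<in> mor V p1 (act_ob \<rho> (inv \<kappa>) p0)"
    and v [simp]: "v \<in> mor V p0 (act_ob \<rho> \<kappa> p1)"
    and y [simp]: "y \<in> mor V p2 (act_ob \<rho> \<delta> p1)"
    and z [simp]: "z \<in> mor V p3 (act_ob \<rho> \<kappa> p2)"
    and e' [simp]: "e' \<in> mor V p0 p3" and e [simp]: "e \<in> mor V p1 p2"
    and yY: "Comp V p1 p2 (act_ob \<rho> \<delta> p1) y e = \<eta> p1"
    and zX: "Comp V p0 p3 (act_ob \<rho> \<kappa> p2) z e' = Comp V p0 (act_ob \<rho> \<kappa> p1) (act_ob \<rho> \<kappa> p2) (act_mor \<rho> \<kappa> p1 p2 e) v"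
    and unit: "inv_mor V (act_ob \<rho> \<one> p0) p0 (phi1 \<rho> p0) =
      Comp V p0 (act_ob \<rho> \<kappa> (act_ob \<rho> (inv \<kappa>) p0)) (act_ob \<rho> \<one> p0) (phi \<rho> \<kappa> (inv \<kappa>) p0)
        (Comp V p0 (act_ob \<rho> \<kappa> p1) (act_ob \<rho> \<kappa> (act_ob \<rho> (inv \<kappa>) p0)) (act_mor \<rho> \<kappa> p1 (act_ob \<rho> (inv \<kappa>) p0) w) v)"
  shows "Comp V p0 p3 (act_ob \<rho> \<delta> p0)
     (Comp V p3 (act_ob \<rho> \<kappa> (act_ob \<rho> (\<delta> \<otimes> inv \<kappa>) p0)) (act_ob \<rho> \<delta> p0) (phi \<rho> \<kappa> (\<delta> \<otimes> inv \<kappa>) p0)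
       (Comp V p3 (act_ob \<rho> \<kappa> p2) (act_ob \<rho> \<kappa> (act_ob \<rho> (\<delta> \<otimes> inv \<kappa>) p0))
         (act_mor \<rho> \<kappa> p2 (act_ob \<rho> (\<delta> \<otimes> inv \<kappa>) p0)
           (Comp V p2 (act_ob \<rho> \<delta> (act_ob \<rho> (inv \<kappa>) p0)) (act_ob \<rho> (\<delta> \<otimes> inv \<kappa>) p0) (phi \<rho> \<delta> (inv \<kappa>) p0)
             (Comp V p2 (act_ob \<rho> \<delta> p1) (act_ob \<rho> \<delta> (act_ob \<rho> (inv \<kappa>) p0))
               (act_mor \<rho> \<delta> p1 (act_ob \<rho> (inv \<kappa>) p0) w) y)))
         z))
     e' = psi (G\<lparr>carrier := H\<rparr>) V \<rho> \<delta> \<kappa> \<eta> p0"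
  (is "Comp V p0 p3 ?d0 (Comp V p3 ?q ?d0 ?f (Comp V p3 ?r2 ?q (act_mor \<rho> \<kappa> p2 ?q' (Comp V p2 ?dk ?q' ?f' (Comp V p2 ?d1 ?dk ?dw y))) z)) e' = _")
proof -
  let ?k = "act_ob \<rho> (inv \<kappa>) p0" and ?K = "act_ob \<rho> \<kappa>" and ?m = "act_mor \<rho> \<kappa>"
  note [simp] = trace_elementD(2)[OF \<eta>]
  have fix_\<delta>': "\<kappa> \<otimes> (\<delta> \<otimes> inv \<kappa>) = \<delta>" using fix_\<delta> by (simp add: m_assoc)
  have [simp]: "?f \<in> mor V ?q ?d0"
    using phi_in[of \<kappa> "\<delta> \<otimes> inv \<kappa>" p0, unfolded fix_\<delta>'] by simp
  have "Comp V p0 p3 ?d0 (Comp V p3 ?q ?d0 ?f (Comp V p3 ?r2 ?q (?m p2 ?q' (Comp V p2 ?dk ?q' ?f' (Comp V p2 ?d1 ?dk ?dw y))) z)) e'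
    = Comp V p0 ?q ?d0 ?f (Comp V p0 (?K ?dk) ?q (?m ?dk ?q' ?f')
        (Comp V p0 (?K ?d1) (?K ?dk) (?m ?d1 ?dk ?dw) (Comp V p0 ?r2 (?K ?d1) (?m p2 ?d1 y) (Comp V p0 p3 ?r2 z e'))))"
    by (simp add: Comp_assoc act_Comp)
  also have "Comp V p0 ?r2 (?K ?d1) (?m p2 ?d1 y) (Comp V p0 p3 ?r2 z e') = Comp V p0 (?K p1) (?K ?d1) (?m p1 ?d1 (\<eta> p1)) v"
    unfolding zX yY[symmetric] by (simp add: Comp_assoc act_Comp)
  also have "Comp V p0 (?K ?d1) (?K ?dk) (?m ?d1 ?dk ?dw) (Comp V p0 (?K p1) (?K ?d1) (?m p1 ?d1 (\<eta> p1)) v)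
    = Comp V p0 (?K p1) (?K ?dk) (?m p1 ?dk (Comp V p1 ?d1 ?dk ?dw (\<eta> p1))) v"
    by (simp add: Comp_assoc act_Comp)
  also have "Comp V p1 ?d1 ?dk ?dw (\<eta> p1) = Comp V p1 ?k ?dk (\<eta> ?k) w"
    by (rule trace_elementD(3)[OF \<eta>, symmetric]) simp_all
  also have "Comp V p0 (?K p1) (?K ?dk) (?m p1 ?dk (Comp V p1 ?k ?dk (\<eta> ?k) w)) v
    = Comp V p0 (?K ?k) (?K ?dk) (?m ?k ?dk (\<eta> ?k)) (Comp V p0 (?K p1) (?K ?k) (?m p1 ?k w) v)"
    by (simp add: Comp_assoc act_Comp)
  also have "Comp V p0 (?K p1) (?K ?k) (?m p1 ?k w) v
    = Comp V p0 (act_ob \<rho> \<one> p0) (?K ?k) (inv_mor V (?K ?k) (act_ob \<rho> \<one> p0) (phi \<rho> \<kappa> (inv \<kappa>) p0))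
        (inv_mor V (act_ob \<rho> \<one> p0) p0 (phi1 \<rho> p0))"
    unfolding unit by (rule comp_inv_left[symmetric]) (simp_all add: phi_inv_is_iso)
  also have "Comp V p0 ?q ?d0 ?f (Comp V p0 (?K ?dk) ?q (?m ?dk ?q' ?f') (Comp V p0 (?K ?k) (?K ?dk) (?m ?k ?dk (\<eta> ?k))
        (Comp V p0 (act_ob \<rho> \<one> p0) (?K ?k) (inv_mor V (?K ?k) (act_ob \<rho> \<one> p0) (phi \<rho> \<kappa> (inv \<kappa>) p0))
        (inv_mor V (act_ob \<rho> \<one> p0) p0 (phi1 \<rho> p0)))))
    = Comp V p0 (?K ?dk) ?d0 (Comp V (?K ?dk) ?q ?d0 ?f (?m ?dk ?q' ?f')) (Comp V p0 (?K ?k) (?K ?dk) (?m ?k ?dk (\<eta> ?k))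
        (Comp V p0 (act_ob \<rho> \<one> p0) (?K ?k) (inv_mor V (?K ?k) (act_ob \<rho> \<one> p0) (phi \<rho> \<kappa> (inv \<kappa>) p0))
        (inv_mor V (act_ob \<rho> \<one> p0) p0 (phi1 \<rho> p0))))"
    using inv_mor_in[OF _ _ phi_inv_is_iso[of \<kappa> p0]] by (simp add: Comp_assoc)
  also have "Comp V (?K ?dk) ?q ?d0 ?f (?m ?dk ?q' ?f') = Comp V (?K ?dk) (act_ob \<rho> (\<kappa> \<otimes> \<delta>) ?k) ?d0 (phi \<rho> (\<kappa> \<otimes> \<delta>) (inv \<kappa>) p0) (phi \<rho> \<kappa> \<delta> ?k)"
    using phi_assoc_H[of \<kappa> \<delta> "inv \<kappa>" p0] fix_\<delta> by (simp add: m_assoc)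
  finally show ?thesis unfolding psi_unfold[OF H fix_\<delta> \<open>p0 \<in> Ob V\<close>] .
qed

lemma conjugate_mult:
  assumes "s \<in> carrier G" "g \<in> carrier G"
  shows "h \<in> carrier G \<Longrightarrow> conjugate s g \<otimes> conjugate s h = conjugate s (g \<otimes> h)"
    and "s \<otimes> conjugate s g = g \<otimes> s"
  using assms by (simp_all add: conjugate_def inv_mult_group m_assoc right_inv_assoc)

text \<open>The operator \<open>\<psi>(h)\<close> takes the value at \<open>s\<close> from the value at \<open>h\<^sup>-\<^sup>1s\<close> of the transformation on the shifted object.
For a transformation supported on \<open>sH\<close> this is zero unless \<open>h\<^sup>-\<^sup>1s \<in> sH\<close>, that is, unless \<open>s\<^sup>-\<^sup>1hs \<in> H\<close>.\<close>

lemma germ_psi_extension: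
  assumes g [simp]: "g \<in> carrier G" and h [simp]: "h \<in> carrier G" and s [simp]: "s \<in> carrier G"
    and comm: "g \<otimes> h = h \<otimes> g" and conj: "conjugate s g \<in> H"
    and \<eta>: "\<eta> \<in> carrier (cat_trace V (act \<rho> (conjugate s g)))" and P [simp]: "P \<in> ind_ob G H V \<rho>"
  shows "germ g s (psi G D (ind_action G H V \<rho>) g h (trace_extension g s \<eta>)) P =
    (if conjugate s h \<in> H then psi (G\<lparr>carrier := H\<rparr>) V \<rho> (conjugate s g) (conjugate s h) \<eta> (fst P s)
     else \<zero>\<^bsub>Hom V (fst P s) (act_ob \<rho> (conjugate s g) (fst P s))\<^esub>)"
proof -
  let ?i = "trace_extension g s \<eta>"
  define Q where "Q = OMap (\<sigma> (inv h)) P"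
  define \<delta> \<kappa> where "\<delta> = conjugate s g" and "\<kappa> = conjugate s h"
  note i_in = trace_extension_in[OF g s conj \<eta>]
  have Q [simp]: "Q \<in> ind_ob G H V \<rho>" by (simp add: Q_def)
  have Q_fst: "t \<in> carrier G \<Longrightarrow> fst Q t = fst P (h \<otimes> t)"
    and Q_snd: "t \<in> carrier G \<Longrightarrow> k \<in> H \<Longrightarrow> snd Q (t, k) = snd P (h \<otimes> t, k)" for t k
    by (simp_all add: Q_def)
  have psi_s: "psi G D (ind_action G H V \<rho>) g h ?i P s = ?i Q (inv h \<otimes> s)"
    by (simp add: psi_ind[OF g h i_in] Q_def)
  have [simp]: "\<delta> \<in> H" "\<delta> \<in> carrier G" "\<kappa> \<in> carrier G" using conj by (simp_all add: \<delta>_def \<kappa>_def conjugate_in)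
  have hg: "h \<otimes> inv g = inv g \<otimes> h"
    using comm by (metis g h inv_closed inv_solve_left inv_solve_right m_assoc m_closed)
  have hgh: "h \<otimes> (inv g \<otimes> (inv h \<otimes> s)) = inv g \<otimes> s"
    by (simp add: m_assoc[symmetric] hg) (simp add: m_assoc right_inv_assoc)
  have tr: "s \<otimes> inv \<delta> = inv g \<otimes> s" "s \<otimes> inv \<kappa> = inv h \<otimes> s" "s \<otimes> \<kappa> = h \<otimes> s"
    by (simp_all add: \<delta>_def \<kappa>_def mult_inv_conjugate conjugate_mult)
  show ?thesis
  proof (cases "\<kappa> \<in> H")
    case False
    then have "inv \<kappa> \<notin> H" using H_closed(2)[of "inv \<kappa>"] by auto
    then have "inv s \<otimes> (inv h \<otimes> s) \<notin> H" by (simp flip: tr(2) add: left_inv_assoc)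
    then have "?i Q (inv h \<otimes> s) = \<zero>\<^bsub>Hom V (fst P s) (fst P (inv g \<otimes> s))\<^esub>"
      using trace_extension_off[OF g s conj \<eta> Q, of "inv h \<otimes> s"] by (simp add: Q_fst hgh right_inv_assoc)
    then show ?thesis
      using False str_conj_in[OF g s conj P] conj by (simp add: germ_def psi_s Comp_linear_simps \<kappa>_def)
  next
    case True
    note [simp] = True
    \<comment> \<open>the points \<open>s\<close>, \<open>s\<kappa>\<close>, \<open>s\<kappa>\<delta>\<^sup>-\<^sup>1\<close> and \<open>s\<delta>\<^sup>-\<^sup>1\<close>, rewritten by \<open>s\<kappa> = hs\<close> and \<open>s\<delta>\<^sup>-\<^sup>1 = g\<^sup>-\<^sup>1s\<close>\<close>
    let ?p0 = "fst P s" and ?p1 = "fst P (h \<otimes> s)" and ?p2 = "fst P (h \<otimes> (inv g \<otimes> s))" and ?p3 = "fst P (inv g \<otimes> s)"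
    have comm': "\<kappa> \<otimes> \<delta> = \<delta> \<otimes> \<kappa>" by (simp add: \<kappa>_def \<delta>_def conjugate_mult comm)
    have fix_\<delta>: "\<kappa> \<otimes> \<delta> \<otimes> inv \<kappa> = \<delta>" by (simp add: comm' m_assoc)
    have s1: "h \<otimes> s \<otimes> inv \<kappa> = s" "h \<otimes> s \<otimes> inv \<delta> = h \<otimes> (inv g \<otimes> s)"
      by (simp_all add: tr m_assoc right_inv_assoc)
    have s2: "h \<otimes> (inv g \<otimes> s) \<otimes> inv \<kappa> = inv g \<otimes> s"
      by (simp add: tr m_assoc hgh)
    have w: "snd P (s, \<kappa>) \<in> mor V ?p1 (act_ob \<rho> (inv \<kappa>) ?p0)"
      using str_in[OF P s True] by (simp add: tr)
    have v: "snd P (h \<otimes> s, inv \<kappa>) \<in> mor V ?p0 (act_ob \<rho> \<kappa> ?p1)"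
      using str_in[OF P, of "h \<otimes> s" "inv \<kappa>"] by (simp add: s1)
    have y: "snd P (h \<otimes> s, inv \<delta>) \<in> mor V ?p2 (act_ob \<rho> \<delta> ?p1)"
      using str_in[OF P, of "h \<otimes> s" "inv \<delta>"] by (simp add: s1)
    have z: "snd P (h \<otimes> (inv g \<otimes> s), inv \<kappa>) \<in> mor V ?p3 (act_ob \<rho> \<kappa> ?p2)"
      using str_in[OF P, of "h \<otimes> (inv g \<otimes> s)" "inv \<kappa>"] by (simp add: s2)
    have iQ: "?i Q \<in> ind_mor G H V \<rho> Q (OMap (\<sigma> g) Q)" by (rule trace_extension_in_mor[OF g s conj \<eta> Q])
    have e': "?i Q (inv h \<otimes> s) \<in> mor V ?p0 ?p3"
      using ind_mor_in[OF iQ, of "inv h \<otimes> s"] by (simp add: Q_fst hgh right_inv_assoc)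
    have e: "?i Q s \<in> mor V ?p1 ?p2"
      using ind_mor_in[OF iQ s] by (simp add: Q_fst)
    have yY: "Comp V ?p1 ?p2 (act_ob \<rho> \<delta> ?p1) (snd P (h \<otimes> s, inv \<delta>)) (?i Q s) = \<eta> ?p1"
      using germ_trace_extension[OF g s conj \<eta> Q] by (simp add: germ_def Q_fst Q_snd flip: \<delta>_def)
    have zX: "Comp V ?p0 ?p3 (act_ob \<rho> \<kappa> ?p2) (snd P (h \<otimes> (inv g \<otimes> s), inv \<kappa>)) (?i Q (inv h \<otimes> s)) =
      Comp V ?p0 (act_ob \<rho> \<kappa> ?p1) (act_ob \<rho> \<kappa> ?p2) (act_mor \<rho> \<kappa> ?p1 ?p2 (?i Q s)) (snd P (h \<otimes> s, inv \<kappa>))"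
      using equivariance[OF iQ s, of "inv \<kappa>"] by (simp add: tr Q_fst Q_snd hgh right_inv_assoc)
    \<comment> \<open>the cocycle identity for \<open>1 = \<kappa>\<kappa>\<^sup>-\<^sup>1\<close>\<close>
    have unit: "inv_mor V (act_ob \<rho> \<one> ?p0) ?p0 (phi1 \<rho> ?p0) =
      Comp V ?p0 (act_ob \<rho> \<kappa> (act_ob \<rho> (inv \<kappa>) ?p0)) (act_ob \<rho> \<one> ?p0) (phi \<rho> \<kappa> (inv \<kappa>) ?p0)
        (Comp V ?p0 (act_ob \<rho> \<kappa> ?p1) (act_ob \<rho> \<kappa> (act_ob \<rho> (inv \<kappa>) ?p0))
          (act_mor \<rho> \<kappa> ?p1 (act_ob \<rho> (inv \<kappa>) ?p0) (snd P (s, \<kappa>))) (snd P (h \<otimes> s, inv \<kappa>)))"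
      using str_mult'[OF P s, of \<kappa> "inv \<kappa>"] by (simp add: str_one tr)
    \<comment> \<open>two applications of the cocycle identity, along \<open>\<delta>\<^sup>-\<^sup>1 = (\<kappa>\<delta>\<^sup>-\<^sup>1)\<kappa>\<^sup>-\<^sup>1\<close>\<close>
    have u1: "snd P (s, \<kappa> \<otimes> inv \<delta>) =
      Comp V ?p2 (act_ob \<rho> \<delta> (act_ob \<rho> (inv \<kappa>) ?p0)) (act_ob \<rho> (\<delta> \<otimes> inv \<kappa>) ?p0) (phi \<rho> \<delta> (inv \<kappa>) ?p0)
        (Comp V ?p2 (act_ob \<rho> \<delta> ?p1) (act_ob \<rho> \<delta> (act_ob \<rho> (inv \<kappa>) ?p0))
          (act_mor \<rho> \<delta> ?p1 (act_ob \<rho> (inv \<kappa>) ?p0) (snd P (s, \<kappa>))) (snd P (h \<otimes> s, inv \<delta>)))"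
    proof -
      have "s \<otimes> (\<kappa> \<otimes> inv \<delta>) = h \<otimes> (inv g \<otimes> s)" by (simp add: m_assoc[symmetric] tr(3)) (simp add: s1 m_assoc tr)
      then show ?thesis using str_mult'[OF P s, of \<kappa> "inv \<delta>"] by (simp add: tr)
    qed
    have u2: "snd P (s, inv \<delta>) =
      Comp V ?p3 (act_ob \<rho> \<kappa> (act_ob \<rho> (\<delta> \<otimes> inv \<kappa>) ?p0)) (act_ob \<rho> \<delta> ?p0) (phi \<rho> \<kappa> (\<delta> \<otimes> inv \<kappa>) ?p0)
        (Comp V ?p3 (act_ob \<rho> \<kappa> ?p2) (act_ob \<rho> \<kappa> (act_ob \<rho> (\<delta> \<otimes> inv \<kappa>) ?p0))
          (act_mor \<rho> \<kappa> ?p2 (act_ob \<rho> (\<delta> \<otimes> inv \<kappa>) ?p0) (snd P (s, \<kappa> \<otimes> inv \<delta>)))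
          (snd P (h \<otimes> (inv g \<otimes> s), inv \<kappa>)))"
    proof -
      have a: "\<kappa> \<otimes> inv \<delta> \<otimes> inv \<kappa> = inv \<delta>"
        using arg_cong[OF fix_\<delta>, of "\<lambda>x. inv x"] by (simp add: inv_mult_group m_assoc)
      have b: "inv (\<kappa> \<otimes> inv \<delta>) = \<delta> \<otimes> inv \<kappa>" by (simp add: inv_mult_group)
      have c: "\<kappa> \<otimes> (\<delta> \<otimes> inv \<kappa>) = \<delta>" using fix_\<delta> by (simp add: m_assoc)
      have d: "s \<otimes> (\<kappa> \<otimes> inv \<delta>) = h \<otimes> (inv g \<otimes> s)" by (simp add: m_assoc[symmetric] tr(3)) (simp add: s1 m_assoc tr)
      show ?thesis using str_mult'[OF P s, of "\<kappa> \<otimes> inv \<delta>" "inv \<kappa>"] by (simp add: a b c d tr)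
    qed
    have "Comp V ?p0 ?p3 (act_ob \<rho> \<delta> ?p0) (snd P (s, inv \<delta>)) (?i Q (inv h \<otimes> s)) =
      psi (G\<lparr>carrier := H\<rparr>) V \<rho> \<delta> \<kappa> \<eta> ?p0"
      unfolding u2 u1
      by (rule psi_from_cocycle[OF True \<open>\<delta> \<in> H\<close> fix_\<delta> \<eta>[folded \<delta>_def] _ _ _ _ w v y z e' e yY zX unit])
        simp_all
    then show ?thesis using True by (simp add: germ_def psi_s \<delta>_def \<kappa>_def)
  qed
qed

text \<open>An element of \<open>Tr(\<rho>(\<gamma>))\<close> is determined by its values on the objects \<open>\<rho>(1)x\<close>, which are values of free
objects, because it is natural along \<open>\<phi>\<^sub>1\<close>. So the comparison of germs suffices.\<close>

lemma component_psi_extension: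
  assumes g: "g \<in> carrier G" and h: "h \<in> carrier G" and s: "s \<in> carrier G"
    and comm: "g \<otimes> h = h \<otimes> g" and conj: "conjugate s g \<in> H"
    and \<eta>: "\<eta> \<in> carrier (cat_trace V (act \<rho> (conjugate s g)))"
  shows "trace_component g s (psi G D (ind_action G H V \<rho>) g h (trace_extension g s \<eta>)) =
    (if conjugate s h \<in> H then psi (G\<lparr>carrier := H\<rparr>) V \<rho> (conjugate s g) (conjugate s h) \<eta>
     else \<zero>\<^bsub>cat_trace V (act \<rho> (conjugate s g))\<^esub>)" (is "_ = ?r")
proof -
  let ?T = "psi G D (ind_action G H V \<rho>) g h (trace_extension g s \<eta>)" and ?c = "act_ob \<rho> (conjugate s g)"
  have T: "?T \<in> carrier (cat_trace D (\<sigma> g))"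
    by (rule module_homD(1)[OF psi_ind_module_hom[OF g h comm] trace_extension_in[OF g s conj \<eta>]])
  interpret W: vectorspace "class_ring :: 'k ring" "cat_trace V (act \<rho> (conjugate s g))"
    by (rule vectorspace_cat_trace[OF act_functor_H[OF conj]])
  have r: "?r \<in> carrier (cat_trace V (act \<rho> (conjugate s g)))"
  proof (cases "conjugate s h \<in> H")
    case True
    have "conjugate s h \<otimes> conjugate s g = conjugate s g \<otimes> conjugate s h"
      using s g h by (simp add: conjugate_mult comm)
    then have "conjugate s h \<otimes> conjugate s g \<otimes> inv (conjugate s h) = conjugate s g"
      using s g h by (simp add: m_assoc conjugate_in)
    then show ?thesis using True psi_in_trace[OF True conj _ \<eta>] by simp
  qed simp
  have germ: "germ g s ?T P = ?r (fst P s)" if "P \<in> ind_ob G H V \<rho>" for P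
    using germ_psi_extension[OF g h s comm conj \<eta> that] that s by (simp add: cat_trace_def)
  show ?thesis
  proof (rule trace_element_eqI[OF trace_component_in[OF g s conj T] r])
    fix x assume [simp]: "x \<in> Ob V"
    note [simp] = s conj trace_elementD(2)[OF r]
    let ?o = "act_ob \<rho> \<one> x" let ?j = "inv_mor V ?o x (phi1 \<rho> x)"
    have "trace_component g s ?T x = Comp V x (?c ?o) (?c x) (act_mor \<rho> (conjugate s g) ?o x (phi1 \<rho> x))
       (Comp V x ?o (?c ?o) (?r ?o) ?j)"
      using germ[of "free_ob s x"] by (simp add: trace_component_def[OF g s conj])
    also have "\<dots> = Comp V x ?o (?c x) (Comp V ?o (?c ?o) (?c x) (act_mor \<rho> (conjugate s g) ?o x (phi1 \<rho> x)) (?r ?o)) ?j"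
      by (rule Comp_assoc[symmetric]) simp_all
    also have "\<dots> = Comp V x ?o (?c x) (Comp V ?o x (?c x) (?r x) (phi1 \<rho> x)) ?j"
      by (subst trace_elementD(3)[OF r]) simp_all
    also have "\<dots> = Comp V x x (?c x) (?r x) (Comp V x ?o x (phi1 \<rho> x) ?j)"
      by (rule Comp_assoc) simp_all
    also have "\<dots> = ?r x"
      using trace_elementD(2)[OF r, of x] by (simp add: inv_mor_right phi1_is_iso del: if_split)
    finally show "trace_component g s ?T x = ?r x" .
  qed
qed

end

section \<open>The induced 2-character\<close>

theorem corollary7p6:
  fixes G :: "('g, 'b) monoid_scheme" (structure)
    and H :: "'g set"
    and V :: "('o, 'm, 'k::field_char_0) lincat"
    and \<rho> :: "('g, 'o, 'm) cat_action"
  assumes "contains_all_roots_of_unity TYPE('k)"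
    and "group G" and "finite (carrier G)" and "subgroup H G"
    and "linear_category V"
    and "linear_action (G\<lparr>carrier := H\<rparr>) V \<rho>"
    and "\<And>h. h \<in> H \<Longrightarrow> vectorspace.fin_dim class_ring (cat_trace V (act \<rho> h))"
  shows "(\<forall>g\<in>carrier G.
            vectorspace.fin_dim class_ring (cat_trace (ind_cat G H V \<rho>) (act (ind_action G H V \<rho>) g))) \<and>
         (\<forall>g\<in>carrier G. \<forall>h\<in>carrier G. g \<otimes> h = h \<otimes> g \<longrightarrow>
            two_character G (ind_cat G H V \<rho>) (ind_action G H V \<rho>) g h =
              1 / of_nat (card H) *
              (\<Sum>s | s \<in> carrier G \<and> inv s \<otimes> g \<otimes> s \<in> H \<and> inv s \<otimes> h \<otimes> s \<in> H.
                 two_character (G\<lparr>carrier := H\<rparr>) V \<rho> (inv s \<otimes> g \<otimes> s) (inv s \<otimes> h \<otimes> s)))"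
proof -
  interpret induced_action G H V \<rho>
    using assms by (simp add: induced_action_def induced_action_axioms_def)
  have "finite H" using finite_G subgroup.subset[OF subgroup_H] by (rule rev_finite_subset)
  then have card: "of_nat (card H) \<noteq> (0 :: 'k)" using H_closed(3) by (auto simp: card_eq_0_iff simp del: H_closed)
  have act: "act (ind_action G H V \<rho>) g = \<sigma> g" for g by (simp add: ind_action_def)
  define I where "I g = {s \<in> carrier G. conjugate s g \<in> H}" for g
  have I: "finite (I g)" for g using finite_G by (simp add: I_def)
  have W: "vectorspace class_ring (cat_trace V (act \<rho> (conjugate s g)))"
    "vectorspace.fin_dim class_ring (cat_trace V (act \<rho> (conjugate s g)))" if "s \<in> I g" for s g
    using that vectorspace_cat_trace[OF act_functor_H] assms(7) by (simp_all add: I_def)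
  show ?thesis
  proof (intro conjI ballI impI)
    fix g assume g: "g \<in> carrier G"
    have T: "vectorspace class_ring (cat_trace D (\<sigma> g))"
      by (rule ind.vectorspace_cat_trace[OF shift_functor[OF g]])
    have hom: "trace_extension g s \<in> LinearCombinations.module_hom class_ring (cat_trace V (act \<rho> (conjugate s g))) (cat_trace D (\<sigma> g))"
      "trace_component g s \<in> LinearCombinations.module_hom class_ring (cat_trace D (\<sigma> g)) (cat_trace V (act \<rho> (conjugate s g)))"
      if "s \<in> I g" for s
      using that trace_extension_module_hom[OF g] trace_component_module_hom[OF g] by (simp_all add: I_def)
    note resolution = trace_resolution[OF card g, folded I_def]
    show "vectorspace.fin_dim class_ring (cat_trace D (act (ind_action G H V \<rho>) g))"
      unfolding act by (rule fin_dim_of_resolution[where I = "I g" and W = "\<lambda>s. cat_trace V (act \<rho> (conjugate s g))" and \<iota> = "trace_extension g" and \<pi> = "trace_component g",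
        OF T I W hom resolution])
    fix h assume h: "h \<in> carrier G" and comm: "g \<otimes> h = h \<otimes> g"
    let ?tr = "\<lambda>s. two_character (G\<lparr>carrier := H\<rparr>) V \<rho> (conjugate s g) (conjugate s h)"
    have summand: "lin_trace (cat_trace V (act \<rho> (conjugate s g)))
        (\<lambda>\<eta>. trace_component g s (psi G D (ind_action G H V \<rho>) g h (trace_extension g s \<eta>))) = (if conjugate s h \<in> H then ?tr s else 0)"
      if s: "s \<in> I g" for s
    proof -
      have s': "s \<in> carrier G" "conjugate s g \<in> H" using s by (simp_all add: I_def)
      show ?thesis
        using lin_trace_cong[OF W[OF s] component_psi_extension[OF g h s'(1) comm s'(2)]] lin_trace_zero[OF W[OF s]]
        by (simp add: two_character_def split: if_splits)
    qed
    have "two_character G D (ind_action G H V \<rho>) g h = 1 / of_nat (card H) *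
        (\<Sum>s\<in>I g. lin_trace (cat_trace V (act \<rho> (conjugate s g))) (\<lambda>\<eta>. trace_component g s (psi G D (ind_action G H V \<rho>) g h (trace_extension g s \<eta>))))"
      unfolding two_character_def act
      by (rule lin_trace_of_resolution[where I = "I g" and W = "\<lambda>s. cat_trace V (act \<rho> (conjugate s g))" and \<iota> = "trace_extension g" and \<pi> = "trace_component g",
        OF T I W hom resolution psi_ind_module_hom[OF g h comm]])
    also have "(\<Sum>s\<in>I g. lin_trace (cat_trace V (act \<rho> (conjugate s g))) (\<lambda>\<eta>. trace_component g s (psi G D (ind_action G H V \<rho>) g h (trace_extension g s \<eta>))))
      = (\<Sum>s\<in>I g. if conjugate s h \<in> H then ?tr s else 0)"
      by (rule sum.cong[OF refl summand])
    also have "\<dots> = (\<Sum>s\<in>{s \<in> I g. conjugate s h \<in> H}. ?tr s)"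
      by (rule sum.inter_filter[symmetric, OF I])
    finally show "two_character G D (ind_action G H V \<rho>) g h = 1 / of_nat (card H) *
        (\<Sum>s | s \<in> carrier G \<and> inv s \<otimes> g \<otimes> s \<in> H \<and> inv s \<otimes> h \<otimes> s \<in> H.
           two_character (G\<lparr>carrier := H\<rparr>) V \<rho> (inv s \<otimes> g \<otimes> s) (inv s \<otimes> h \<otimes> s))"
      by (simp add: I_def conjugate_def conj_assoc)
  qed
qed

end
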